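(* Let $\sigma=\{\pi_i \mid i\in I\}$ be a partition of the set of all primes into mutually disjoint subsets, let $G$ be a finite group and let $H$ be a $\sigma^{(3)}$-permutable subgroup of $G$. Then $H^G/H_G$ is $\sigma$-nilpotent.
   Context: All groups are finite. $\sigma=\{\pi_i \mid i\in I\}$ is a partition of the set $\mathbb{P}$ of all primes: $\pi_i\cap\pi_j=\emptyset$ for $i\neq j$ and $\bigcup_{i\in I}\pi_i=\mathbb{P}$. We write $P^x=x^{-1}Px$. $H_G$ denotes the largest normal subgroup of $G$ contained in $H$, and $H^G$ the smallest normal subgroup of $G$ containing $H$. For a set of primes $\pi$, $\mathfrak{G}_\pi$ denotes the class of all finite $\pi$-groups. A subgroup $P$ of $G$ is a $\mathfrak{G}_\pi$-projector of $G$ if, for every normal subgroup $N$ of $G$, $PN/N$ is $\mathfrak{G}_\pi$-maximal in $G/N$, i.e. $PN/N$ is a $\pi$-subgroup of $G/N$ not properly contained in any other $\pi$-subgroup of $G/N$. (Such projectors exist in every finite group.) A subgroup $H$ of $G$ is called $\sigma^{(3)}$-permutable if for every $\pi_i\in\sigma$ there is a $\mathfrak{G}_{\pi_i}$-projector $P$ of $G$ such that $HP^x=P^xH$ for all $x\in G$. A group is called $\sigma$-nilpotent if it is the direct product of its Hall $\pi_i$-subgroups for all $\pi_i\in\sigma$. *)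

theory Defs
  imports "HOL-Algebra.Algebra" "HOL-Library.Disjoint_Sets"
    "HOL-Computational_Algebra.Primes"
begin

text \<open>A partition of the set of all primes, as an indexed family \<open>sigma i\<close> with \<open>i \<in> I\<close>;
  empty members are not excluded.\<close>

definition prime_partition :: "'i set \<Rightarrow> ('i \<Rightarrow> nat set) \<Rightarrow> bool" where
  "prime_partition I sigma \<longleftrightarrow> disjoint_family_on sigma I \<and>
     (\<Union>i\<in>I. sigma i) = {p. Factorial_Ring.prime p}"

definition pi_group :: "nat set \<Rightarrow> ('a, 'b) monoid_scheme \<Rightarrow> bool" where
  "pi_group ps G \<longleftrightarrow>
     group G \<and> finite (carrier G) \<and> (\<forall>p. Factorial_Ring.prime p \<and> p dvd order G \<longrightarrow> p \<in> ps)"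

definition pi_subgroup :: "nat set \<Rightarrow> 'a set \<Rightarrow> ('a, 'b) monoid_scheme \<Rightarrow> bool" where
  "pi_subgroup ps U G \<longleftrightarrow> subgroup U G \<and> pi_group ps (G\<lparr>carrier := U\<rparr>)"

definition pi_maximal :: "nat set \<Rightarrow> 'a set \<Rightarrow> ('a, 'b) monoid_scheme \<Rightarrow> bool" where
  "pi_maximal ps U G \<longleftrightarrow>
     pi_subgroup ps U G \<and> (\<forall>V. pi_subgroup ps V G \<longrightarrow> \<not> U \<subset> V)"

text \<open>In the next definition the set of right cosets of \<open>N\<close> in the subgroup \<open>PN\<close> is \<open>PN/N\<close>,
  regarded as a subset of the carrier of \<open>G/N\<close>.\<close>

definition pi_projector :: "nat set \<Rightarrow> 'a set \<Rightarrow> ('a, 'b) monoid_scheme \<Rightarrow> bool" where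
  "pi_projector ps P G \<longleftrightarrow>
     subgroup P G \<and>
     (\<forall>N. N \<lhd> G \<longrightarrow> pi_maximal ps (rcosets\<^bsub>G\<lparr>carrier := P <#>\<^bsub>G\<^esub> N\<rparr>\<^esub> N) (G Mod N))"

text \<open>\<open>P\<^sup>x = x\<inverse>Px\<close>\<close>

definition conj_set :: "('a, 'b) monoid_scheme \<Rightarrow> 'a set \<Rightarrow> 'a \<Rightarrow> 'a set" where
  "conj_set G P x = (\<lambda>p. inv\<^bsub>G\<^esub> x \<otimes>\<^bsub>G\<^esub> p \<otimes>\<^bsub>G\<^esub> x) ` P"

definition sigma3_permutable ::
  "'i set \<Rightarrow> ('i \<Rightarrow> nat set) \<Rightarrow> 'a set \<Rightarrow> ('a, 'b) monoid_scheme \<Rightarrow> bool" where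
  "sigma3_permutable I sigma H G \<longleftrightarrow>
     subgroup H G \<and>
     (\<forall>i\<in>I. \<exists>P. pi_projector (sigma i) P G \<and>
        (\<forall>x\<in>carrier G. H <#>\<^bsub>G\<^esub> conj_set G P x = conj_set G P x <#>\<^bsub>G\<^esub> H))"

text \<open>The largest normal subgroup contained in \<open>H\<close> and the smallest one containing \<open>H\<close>,
  with respect to inclusion. Both exist when \<open>H\<close> is a subgroup; see
  \<open>normal_core_greatest\<close> and \<open>normal_closure_least\<close> below.\<close>

definition normal_core :: "('a, 'b) monoid_scheme \<Rightarrow> 'a set \<Rightarrow> 'a set" where
  "normal_core G H = (GREATEST N. N \<lhd> G \<and> N \<subseteq> H)"

definition normal_closure :: "('a, 'b) monoid_scheme \<Rightarrow> 'a set \<Rightarrow> 'a set" where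
  "normal_closure G H = (LEAST N. N \<lhd> G \<and> H \<subseteq> N)"

definition hall_subgroup :: "nat set \<Rightarrow> 'a set \<Rightarrow> ('a, 'b) monoid_scheme \<Rightarrow> bool" where
  "hall_subgroup ps A G \<longleftrightarrow>
     pi_subgroup ps A G \<and> (\<forall>p\<in>ps. Factorial_Ring.prime p \<longrightarrow> \<not> p dvd card (rcosets\<^bsub>G\<^esub> A))"

definition internal_direct_product ::
  "('a, 'b) monoid_scheme \<Rightarrow> 'i set \<Rightarrow> ('i \<Rightarrow> 'a set) \<Rightarrow> bool" where
  "internal_direct_product G I A \<longleftrightarrow>
     (\<forall>i\<in>I. A i \<lhd> G) \<and>
     generate G (\<Union>i\<in>I. A i) = carrier G \<and>
     (\<forall>i\<in>I. A i \<inter> generate G (\<Union>j\<in>I - {i}. A j) = {\<one>\<^bsub>G\<^esub>})"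

definition sigma_nilpotent ::
  "'i set \<Rightarrow> ('i \<Rightarrow> nat set) \<Rightarrow> ('a, 'b) monoid_scheme \<Rightarrow> bool" where
  "sigma_nilpotent I sigma G \<longleftrightarrow>
     group G \<and> finite (carrier G) \<and>
     (\<exists>A. (\<forall>i\<in>I. hall_subgroup (sigma i) (A i) G) \<and> internal_direct_product G I A)"

context group
begin

lemma normal_core_greatest:
  assumes H: "subgroup H G"
  shows "normal_core G H \<lhd> G" "normal_core G H \<subseteq> H"
    and "\<And>N. N \<lhd> G \<Longrightarrow> N \<subseteq> H \<Longrightarrow> N \<subseteq> normal_core G H"
proof -
  define C where "C = {h \<in> carrier G. \<forall>x\<in>carrier G. x \<otimes> h \<otimes> inv x \<in> H}"
  have sub: "subgroup C G"
  proof (rule subgroupI)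
    show "C \<subseteq> carrier G" by (auto simp: C_def)
    show "C \<noteq> {}"
      using subgroup.one_closed[OF H] by (auto simp: C_def intro!: exI[of _ \<one>])
  next
    fix a assume a: "a \<in> C"
    have "x \<otimes> inv a \<otimes> inv x \<in> H" if x: "x \<in> carrier G" for x
    proof -
      have "x \<otimes> inv a \<otimes> inv x = inv (x \<otimes> a \<otimes> inv x)"
        using a x by (simp add: C_def inv_mult_group m_assoc)
      then show ?thesis using a x subgroup.m_inv_closed[OF H] by (simp add: C_def)
    qed
    then show "inv a \<in> C" using a by (auto simp: C_def)
  next
    fix a b assume ab: "a \<in> C" "b \<in> C"
    have "x \<otimes> (a \<otimes> b) \<otimes> inv x \<in> H" if x: "x \<in> carrier G" for x
    proof -
      have c: "a \<in> carrier G" "b \<in> carrier G" using ab by (auto simp: C_def)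
      have "(x \<otimes> a \<otimes> inv x) \<otimes> (x \<otimes> b \<otimes> inv x) = x \<otimes> a \<otimes> (inv x \<otimes> x) \<otimes> b \<otimes> inv x"
        using c x by (simp only: m_assoc m_closed inv_closed)
      also have "\<dots> = x \<otimes> (a \<otimes> b) \<otimes> inv x"
        using c x by (simp add: m_assoc)
      finally show ?thesis using ab x subgroup.m_closed[OF H] by (metis (no_types, lifting) C_def mem_Collect_eq)
    qed
    then show "a \<otimes> b \<in> C" using ab by (auto simp: C_def)
  qed
  have nor: "C \<lhd> G"
  proof (rule normal_invI[OF sub])
    fix x h assume x: "x \<in> carrier G" and h: "h \<in> C"
    have hc: "h \<in> carrier G" using h by (simp add: C_def)
    have "y \<otimes> (x \<otimes> h \<otimes> inv x) \<otimes> inv y \<in> H" if y: "y \<in> carrier G" for y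
    proof -
      have "y \<otimes> (x \<otimes> h \<otimes> inv x) \<otimes> inv y = (y \<otimes> x) \<otimes> h \<otimes> inv (y \<otimes> x)"
        using hc x y by (simp add: m_assoc inv_mult_group)
      then show ?thesis using h x y by (simp add: C_def)
    qed
    then show "x \<otimes> h \<otimes> inv x \<in> C" using hc x by (simp add: C_def)
  qed
  have CH: "C \<subseteq> H"
  proof
    fix h assume "h \<in> C"
    then have "h \<in> carrier G" "\<one> \<otimes> h \<otimes> inv \<one> \<in> H" unfolding C_def by blast+
    then show "h \<in> H" by simp
  qed
  have great: "N \<subseteq> C" if "N \<lhd> G" "N \<subseteq> H" for N
    using that normal_invE[OF that(1)] subgroup.mem_carrier by (fastforce simp: C_def)
  have "normal_core G H = C"
    unfolding normal_core_def by (rule Greatest_equality) (use nor CH great in auto)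
  then show "normal_core G H \<lhd> G" "normal_core G H \<subseteq> H"
    and "\<And>N. N \<lhd> G \<Longrightarrow> N \<subseteq> H \<Longrightarrow> N \<subseteq> normal_core G H"
    using nor CH great by auto
qed

lemma normal_closure_least:
  assumes H: "subgroup H G"
  shows "normal_closure G H \<lhd> G" "H \<subseteq> normal_closure G H"
    and "\<And>N. N \<lhd> G \<Longrightarrow> H \<subseteq> N \<Longrightarrow> normal_closure G H \<subseteq> N"
proof -
  define S where "S = {N. N \<lhd> G \<and> H \<subseteq> N}"
  have car: "carrier G \<in> S"
    using subgroup.subset[OF H] normal_invI[OF subgroup_self] by (simp add: S_def)
  have sub: "subgroup (\<Inter>S) G"
    by (rule subgroups_Inter) (use car normal_imp_subgroup in \<open>auto simp: S_def\<close>)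
  have nor: "\<Inter>S \<lhd> G"
    by (rule normal_invI[OF sub]) (auto simp: S_def intro: normal_invE(2))
  have "normal_closure G H = \<Inter>S"
    unfolding normal_closure_def by (rule Least_equality) (use nor in \<open>auto simp: S_def\<close>)
  then show "normal_closure G H \<lhd> G" "H \<subseteq> normal_closure G H"
    and "\<And>N. N \<lhd> G \<Longrightarrow> H \<subseteq> N \<Longrightarrow> normal_closure G H \<subseteq> N"
    using nor by (auto simp: S_def)
qed

end

end

theory Submission
  imports Defs
begin

text \<open>Write \<open>O^pi(A)\<close> for the smallest normal subgroup of \<open>A\<close> whose quotient is a
  \<open>pi\<close>-group, and let \<open>Q\<close> range over the conjugates of the given projectors. The proof has three
  steps.

  (1) If \<open>H\<close> permutes with every \<open>Q\<close>, and \<open>Q\<close> belongs to the class \<open>i\<close>, then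
  \<open>O^{sigma i} (H Q) \<subseteq> H\<close> (lemma \<open>permutable_pi_over\<close>). In particular \<open>Q\<close> normalises
  \<open>O^{sigma i} (H)\<close>. This is the substitute for \<open>sigma\<close>-subnormality of \<open>H\<close>, and it is the hard
  step, because intersecting a projector with a normal subgroup of \<open>G\<close> need not give a projector
  of that subgroup. The induction therefore keeps away from subgroups of \<open>G\<close>: it enlarges \<open>H\<close> to
  \<open>H M\<close>, where \<open>M\<close> is minimal normal modulo the core of \<open>H\<close>, and divides by that core. The tool
  is an argument of Kegel and Wielandt (\<open>permuting_proper_normal\<close>, \<open>permuting_Int_normalized\<close>):
  since \<open>H\<close> permutes with all conjugates of \<open>Q\<close>, all commutators of \<open>H\<close> with \<open>Q\<close> lie in a
  subgroup of \<open>H Q\<close> that is normalised by every minimal normal subgroup \<open>M\<close> of \<open>G\<close>. If \<open>M\<close>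
  belongs to a single class, a coprimality computation with these commutators shows
  \<open>O^{sigma i} (H M) \<subseteq> H\<close> for the class \<open>i\<close> of \<open>M\<close> (\<open>primary_conj_mem\<close>,
  \<open>primary_pi_over\<close>). If \<open>M\<close> involves several classes, the same commutators, the maximality of
  the projectors and the trivial core of \<open>H\<close> force \<open>H \<inter> M\<close> to be trivial (\<open>H_Int_M\<close>), and
  then \<open>M \<inter> H Q\<close> centralises \<open>H\<close>.

  (2) Let \<open>H\<close> have trivial core. Conjugates of \<open>Q\<close> for the class \<open>i\<close> generate a normal subgroup
  \<open>G_i\<close> containing all elements of \<open>q\<close>-power order with \<open>q\<close> in the class \<open>i\<close>, and the \<open>G_i\<close>
  generate \<open>G\<close>. By (1), \<open>G_i\<close> normalises \<open>O^{sigma i} (H)\<close>. Hence the subgroup \<open>D_i\<close> generated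
  by the elements of \<open>H\<close> of \<open>q\<close>-power order, \<open>q\<close> in the class \<open>i\<close>, is normalised by \<open>G_j\<close> for
  all \<open>j \<noteq> i\<close>, and the residual \<open>O^{sigma i} (D_i)\<close> cannot leave \<open>H\<close> under conjugation by
  \<open>G\<close>; so it is trivial and \<open>D_i\<close> is a \<open>sigma i\<close>-group. A transfer argument
  (\<open>normalized_pi_subgroup\<close>) then puts \<open>D_i\<close> into a normal \<open>sigma i\<close>-subgroup of \<open>G\<close>
  (\<open>corefree_pi_part\<close>).

  (3) In general apply (2) to the image of \<open>H\<close> modulo its core. The image of the normal closure
  of \<open>H\<close> lies in a subgroup generated by normal \<open>sigma i\<close>-subgroups, one for each \<open>i\<close>, and
  intersecting with these gives the required decomposition (\<open>sigma_nilpotent_if_generated\<close>).\<close>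

section \<open>Relative normality, conjugation and products of subgroups\<close>

context group
begin

text \<open>Normality is a relation between subsets of one ambient group, so that inductions
  over subgroups keep its operations.\<close>

definition normal_in :: "'a set \<Rightarrow> 'a set \<Rightarrow> bool" where
  "normal_in N J \<longleftrightarrow> subgroup N G \<and> subgroup J G \<and> N \<subseteq> J \<and>
     (\<forall>x\<in>J. \<forall>n\<in>N. inv x \<otimes> n \<otimes> x \<in> N)"

definition comm :: "'a \<Rightarrow> 'a \<Rightarrow> 'a" where
  "comm x y = inv x \<otimes> inv y \<otimes> x \<otimes> y"

lemma cancel_left [simp]:
  assumes "x \<in> carrier G" "y \<in> carrier G"
  shows "inv x \<otimes> (x \<otimes> y) = y" "x \<otimes> (inv x \<otimes> y) = y"
  using assms by (simp_all flip: m_assoc)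

lemma comm_closed [simp]: "x \<in> carrier G \<Longrightarrow> y \<in> carrier G \<Longrightarrow> comm x y \<in> carrier G"
  by (simp add: comm_def)

lemma comm_inv: "x \<in> carrier G \<Longrightarrow> y \<in> carrier G \<Longrightarrow> comm y x = inv (comm x y)"
  by (simp add: comm_def inv_mult_group m_assoc)

lemma comm_eq_one_iff:
  assumes "x \<in> carrier G" "y \<in> carrier G"
  shows "comm x y = \<one> \<longleftrightarrow> x \<otimes> y = y \<otimes> x"
proof -
  have "comm x y = inv (y \<otimes> x) \<otimes> (x \<otimes> y)"
    using assms by (simp add: comm_def inv_mult_group m_assoc)
  then show ?thesis using assms
    by (metis inv_closed inv_equality inv_inv l_inv m_closed r_inv inv_solve_left r_one)
qed

lemma conj_set_memI: "p \<in> P \<Longrightarrow> inv x \<otimes> p \<otimes> x \<in> conj_set G P x"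
  by (auto simp: conj_set_def)

lemma conj_set_mem_iff:
  assumes "P \<subseteq> carrier G" "x \<in> carrier G" "y \<in> carrier G"
  shows "y \<in> conj_set G P x \<longleftrightarrow> x \<otimes> y \<otimes> inv x \<in> P"
proof
  assume "y \<in> conj_set G P x"
  then obtain p where "p \<in> P" "y = inv x \<otimes> p \<otimes> x" by (auto simp: conj_set_def)
  then show "x \<otimes> y \<otimes> inv x \<in> P" using assms by (auto simp: m_assoc)
next
  assume "x \<otimes> y \<otimes> inv x \<in> P"
  then have "inv x \<otimes> (x \<otimes> y \<otimes> inv x) \<otimes> x \<in> conj_set G P x" by (rule conj_set_memI)
  then show "y \<in> conj_set G P x" using assms by (simp add: m_assoc)
qed

lemma conj_set_subset: "P \<subseteq> carrier G \<Longrightarrow> x \<in> carrier G \<Longrightarrow> conj_set G P x \<subseteq> carrier G"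
  by (auto simp: conj_set_def)

lemma conj_set_subgroup:
  assumes P: "subgroup P G" and x: "x \<in> carrier G"
  shows "subgroup (conj_set G P x) G"
proof -
  have Pc: "P \<subseteq> carrier G" using P by (rule subgroup.subset)
  show ?thesis
  proof (rule subgroupI)
    show "conj_set G P x \<subseteq> carrier G" using Pc x by (rule conj_set_subset)
    show "conj_set G P x \<noteq> {}" using subgroup.one_closed[OF P] by (auto simp: conj_set_def)
  next
    fix a assume "a \<in> conj_set G P x"
    then obtain p where p: "p \<in> P" "a = inv x \<otimes> p \<otimes> x" by (auto simp: conj_set_def)
    then have "inv a = inv x \<otimes> inv p \<otimes> x" using Pc x by (auto simp: inv_mult_group m_assoc subset_iff)
    then show "inv a \<in> conj_set G P x" using p subgroup.m_inv_closed[OF P] by (auto simp: conj_set_def)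
  next
    fix a b assume "a \<in> conj_set G P x" "b \<in> conj_set G P x"
    then obtain p r where p: "p \<in> P" "a = inv x \<otimes> p \<otimes> x" "r \<in> P" "b = inv x \<otimes> r \<otimes> x"
      by (auto simp: conj_set_def)
    then have "a \<otimes> b = inv x \<otimes> (p \<otimes> r) \<otimes> x" using Pc x by (auto simp: m_assoc subset_iff)
    then show "a \<otimes> b \<in> conj_set G P x" using p subgroup.m_closed[OF P] by (auto simp: conj_set_def)
  qed
qed

lemma conj_set_conj_set:
  assumes "P \<subseteq> carrier G" "x \<in> carrier G" "y \<in> carrier G"
  shows "conj_set G (conj_set G P x) y = conj_set G P (x \<otimes> y)"
  unfolding conj_set_def image_image
  by (rule image_cong) (use assms in \<open>auto simp: m_assoc inv_mult_group subset_iff\<close>)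

lemma conj_set_one: "P \<subseteq> carrier G \<Longrightarrow> conj_set G P \<one> = P"
  by (force simp: conj_set_def)

lemma conj_set_mono: "A \<subseteq> B \<Longrightarrow> conj_set G A x \<subseteq> conj_set G B x"
  by (auto simp: conj_set_def)

lemma conj_set_self: "subgroup P G \<Longrightarrow> x \<in> P \<Longrightarrow> conj_set G P x = P"
proof -
  assume P: "subgroup P G" and x: "x \<in> P"
  have xc: "x \<in> carrier G" using P x by (rule subgroup.mem_carrier)
  show ?thesis
  proof
    show "conj_set G P x \<subseteq> P"
      using P x by (auto simp: conj_set_def subgroup.m_closed subgroup.m_inv_closed)
    show "P \<subseteq> conj_set G P x"
    proof
      fix y assume y: "y \<in> P"
      then show "y \<in> conj_set G P x"
        using P x xc by (simp add: conj_set_mem_iff subgroup.subset subgroup.mem_carrier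
            subgroup.m_closed subgroup.m_inv_closed)
    qed
  qed
qed

lemma set_multI: "a \<in> A \<Longrightarrow> b \<in> B \<Longrightarrow> a \<otimes> b \<in> A <#> B"
  by (auto simp: set_mult_def)

lemma set_multE:
  assumes "x \<in> A <#> B" obtains a b where "a \<in> A" "b \<in> B" "x = a \<otimes> b"
  using assms by (auto simp: set_mult_def)

lemma subset_set_mult_left: "A \<subseteq> carrier G \<Longrightarrow> \<one> \<in> B \<Longrightarrow> A \<subseteq> A <#> B"
  by (force simp: set_mult_def)

lemma subset_set_mult_right: "B \<subseteq> carrier G \<Longrightarrow> \<one> \<in> A \<Longrightarrow> B \<subseteq> A <#> B"
  by (force simp: set_mult_def)

lemma subgroup_set_mult_subsets:
  assumes "subgroup A G" "subgroup B G"
  shows "A \<subseteq> A <#> B" "B \<subseteq> A <#> B"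
  using assms by (simp_all add: subset_set_mult_left subset_set_mult_right
      subgroup.subset subgroup.one_closed)

lemma set_mult_least: "subgroup J G \<Longrightarrow> A \<subseteq> J \<Longrightarrow> B \<subseteq> J \<Longrightarrow> A <#> B \<subseteq> J"
  by (auto simp: set_mult_def subset_iff subgroup.m_closed)

lemma conj_set_set_mult:
  assumes "A \<subseteq> carrier G" "B \<subseteq> carrier G" "x \<in> carrier G"
  shows "conj_set G (A <#> B) x = conj_set G A x <#> conj_set G B x"
proof -
  have eq: "inv x \<otimes> (a \<otimes> b) \<otimes> x = (inv x \<otimes> a \<otimes> x) \<otimes> (inv x \<otimes> b \<otimes> x)" if "a \<in> A" "b \<in> B" for a b
    using assms that by (auto simp: m_assoc subset_iff)
  show ?thesis unfolding conj_set_def set_mult_def using eq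
    by (auto simp: image_iff) (metis eq)+
qed

lemma permuting_subgroup:
  assumes A: "subgroup A G" and B: "subgroup B G" and AB: "A <#> B = B <#> A"
  shows "subgroup (A <#> B) G"
proof -
  have Ac: "A \<subseteq> carrier G" and Bc: "B \<subseteq> carrier G"
    using A B by (auto dest: subgroup.subset)
  show ?thesis
  proof (rule subgroupI)
    show "A <#> B \<subseteq> carrier G" using Ac Bc by (rule setmult_subset_G)
    show "A <#> B \<noteq> {}" using subgroup_set_mult_subsets[OF A B] subgroup.one_closed[OF A] by auto
  next
    fix x assume "x \<in> A <#> B"
    then obtain a b where ab: "a \<in> A" "b \<in> B" "x = a \<otimes> b" by (rule set_multE)
    then have "inv x = inv b \<otimes> inv a" using Ac Bc by (auto simp: inv_mult_group subset_iff)
    then show "inv x \<in> A <#> B" unfolding AB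
      using ab A B by (auto intro!: set_multI simp: subgroup.m_inv_closed)
  next
    fix x y assume "x \<in> A <#> B" "y \<in> A <#> B"
    then obtain a b c d where *: "a \<in> A" "b \<in> B" "x = a \<otimes> b" "c \<in> A" "d \<in> B" "y = c \<otimes> d"
      by (meson set_multE)
    have "b \<otimes> c \<in> A <#> B" unfolding AB using * by (auto intro: set_multI)
    then obtain c' b' where c: "c' \<in> A" "b' \<in> B" "b \<otimes> c = c' \<otimes> b'" by (rule set_multE)
    have "x \<otimes> y = a \<otimes> (b \<otimes> c) \<otimes> d" using * Ac Bc by (auto simp: m_assoc subset_iff)
    also have "\<dots> = (a \<otimes> c') \<otimes> (b' \<otimes> d)" using * c Ac Bc by (auto simp: m_assoc subset_iff)
    finally show "x \<otimes> y \<in> A <#> B"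
      using * c A B by (auto intro!: set_multI simp: subgroup.m_closed)
  qed
qed

lemma subgroup_set_mult_commute:
  assumes A: "subgroup A G" and B: "subgroup B G" and AB: "subgroup (A <#> B) G"
  shows "A <#> B = B <#> A"
proof -
  have Ac: "A \<subseteq> carrier G" and Bc: "B \<subseteq> carrier G"
    using A B by (auto dest: subgroup.subset)
  show ?thesis
  proof
    show "B <#> A \<subseteq> A <#> B"
      using subgroup_set_mult_subsets[OF A B] AB by (intro set_mult_least)
    show "A <#> B \<subseteq> B <#> A"
    proof
      fix x assume x: "x \<in> A <#> B"
      then have "inv x \<in> A <#> B" using AB by (simp add: subgroup.m_inv_closed)
      then obtain a b where ab: "a \<in> A" "b \<in> B" "inv x = a \<otimes> b" by (rule set_multE)
      have "x = inv (inv x)" using x AB by (simp add: subgroup.mem_carrier)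
      also have "\<dots> = inv b \<otimes> inv a" using ab Ac Bc by (auto simp: inv_mult_group subset_iff)
      finally show "x \<in> B <#> A"
        using ab A B by (auto intro!: set_multI simp: subgroup.m_inv_closed)
    qed
  qed
qed

lemma normalized_permute:
  assumes A: "subgroup A G" and N: "subgroup N G"
    and nor: "\<And>a n. a \<in> A \<Longrightarrow> n \<in> N \<Longrightarrow> inv a \<otimes> n \<otimes> a \<in> N"
  shows "A <#> N = N <#> A"
proof
  show "A <#> N \<subseteq> N <#> A"
  proof
    fix x assume "x \<in> A <#> N"
    then obtain a n where *: "a \<in> A" "n \<in> N" "x = a \<otimes> n" by (rule set_multE)
    have "inv (inv a) \<otimes> n \<otimes> inv a \<in> N" using nor[of "inv a" n] * A by (simp add: subgroup.m_inv_closed)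
    moreover have "x = (inv (inv a) \<otimes> n \<otimes> inv a) \<otimes> a"
      using * A N by (auto simp: m_assoc subgroup.mem_carrier)
    ultimately show "x \<in> N <#> A" using * by (metis set_multI)
  qed
  show "N <#> A \<subseteq> A <#> N"
  proof
    fix x assume "x \<in> N <#> A"
    then obtain a n where *: "a \<in> A" "n \<in> N" "x = n \<otimes> a" by (meson set_multE)
    have "inv a \<otimes> n \<otimes> a \<in> N" using nor * by simp
    moreover have "x = a \<otimes> (inv a \<otimes> n \<otimes> a)"
      using * A N by (auto simp: m_assoc subgroup.mem_carrier)
    ultimately show "x \<in> A <#> N" using * by (metis set_multI)
  qed
qed

lemma normal_inI:
  assumes "subgroup N G" "subgroup J G" "N \<subseteq> J"
    and "\<And>x n. x \<in> J \<Longrightarrow> n \<in> N \<Longrightarrow> inv x \<otimes> n \<otimes> x \<in> N"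
  shows "normal_in N J"
  using assms by (auto simp: normal_in_def)

lemma normal_inD:
  assumes "normal_in N J"
  shows "subgroup N G" "subgroup J G" "N \<subseteq> J"
    and "\<And>x n. x \<in> J \<Longrightarrow> n \<in> N \<Longrightarrow> inv x \<otimes> n \<otimes> x \<in> N"
    and "\<And>x n. x \<in> J \<Longrightarrow> n \<in> N \<Longrightarrow> x \<otimes> n \<otimes> inv x \<in> N"
proof -
  show *: "subgroup N G" "subgroup J G" "N \<subseteq> J"
    and **: "\<And>x n. x \<in> J \<Longrightarrow> n \<in> N \<Longrightarrow> inv x \<otimes> n \<otimes> x \<in> N"
    using assms by (auto simp: normal_in_def)
  show "x \<otimes> n \<otimes> inv x \<in> N" if "x \<in> J" "n \<in> N" for x n
    using **[of "inv x" n] that *(2) by (simp add: subgroup.m_inv_closed subgroup.mem_carrier)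
qed

lemma normal_in_carrier_iff: "normal_in N (carrier G) \<longleftrightarrow> N \<lhd> G"
proof
  assume N: "normal_in N (carrier G)"
  show "N \<lhd> G" by (rule normal_invI) (use normal_inD[OF N] in auto)
next
  assume N: "N \<lhd> G"
  then have "subgroup N G" by (rule normal_imp_subgroup)
  then show "normal_in N (carrier G)"
    using normal.inv_op_closed1[OF N] by (auto intro!: normal_inI subgroup_self dest: subgroup.subset)
qed

lemma normal_in_restrict:
  assumes N: "normal_in N J"
  shows "N \<lhd> G\<lparr>carrier := J\<rparr>"
proof -
  interpret J: group "G\<lparr>carrier := J\<rparr>"
    using normal_inD(2)[OF N] by (rule subgroup.subgroup_is_group) (rule is_group)
  show ?thesis
  proof (rule J.normal_invI)
    show "subgroup N (G\<lparr>carrier := J\<rparr>)"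
      using normal_inD(1-3)[OF N] by (intro subgroup_incl)
    fix x n assume "x \<in> carrier (G\<lparr>carrier := J\<rparr>)" "n \<in> N"
    then show "x \<otimes>\<^bsub>G\<lparr>carrier := J\<rparr>\<^esub> n \<otimes>\<^bsub>G\<lparr>carrier := J\<rparr>\<^esub> inv\<^bsub>G\<lparr>carrier := J\<rparr>\<^esub> x \<in> N"
      using normal_inD[OF N] by (simp add: m_inv_consistent)
  qed
qed

lemma normal_in_Int:
  assumes "normal_in N J" "subgroup Y G"
  shows "normal_in (N \<inter> Y) (J \<inter> Y)"
  using assms normal_inD[OF assms(1)]
  by (auto intro!: normal_inI subgroups_Inter_pair simp: subgroup.m_closed subgroup.m_inv_closed)

lemma normal_in_Int2:
  assumes "normal_in M J" "normal_in N J"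
  shows "normal_in (M \<inter> N) J"
  using assms normal_inD[OF assms(1)] normal_inD[OF assms(2)]
  by (auto intro!: normal_inI subgroups_Inter_pair)

lemma normal_in_subset:
  assumes "normal_in N J" "subgroup Y G" "N \<subseteq> Y" "Y \<subseteq> J"
  shows "normal_in N Y"
  using assms normal_inD[OF assms(1)] by (auto intro!: normal_inI)

lemma normal_in_refl: "subgroup J G \<Longrightarrow> normal_in J J"
  by (rule normal_inI) (auto simp: subgroup.m_closed subgroup.m_inv_closed)

lemma normal_in_one: "subgroup J G \<Longrightarrow> normal_in {\<one>} J"
  by (rule normal_inI) (auto simp: triv_subgroup subgroup.one_closed subgroup.mem_carrier)

lemma normal_in_conj_set:
  assumes N: "normal_in N J" and x: "x \<in> J"
  shows "conj_set G N x = N"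
proof
  note n = normal_inD[OF N]
  have xc: "x \<in> carrier G" using n(2) x by (rule subgroup.mem_carrier)
  show "conj_set G N x \<subseteq> N" using n(4) x by (auto simp: conj_set_def)
  show "N \<subseteq> conj_set G N x"
  proof
    fix y assume "y \<in> N"
    then show "y \<in> conj_set G N x"
      using n x xc by (simp add: conj_set_mem_iff subgroup.subset subgroup.mem_carrier)
  qed
qed

lemma conj_set_inverse:
  assumes "P \<subseteq> carrier G" "x \<in> carrier G"
  shows "conj_set G (conj_set G P x) (inv x) = P" "conj_set G (conj_set G P (inv x)) x = P"
  using assms by (simp_all add: conj_set_conj_set conj_set_one)

lemma conj_set_normal_in:
  assumes N: "normal_in N J" and x: "x \<in> carrier G" and J: "conj_set G J x = J"
  shows "normal_in (conj_set G N x) J"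
proof -
  note n = normal_inD[OF N]
  show ?thesis
  proof (rule normal_inI)
    show "subgroup (conj_set G N x) G" using n x by (intro conj_set_subgroup)
    show "conj_set G N x \<subseteq> J" using n(3) J by (metis conj_set_mono)
    fix y m assume y: "y \<in> J" and "m \<in> conj_set G N x"
    then obtain k where k: "k \<in> N" "m = inv x \<otimes> k \<otimes> x" by (auto simp: conj_set_def)
    obtain z where z: "z \<in> J" "y = inv x \<otimes> z \<otimes> x" using y J by (auto simp: conj_set_def)
    have c: "k \<in> carrier G" "z \<in> carrier G"
      using k z n by (auto dest: subgroup.mem_carrier)
    have "inv y \<otimes> m \<otimes> y = inv x \<otimes> (inv z \<otimes> k \<otimes> z) \<otimes> x"
      using c x k z by (simp add: m_assoc inv_mult_group)
    then show "inv y \<otimes> m \<otimes> y \<in> conj_set G N x"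
      using n(4)[OF z(1) k(1)] by (simp add: conj_set_memI)
  qed (rule n(2))
qed

text \<open>The commutator of \<open>x\<close> and \<open>y\<close> lies in both subgroups.\<close>

lemma trivial_Int_commute:
  assumes M: "subgroup M G" and N: "subgroup N G" and tr: "M \<inter> N = {\<one>}"
    and MN: "\<And>x n. x \<in> M \<Longrightarrow> n \<in> N \<Longrightarrow> inv x \<otimes> n \<otimes> x \<in> N"
    and NM: "\<And>x n. x \<in> N \<Longrightarrow> n \<in> M \<Longrightarrow> inv x \<otimes> n \<otimes> x \<in> M"
    and x: "x \<in> M" and y: "y \<in> N"
  shows "x \<otimes> y = y \<otimes> x"
proof -
  have c: "x \<in> carrier G" "y \<in> carrier G" using x y M N by (auto dest: subgroup.mem_carrier)
  have "comm x y = (inv x \<otimes> inv y \<otimes> x) \<otimes> y" using c by (simp add: comm_def m_assoc)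
  then have 1: "comm x y \<in> N" using MN[OF x subgroup.m_inv_closed[OF N y]] y N
    by (simp add: subgroup.m_closed)
  have "comm x y = inv x \<otimes> (inv y \<otimes> x \<otimes> y)" using c by (simp add: comm_def m_assoc)
  then have 2: "comm x y \<in> M" using NM[OF y x] x M
    by (simp add: subgroup.m_closed subgroup.m_inv_closed)
  from 1 2 tr have "comm x y = \<one>" by auto
  then show ?thesis using c by (simp add: comm_eq_one_iff)
qed

lemma generate_subset_iff:
  "S \<subseteq> carrier G \<Longrightarrow> subgroup J G \<Longrightarrow> generate G S \<subseteq> J \<longleftrightarrow> S \<subseteq> J"
  using generate_subgroup_incl[of S J] generate.incl[of _ S G] by auto

lemma conj_generate_closed:
  assumes S: "S \<subseteq> carrier G" and x: "x \<in> carrier G"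
    and J: "subgroup J G" and conj: "\<And>s. s \<in> S \<Longrightarrow> inv x \<otimes> s \<otimes> x \<in> J"
    and y: "y \<in> generate G S"
  shows "inv x \<otimes> y \<otimes> x \<in> J"
  using y
proof (induction rule: generate.induct)
  case one then show ?case using x J by (simp add: subgroup.one_closed)
next
  case (incl h) then show ?case by (rule conj)
next
  case (inv h)
  then have "inv (inv x \<otimes> h \<otimes> x) \<in> J" using conj J by (simp add: subgroup.m_inv_closed)
  moreover have "inv (inv x \<otimes> h \<otimes> x) = inv x \<otimes> inv h \<otimes> x"
    using inv S x by (auto simp: inv_mult_group m_assoc)
  ultimately show ?case by simp
next
  case (eng a b)
  then have "(inv x \<otimes> a \<otimes> x) \<otimes> (inv x \<otimes> b \<otimes> x) \<in> J" using J by (simp add: subgroup.m_closed)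
  moreover have "(inv x \<otimes> a \<otimes> x) \<otimes> (inv x \<otimes> b \<otimes> x) = inv x \<otimes> (a \<otimes> b) \<otimes> x"
    using eng x generate_in_carrier[OF S] by (simp add: m_assoc)
  ultimately show ?case by simp
qed

lemma normal_in_generate:
  assumes S: "S \<subseteq> J" and J: "subgroup J G"
    and conj: "\<And>x s. x \<in> J \<Longrightarrow> s \<in> S \<Longrightarrow> inv x \<otimes> s \<otimes> x \<in> S"
  shows "normal_in (generate G S) J"
proof (rule normal_inI)
  have Sc: "S \<subseteq> carrier G" using S subgroup.subset[OF J] by auto
  show g: "subgroup (generate G S) G" using Sc by (rule generate_is_subgroup)
  show "generate G S \<subseteq> J" using Sc J S by (simp add: generate_subset_iff)
  show "inv x \<otimes> n \<otimes> x \<in> generate G S" if "x \<in> J" "n \<in> generate G S" for x n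
    by (rule conj_generate_closed[OF Sc _ g _ that(2)])
       (use that conj J in \<open>auto intro: generate.incl dest: subgroup.mem_carrier\<close>)
qed (rule J)

lemma normal_in_conj_closure:
  assumes S: "S \<subseteq> J" and J: "subgroup J G"
  shows "normal_in (generate G (\<Union>x\<in>J. conj_set G S x)) J"
    and "S \<subseteq> generate G (\<Union>x\<in>J. conj_set G S x)"
proof -
  have Jc: "J \<subseteq> carrier G" using J by (rule subgroup.subset)
  have Sc: "S \<subseteq> carrier G" using S Jc by blast
  show "normal_in (generate G (\<Union>x\<in>J. conj_set G S x)) J"
  proof (rule normal_in_generate[OF _ J])
    show "(\<Union>x\<in>J. conj_set G S x) \<subseteq> J" using conj_set_mono[OF S] conj_set_self[OF J] by auto
    fix x s assume x: "x \<in> J" and "s \<in> (\<Union>x\<in>J. conj_set G S x)"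
    then obtain g where g: "g \<in> J" "s \<in> conj_set G S g" by auto
    have "inv x \<otimes> s \<otimes> x \<in> conj_set G (conj_set G S g) x" using g(2) by (rule conj_set_memI)
    then have "inv x \<otimes> s \<otimes> x \<in> conj_set G S (g \<otimes> x)"
      using conj_set_conj_set[OF Sc, of g x] g x Jc by auto
    then show "inv x \<otimes> s \<otimes> x \<in> (\<Union>x\<in>J. conj_set G S x)"
      using g x J by (auto simp: subgroup.m_closed)
  qed
  have "S = conj_set G S \<one>" using Sc by (simp add: conj_set_one)
  then show "S \<subseteq> generate G (\<Union>x\<in>J. conj_set G S x)"
    using subgroup.one_closed[OF J] by (blast intro: generate.incl)
qed

lemma centralizer_subgroup:
  assumes "S \<subseteq> carrier G"
  shows "subgroup {x \<in> carrier G. \<forall>s\<in>S. x \<otimes> s = s \<otimes> x} G"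
proof (rule subgroupI)
  fix a assume a: "a \<in> {x \<in> carrier G. \<forall>s\<in>S. x \<otimes> s = s \<otimes> x}"
  have "inv a \<otimes> s = s \<otimes> inv a" if s: "s \<in> S" for s
  proof -
    have sc: "s \<in> carrier G" "a \<in> carrier G" "a \<otimes> s = s \<otimes> a" using s assms a by auto
    have "inv a \<otimes> s = inv a \<otimes> ((s \<otimes> a) \<otimes> inv a)" using sc(1,2) by (simp add: m_assoc)
    also have "\<dots> = s \<otimes> inv a" unfolding sc(3)[symmetric] using sc(1,2) by (simp add: m_assoc)
    finally show ?thesis .
  qed
  then show "inv a \<in> {x \<in> carrier G. \<forall>s\<in>S. x \<otimes> s = s \<otimes> x}" using a by auto
next
  fix a b assume ab: "a \<in> {x \<in> carrier G. \<forall>s\<in>S. x \<otimes> s = s \<otimes> x}" "b \<in> {x \<in> carrier G. \<forall>s\<in>S. x \<otimes> s = s \<otimes> x}"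
  have "a \<otimes> b \<otimes> s = s \<otimes> (a \<otimes> b)" if s: "s \<in> S" for s
  proof -
    have sc: "s \<in> carrier G" using s assms by auto
    have "a \<otimes> b \<otimes> s = a \<otimes> (b \<otimes> s)" using ab sc by (simp add: m_assoc)
    also have "\<dots> = a \<otimes> (s \<otimes> b)" using ab s by simp
    also have "\<dots> = (a \<otimes> s) \<otimes> b" by (rule m_assoc[symmetric]) (use ab sc in auto)
    also have "\<dots> = (s \<otimes> a) \<otimes> b" using ab s by simp
    also have "\<dots> = s \<otimes> (a \<otimes> b)" using ab sc by (simp add: m_assoc)
    finally show ?thesis .
  qed
  then show "a \<otimes> b \<in> {x \<in> carrier G. \<forall>s\<in>S. x \<otimes> s = s \<otimes> x}" using ab by auto
qed (use assms in \<open>auto intro!: exI[of _ \<one>]\<close>)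

lemma normal_in_centralizer:
  assumes Y: "normal_in Y J"
  shows "normal_in {x \<in> J. \<forall>s\<in>Y. x \<otimes> s = s \<otimes> x} J" (is "normal_in ?C J")
proof -
  note y = normal_inD[OF Y]
  have Jc: "J \<subseteq> carrier G" using y(2) by (rule subgroup.subset)
  have Yc: "Y \<subseteq> carrier G" using y(3) Jc by blast
  have eq: "?C = J \<inter> {x \<in> carrier G. \<forall>s\<in>Y. x \<otimes> s = s \<otimes> x}" using Jc by auto
  show ?thesis
  proof (rule normal_inI)
    show "subgroup ?C G" unfolding eq
      using y(2) centralizer_subgroup[OF Yc] by (rule subgroups_Inter_pair)
    show "subgroup J G" by (rule y(2))
    show "?C \<subseteq> J" by blast
    fix x c assume x: "x \<in> J" and c: "c \<in> ?C"
    have xc: "x \<in> carrier G" "c \<in> carrier G" using x c Jc by auto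
    have "inv x \<otimes> c \<otimes> x \<otimes> m = m \<otimes> (inv x \<otimes> c \<otimes> x)" if m: "m \<in> Y" for m
    proof -
      define m' where "m' = x \<otimes> m \<otimes> inv x"
      have m': "m' \<in> Y" unfolding m'_def using y(5)[OF x m] .
      have mc: "m' \<in> carrier G" "m \<in> carrier G" using m' m Yc by auto
      have "inv x \<otimes> c \<otimes> x \<otimes> m = inv x \<otimes> (c \<otimes> m') \<otimes> x"
        using mc xc by (simp add: m'_def m_assoc)
      also have "c \<otimes> m' = m' \<otimes> c" using c m' by simp
      also have "inv x \<otimes> (m' \<otimes> c) \<otimes> x = m \<otimes> (inv x \<otimes> c \<otimes> x)"
        using mc xc by (simp add: m'_def m_assoc)
      finally show ?thesis .
    qed
    then show "inv x \<otimes> c \<otimes> x \<in> ?C"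
      using x c y(2) by (simp add: subgroup.m_closed subgroup.m_inv_closed)
  qed
qed

lemma comm_mem_subgroup: "subgroup J G \<Longrightarrow> x \<in> J \<Longrightarrow> y \<in> J \<Longrightarrow> comm x y \<in> J"
  by (simp add: comm_def subgroup.m_closed subgroup.m_inv_closed)

text \<open>Modulo \<open>E\<close> this is the centraliser of \<open>h\<close> in \<open>M\<close>.\<close>

lemma subgroup_comm_mem:
  assumes h: "h \<in> carrier G" and M: "subgroup M G" and E: "subgroup E G"
    and nor: "\<And>x e. x \<in> M \<Longrightarrow> e \<in> E \<Longrightarrow> inv x \<otimes> e \<otimes> x \<in> E"
  shows "subgroup {c \<in> M. comm h c \<in> E} G"
proof (rule subgroupI)
  have Mc: "x \<in> carrier G" if "x \<in> M" for x using M that by (rule subgroup.mem_carrier)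
  show "{c \<in> M. comm h c \<in> E} \<subseteq> carrier G" using Mc by blast
  have "comm h \<one> = \<one>" using h by (simp add: comm_def)
  then show "{c \<in> M. comm h c \<in> E} \<noteq> {}"
    using M E by (auto simp: subgroup.one_closed intro!: exI[of _ \<one>])
  fix x assume "x \<in> {c \<in> M. comm h c \<in> E}"
  then have x: "x \<in> M" "comm h x \<in> E" "x \<in> carrier G" using Mc by auto
  have "inv (inv x) \<otimes> inv (comm h x) \<otimes> inv x \<in> E"
    using nor[of "inv x"] x M E by (simp add: subgroup.m_inv_closed)
  moreover have "inv (inv x) \<otimes> inv (comm h x) \<otimes> inv x = comm h (inv x)"
    using x h by (simp add: comm_def m_assoc inv_mult_group)
  ultimately show "inv x \<in> {c \<in> M. comm h c \<in> E}" using x M by (simp add: subgroup.m_inv_closed)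
  fix y assume "y \<in> {c \<in> M. comm h c \<in> E}"
  then have y: "y \<in> M" "comm h y \<in> E" "y \<in> carrier G" using Mc by auto
  have "comm h y \<otimes> (inv y \<otimes> comm h x \<otimes> y) \<in> E"
    using nor[OF y(1) x(2)] y(2) E by (simp add: subgroup.m_closed)
  moreover have "comm h y \<otimes> (inv y \<otimes> comm h x \<otimes> y) = comm h (x \<otimes> y)"
    using x y h by (simp add: comm_def m_assoc inv_mult_group)
  ultimately show "x \<otimes> y \<in> {c \<in> M. comm h c \<in> E}" using x y M by (simp add: subgroup.m_closed)
qed

end

section \<open>Indices and elements of prime power order\<close>

context group
begin

definition q_elt :: "nat \<Rightarrow> 'a \<Rightarrow> bool" where
  "q_elt q x \<longleftrightarrow> x \<in> carrier G \<and> (\<exists>n::nat. x [^] (q ^ n) = \<one>)"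

text \<open>For subgroups \<open>N \<subseteq> J\<close> of a finite group this says that \<open>N\<close> contains the
  smallest normal subgroup of \<open>J\<close> whose quotient is a \<open>ps\<close>-group: that residual is generated by
  the elements of prime power order for primes outside \<open>ps\<close>. Formulated through elements, the
  condition passes to subgroups, conjugates and quotients directly. With \<open>N = {\<one>}\<close> it says
  that \<open>J\<close> is a \<open>ps\<close>-group, see \<open>pi_over_Cauchy\<close>.\<close>

definition pi_over :: "nat set \<Rightarrow> 'a set \<Rightarrow> 'a set \<Rightarrow> bool" where
  "pi_over ps N J \<longleftrightarrow>
     (\<forall>q x. Factorial_Ring.prime q \<longrightarrow> q \<notin> ps \<longrightarrow> x \<in> J \<longrightarrow> q_elt q x \<longrightarrow> x \<in> N)"

lemma pi_overD: "pi_over ps N J \<Longrightarrow> Factorial_Ring.prime q \<Longrightarrow> q \<notin> ps \<Longrightarrow> x \<in> J \<Longrightarrow> q_elt q x \<Longrightarrow> x \<in> N"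
  unfolding pi_over_def by blast

lemma pi_over_mono: "pi_over ps N J \<Longrightarrow> N \<subseteq> N' \<Longrightarrow> J' \<subseteq> J \<Longrightarrow> pi_over ps N' J'"
  unfolding pi_over_def by blast

lemma coprime_if_no_common_prime:
  fixes m n :: nat
  assumes "\<And>r. Factorial_Ring.prime r \<Longrightarrow> r dvd m \<Longrightarrow> r dvd n \<Longrightarrow> False"
  shows "coprime m n"
  using assms prime_factor_nat[of "gcd m n"] by (auto simp: coprime_iff_gcd_eq_1)

lemma q_elt_closed: "q_elt q x \<Longrightarrow> x \<in> carrier G"
  by (simp add: q_elt_def)

lemma subgroup_nat_pow: "subgroup N G \<Longrightarrow> x \<in> N \<Longrightarrow> x [^] (n::nat) \<in> N"
  by (induction n) (auto simp: subgroup.one_closed subgroup.m_closed)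

lemma conj_nat_pow:
  assumes "x \<in> carrier G" "y \<in> carrier G"
  shows "(inv x \<otimes> y \<otimes> x) [^] (n::nat) = inv x \<otimes> (y [^] n) \<otimes> x"
proof (induction n)
  case (Suc n)
  have "(inv x \<otimes> y \<otimes> x) [^] Suc n = (inv x \<otimes> (y [^] n) \<otimes> x) \<otimes> (inv x \<otimes> y \<otimes> x)"
    using Suc by simp
  also have "\<dots> = inv x \<otimes> (y [^] Suc n) \<otimes> x" using assms by (simp add: m_assoc)
  finally show ?case .
qed (use assms in simp)

lemma q_elt_conj:
  assumes "q_elt q y" "x \<in> carrier G"
  shows "q_elt q (inv x \<otimes> y \<otimes> x)"
proof -
  obtain n :: nat where "y [^] (q ^ n) = \<one>" and y: "y \<in> carrier G"
    using assms by (auto simp: q_elt_def)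
  then have "(inv x \<otimes> y \<otimes> x) [^] (q ^ n) = \<one>" using assms by (simp add: conj_nat_pow)
  then show ?thesis using assms y unfolding q_elt_def by blast
qed

lemma coprime_powers_mem:
  assumes N: "subgroup N G" and x: "x \<in> carrier G"
    and a: "x [^] (a::nat) \<in> N" and b: "x [^] (b::nat) \<in> N" and ab: "coprime a b"
  shows "x \<in> N"
proof -
  obtain u v :: int where uv: "u * int a + v * int b = 1"
    using ab bezout_int[of "int a" "int b"] by (auto simp: coprime_iff_gcd_eq_1)
  have pow: "x [^] (w * int m) \<in> N" if "x [^] m \<in> N" for w :: int and m :: nat
  proof -
    have "x [^] (w * int m) = (x [^] m) [^] w"
      using x by (simp add: int_pow_int[symmetric] int_pow_pow mult.commute)
    then show ?thesis using subgroup_int_pow_closed[OF N that] by simp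
  qed
  have "x = x [^] (u * int a + v * int b)" using x by (simp add: uv)
  also have "\<dots> = x [^] (u * int a) \<otimes> x [^] (v * int b)" using x by (simp add: int_pow_mult)
  also have "\<dots> \<in> N" using pow a b N by (simp add: subgroup.m_closed)
  finally show ?thesis .
qed

end

locale fin_group = group +
  assumes fin: "finite (carrier G)"
begin

lemma finite_subgroup: "subgroup N G \<Longrightarrow> finite N"
  using fin by (meson finite_subset subgroup.subset)

lemma card_subgroup_pos: "subgroup N G \<Longrightarrow> card N > 0"
  using finite_subgroup subgroup.one_closed by (metis card_gt_0_iff empty_iff)

text \<open>The map from \<open>A \<times> B\<close> to \<open>A <#> B\<close> is surjective and each fibre is a copy of
  \<open>A \<inter> B\<close>.\<close>

lemma card_set_mult:
  assumes A: "subgroup A G" and B: "subgroup B G"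
  shows "card (A <#> B) * card (A \<inter> B) = card A * card B"
proof -
  have Ac: "A \<subseteq> carrier G" and Bc: "B \<subseteq> carrier G" using A B by (auto dest: subgroup.subset)
  let ?f = "\<lambda>(a, b). a \<otimes> b"
  have img: "?f ` (A \<times> B) = A <#> B" by (auto simp: set_mult_def)
  have fib: "card {p \<in> A \<times> B. ?f p = y} = card (A \<inter> B)" if y: "y \<in> A <#> B" for y
  proof -
    obtain a b where ab: "a \<in> A" "b \<in> B" "y = a \<otimes> b" using y by (rule set_multE)
    have "bij_betw (\<lambda>c. (a \<otimes> c, inv c \<otimes> b)) (A \<inter> B) {p \<in> A \<times> B. ?f p = y}"
    proof (rule bij_betwI[where g = "\<lambda>(u, v). inv a \<otimes> u"])
      show "(\<lambda>c. (a \<otimes> c, inv c \<otimes> b)) \<in> A \<inter> B \<rightarrow> {p \<in> A \<times> B. ?f p = y}"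
        using ab A B Ac Bc
        by (auto simp: subgroup.m_closed subgroup.m_inv_closed m_assoc subset_iff)
      show "(\<lambda>(u, v). inv a \<otimes> u) \<in> {p \<in> A \<times> B. ?f p = y} \<rightarrow> A \<inter> B"
      proof
        fix p assume "p \<in> {p \<in> A \<times> B. ?f p = y}"
        then obtain u v where p: "p = (u, v)" "u \<in> A" "v \<in> B" "u \<otimes> v = a \<otimes> b" using ab by auto
        have c: "u \<in> carrier G" "v \<in> carrier G" "a \<in> carrier G" "b \<in> carrier G"
          using p ab Ac Bc by auto
        have "inv a \<otimes> u = inv a \<otimes> (u \<otimes> v) \<otimes> inv v" using c by (simp add: m_assoc)
        also have "\<dots> = b \<otimes> inv v" unfolding p(4) using c by (simp add: m_assoc)
        finally show "(case p of (u, v) \<Rightarrow> inv a \<otimes> u) \<in> A \<inter> B"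
          using p ab A B c by (metis (no_types, lifting) IntI case_prod_conv subgroup.m_closed subgroup.m_inv_closed)
      qed
      show "(case (a \<otimes> c, inv c \<otimes> b) of (u, v) \<Rightarrow> inv a \<otimes> u) = c" if "c \<in> A \<inter> B" for c
        using that ab Ac Bc by (auto simp: subset_iff)
      show "(\<lambda>c. (a \<otimes> c, inv c \<otimes> b)) (case p of (u, v) \<Rightarrow> inv a \<otimes> u) = p"
        if p: "p \<in> {p \<in> A \<times> B. ?f p = y}" for p
      proof -
        obtain u v where p: "p = (u, v)" "u \<in> A" "v \<in> B" "u \<otimes> v = a \<otimes> b" using ab p by auto
        have c: "u \<in> carrier G" "v \<in> carrier G" "a \<in> carrier G" "b \<in> carrier G"
          using p ab Ac Bc by auto
        have "inv (inv a \<otimes> u) \<otimes> b = inv u \<otimes> (a \<otimes> b)" using c by (simp add: inv_mult_group m_assoc)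
        also have "\<dots> = v" unfolding p(4)[symmetric] using c by simp
        finally show ?thesis using p c by simp
      qed
    qed
    then show ?thesis by (simp add: bij_betw_same_card)
  qed
  have "card A * card B = (\<Sum>p\<in>A \<times> B. 1)" by (simp add: card_cartesian_product)
  also have "\<dots> = (\<Sum>y\<in>?f ` (A \<times> B). \<Sum>p\<in>{p \<in> A \<times> B. ?f p = y}. 1)"
    using A B by (intro sum.image_gen) (simp add: finite_subgroup)
  also have "\<dots> = (\<Sum>y\<in>A <#> B. card (A \<inter> B))" unfolding img using fib by (intro sum.cong) auto
  finally show ?thesis by simp
qed

lemma card_subgroup_dvd:
  assumes "subgroup N G" "subgroup J G" "N \<subseteq> J"
  shows "card N dvd card J"
proof -
  interpret J: group "G\<lparr>carrier := J\<rparr>"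
    using assms(2) by (rule subgroup.subgroup_is_group) (rule is_group)
  have "subgroup N (G\<lparr>carrier := J\<rparr>)" using assms by (intro subgroup_incl)
  from J.lagrange[OF this] show ?thesis by (auto simp: order_def) (metis dvd_triv_right)
qed

text \<open>The exponent of the quotient group \<open>J / N\<close> divides its order.\<close>

lemma index_pow_mem:
  assumes N: "normal_in N J" and card: "card J = card N * n" and x: "x \<in> J"
  shows "x [^] n \<in> N"
proof -
  note nd = normal_inD[OF N]
  interpret N: normal N "G\<lparr>carrier := J\<rparr>" using N by (rule normal_in_restrict)
  interpret Q: group "G\<lparr>carrier := J\<rparr> Mod N" by (rule N.factorgroup_is_group)
  have "card (rcosets\<^bsub>G\<lparr>carrier := J\<rparr>\<^esub> N) * card N = card J"
    using N.lagrange[OF N.is_subgroup] by (simp add: order_def)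
  then have o: "order (G\<lparr>carrier := J\<rparr> Mod N) = n"
    using card card_subgroup_pos[OF nd(1)] by (simp add: order_def FactGroup_def)
  have "(N #> x) [^]\<^bsub>G\<lparr>carrier := J\<rparr> Mod N\<^esub> n = N"
    using Q.pow_order_eq_1[of "N #> x"] x o by (auto simp: FactGroup_def RCOSETS_def r_coset_consistent)
  then have "N #>\<^bsub>G\<lparr>carrier := J\<rparr>\<^esub> (x [^]\<^bsub>G\<lparr>carrier := J\<rparr>\<^esub> n) = N"
    using N.FactGroup_pow[of x n] x by simp
  then have "x [^]\<^bsub>G\<lparr>carrier := J\<rparr>\<^esub> n \<in> N"
    using N.rcos_self[of "x [^]\<^bsub>G\<lparr>carrier := J\<rparr>\<^esub> n" N] N.nat_pow_closed[of x n] x N.is_subgroup by auto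
  then show ?thesis by (simp add: nat_pow_consistent[symmetric])
qed

lemma q_elt_mem_normal:
  assumes N: "normal_in N J" and card: "card J = card N * n" and q: "Factorial_Ring.prime q" "\<not> q dvd n"
    and x: "x \<in> J" "q_elt q x"
  shows "x \<in> N"
proof -
  obtain k :: nat where k: "x [^] (q ^ k) = \<one>" using x by (auto simp: q_elt_def)
  have N': "subgroup N G" using normal_inD[OF N] by simp
  show ?thesis
  proof (rule coprime_powers_mem[OF N' q_elt_closed[OF x(2)]])
    show "x [^] (q ^ k) \<in> N" using k N' by (simp add: subgroup.one_closed)
    show "x [^] n \<in> N" using N card x(1) by (rule index_pow_mem)
    show "coprime (q ^ k) n" using q by (simp add: prime_imp_coprime)
  qed
qed

lemma q_elt_subgroup_card:
  assumes "subgroup S G" "card S = q ^ a" "x \<in> S"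
  shows "q_elt q x"
proof -
  have "x [^] card S \<in> {\<one>}"
    by (rule index_pow_mem[where J = S])
       (use assms in \<open>auto intro!: normal_in_one\<close>)
  then show ?thesis using assms unfolding q_elt_def by (auto dest: subgroup.mem_carrier)
qed

text \<open>A Sylow \<open>q\<close>-subgroup of \<open>J\<close> consists of elements of \<open>q\<close>-power order, so it lies in
  \<open>N\<close>.\<close>

lemma index_coprime_if_q_elts:
  assumes N: "subgroup N G" and J: "subgroup J G" and NJ: "N \<subseteq> J" and q: "Factorial_Ring.prime q"
    and mem: "\<And>x. x \<in> J \<Longrightarrow> q_elt q x \<Longrightarrow> x \<in> N" and card: "card J = card N * n"
  shows "\<not> q dvd n"
proof
  assume "q dvd n"
  interpret J: group "G\<lparr>carrier := J\<rparr>"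
    using J by (rule subgroup.subgroup_is_group) (rule is_group)
  define a where "a = multiplicity q (card J)"
  have "q ^ a dvd card J" by (simp add: a_def multiplicity_dvd)
  then obtain m where m: "card J = q ^ a * m" by (elim dvdE)
  have "\<exists>S. subgroup S (G\<lparr>carrier := J\<rparr>) \<and> card S = q ^ a"
    by (rule sylow_thm[of q "G\<lparr>carrier := J\<rparr>" a m])
       (use q m J in \<open>auto simp: order_def finite_subgroup J.is_group\<close>)
  then obtain S where S: "subgroup S (G\<lparr>carrier := J\<rparr>)" "card S = q ^ a" by blast
  have SG: "subgroup S G" using S(1) J incl_subgroup by blast
  have SJ: "S \<subseteq> J" using subgroup.subset[OF S(1)] by simp
  have "S \<subseteq> N" using mem q_elt_subgroup_card[OF SG S(2)] SJ by blast
  then have "q ^ a dvd card N" using card_subgroup_dvd[OF SG N] S by simp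
  then have "q ^ Suc a dvd card J" using \<open>q dvd n\<close> unfolding card by (simp add: mult.commute mult_dvd_mono)
  moreover have "card J \<noteq> 0" using card_subgroup_pos[OF J] by simp
  ultimately show False
    using q by (metis a_def multiplicity_geI not_less_eq_eq order_refl not_prime_unit)
qed

lemma pi_over_index:
  assumes "subgroup N G" "subgroup J G" "N \<subseteq> J" "pi_over ps N J"
    and "Factorial_Ring.prime q" "q \<notin> ps" "card J = card N * n"
  shows "\<not> q dvd n"
  using assms by (intro index_coprime_if_q_elts) (auto dest: pi_overD)

lemma pi_overI_index:
  assumes N: "normal_in N J" and "card J = card N * n"
    and "\<And>q. Factorial_Ring.prime q \<Longrightarrow> q dvd n \<Longrightarrow> q \<in> ps"
  shows "pi_over ps N J"
  unfolding pi_over_def using q_elt_mem_normal[OF N assms(2)] assms(3) by blast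

text \<open>No prime divides the index of \<open>N\<close> in \<open>J\<close>.\<close>

lemma all_q_elts_imp_eq:
  assumes N: "subgroup N G" and J: "subgroup J G" and NJ: "N \<subseteq> J"
    and mem: "\<And>q x. Factorial_Ring.prime q \<Longrightarrow> x \<in> J \<Longrightarrow> q_elt q x \<Longrightarrow> x \<in> N"
  shows "N = J"
proof -
  obtain n where n: "card J = card N * n" using card_subgroup_dvd[OF N J NJ] by (elim dvdE)
  have "\<not> q dvd n" if "Factorial_Ring.prime q" for q
    using index_coprime_if_q_elts[OF N J NJ that mem[OF that] n] .
  then have "n = 1" using prime_factor_nat[of n] by blast
  then show ?thesis using n NJ card_subset_eq[OF finite_subgroup[OF J] NJ] by simp
qed

lemma pi_over_Cauchy:
  assumes J: "subgroup J G"
  shows "pi_over ps {\<one>} J \<longleftrightarrow> (\<forall>q. Factorial_Ring.prime q \<and> q dvd card J \<longrightarrow> q \<in> ps)"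
proof
  assume *: "pi_over ps {\<one>} J"
  show "\<forall>q. Factorial_Ring.prime q \<and> q dvd card J \<longrightarrow> q \<in> ps"
    using pi_over_index[OF triv_subgroup J _ *] J by (auto simp: subgroup.one_closed)
next
  assume "\<forall>q. Factorial_Ring.prime q \<and> q dvd card J \<longrightarrow> q \<in> ps"
  then show "pi_over ps {\<one>} J"
    using J by (intro pi_overI_index[where n = "card J"]) (auto intro: normal_in_one)
qed

text \<open>The index of \<open>B \<inter> H\<close> in \<open>B\<close> equals the index of \<open>H\<close> in the subgroup
  \<open>H <#> B\<close> of \<open>J\<close>.\<close>

lemma index_Int_normal:
  assumes B: "normal_in B J" and H: "subgroup H G" "H \<subseteq> J" and n: "card J = card H * n"
  obtains m where "card B = card (B \<inter> H) * m" "m dvd n"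
proof -
  note b = normal_inD[OF B]
  have comm: "H <#> B = B <#> H" by (rule normalized_permute) (use H b in auto)
  have HB: "subgroup (H <#> B) G" using H b comm by (intro permuting_subgroup) auto
  have sub: "H <#> B \<subseteq> J" using H b by (intro set_mult_least) auto
  have "card H dvd card (H <#> B)"
    using H HB subgroup_set_mult_subsets(1)[OF H(1) b(1)] by (intro card_subgroup_dvd)
  then obtain m where m: "card (H <#> B) = card H * m" by (rule dvdE)
  have "card H * m * card (H \<inter> B) = card H * card B" using card_set_mult[OF H(1) b(1)] m by simp
  then have "card B = card (B \<inter> H) * m"
    using card_subgroup_pos[OF H(1)] by (simp add: mult.assoc Int_commute mult.commute)
  moreover have "m dvd n"
    using card_subgroup_dvd[OF HB b(2) sub] m n card_subgroup_pos[OF H(1)] by simp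
  ultimately show thesis by (rule that)
qed

lemma index_permuting:
  assumes H: "subgroup H G" and Q: "subgroup Q G"
  obtains n where "card (H <#> Q) = card H * n" "n dvd card Q"
proof -
  have i: "subgroup (H \<inter> Q) G" using H Q by (rule subgroups_Inter_pair)
  obtain n where n: "card Q = card (H \<inter> Q) * n"
    using card_subgroup_dvd[OF i Q] by (auto elim: dvdE)
  have "card (H <#> Q) * card (H \<inter> Q) = card H * n * card (H \<inter> Q)"
    unfolding card_set_mult[OF H Q] by (subst n) (simp only: mult.assoc mult.commute mult.left_commute)
  moreover have "card (H \<inter> Q) \<noteq> 0" using card_subgroup_pos[OF i] by simp
  ultimately have "card (H <#> Q) = card H * n" by (metis mult_right_cancel)
  then show thesis using n by (intro that[of n]) auto
qed

text \<open>By Bezout there is an exponent that is divisible by the part of the group order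
  prime to \<open>q\<close> and congruent to \<open>1\<close> modulo \<open>q ^ k\<close>; the corresponding power of \<open>x\<close> has \<open>q\<close>-power
  order and lies in the same coset.\<close>

lemma q_elt_representative:
  assumes N: "subgroup N G" and x: "x \<in> carrier G" and q: "Factorial_Ring.prime q" and pow: "x [^] (q ^ k) \<in> N"
  obtains y n where "q_elt q y" "y = x [^] (n::int)" "y \<otimes> inv x \<in> N"
proof -
  have "order G \<noteq> 0" using fin order_gt_0_iff_finite by simp
  then obtain b m where bm: "order G = q ^ b * m" "\<not> q dvd m"
    using multiplicity_decompose'[of "order G" q] q not_prime_unit by metis
  have "coprime m (q ^ k)" using prime_imp_coprime[OF q bm(2)] by (simp add: coprime_commute)
  then have "gcd (int m) (int (q ^ k)) = 1" unfolding gcd_int_int_eq by simp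
  then obtain u v :: int where uv: "u * int m + v * int (q ^ k) = 1"
    using bezout_int[of "int m" "int (q ^ k)"] by auto
  define y where "y = x [^] (int m * u)"
  have "y [^] (q ^ b) = x [^] (int (order G) * u)"
    unfolding y_def bm(1) using x by (simp add: int_pow_int[symmetric] int_pow_pow algebra_simps)
  also have "\<dots> = (x [^] order G) [^] u"
    using x by (simp only: int_pow_int[symmetric] int_pow_pow)
  also have "\<dots> = \<one>" using x pow_order_eq_1 by simp
  finally have 1: "q_elt q y" unfolding q_elt_def using x by (auto simp: y_def)
  have "int m * u = 1 + int (q ^ k) * (- v)" using uv by (simp add: algebra_simps)
  then have "y = x \<otimes> (x [^] (q ^ k)) [^] (- v)"
    unfolding y_def using x by (simp only: int_pow_mult int_pow_1 int_pow_pow int_pow_int[symmetric])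
  moreover have "x \<otimes> (x [^] (q ^ k)) [^] (- v) = (x [^] (q ^ k)) [^] (- v) \<otimes> x"
    using x int_pow_mult[of x 1 "int (q ^ k) * (- v)"] int_pow_mult[of x "int (q ^ k) * (- v)" 1]
    by (simp only: int_pow_1 int_pow_pow int_pow_int[symmetric] add.commute)
  ultimately have "y \<otimes> inv x = (x [^] (q ^ k)) [^] (- v)"
    using x by (simp add: m_assoc)
  then have "y \<otimes> inv x \<in> N" using subgroup_int_pow_closed[OF N pow] by simp
  with 1 show thesis using that y_def by blast
qed

end

section \<open>Subgroups permuting with all conjugates of another subgroup\<close>

context group
begin

definition minimal_normal :: "'a set \<Rightarrow> 'a set \<Rightarrow> bool" where
  "minimal_normal M J \<longleftrightarrow> normal_in M J \<and> M \<noteq> {\<one>} \<and>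
     (\<forall>L. normal_in L J \<longrightarrow> L \<subseteq> M \<longrightarrow> L = {\<one>} \<or> L = M)"

lemma minimal_normalD:
  assumes "minimal_normal M J"
  shows "normal_in M J" "M \<noteq> {\<one>}" "\<And>L. normal_in L J \<Longrightarrow> L \<subseteq> M \<Longrightarrow> L = {\<one>} \<or> L = M"
  using assms by (auto simp: minimal_normal_def)

lemma minimal_normal_generate:
  assumes M: "minimal_normal M J" and S: "S \<subseteq> M" "\<not> S \<subseteq> {\<one>}"
    and conj: "\<And>x s. x \<in> J \<Longrightarrow> s \<in> S \<Longrightarrow> inv x \<otimes> s \<otimes> x \<in> S"
  shows "generate G S = M"
proof -
  note m = minimal_normalD[OF M] and n = normal_inD[OF minimal_normalD(1)[OF M]]
  have "normal_in (generate G S) J" using S(1) n conj by (intro normal_in_generate) auto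
  moreover have "generate G S \<subseteq> M" using S(1) n(1) by (rule generate_subgroup_incl)
  moreover have "generate G S \<noteq> {\<one>}" using S(2) generate.incl[of _ S G] by auto
  ultimately show ?thesis using m(3) by blast
qed

lemma minimal_normal_conj_closure:
  assumes M: "minimal_normal M J" and S: "S \<subseteq> M" "\<not> S \<subseteq> {\<one>}"
  shows "generate G (\<Union>x\<in>J. conj_set G S x) = M"
proof -
  note m = minimal_normalD[OF M] and n = normal_inD[OF minimal_normalD(1)[OF M]]
  have SJ: "S \<subseteq> J" using S(1) n(3) by blast
  have "(\<Union>x\<in>J. conj_set G S x) \<subseteq> M"
    using conj_set_mono[OF S(1)] normal_in_conj_set[OF m(1)] by auto
  then have "generate G (\<Union>x\<in>J. conj_set G S x) \<subseteq> M" using n(1) by (rule generate_subgroup_incl)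
  moreover have "generate G (\<Union>x\<in>J. conj_set G S x) \<noteq> {\<one>}"
    using normal_in_conj_closure(2)[OF SJ n(2)] S(2) by auto
  ultimately show ?thesis using m(3)[OF normal_in_conj_closure(1)[OF SJ n(2)]] by blast
qed

lemma minimal_normal_Int:
  assumes M: "minimal_normal M J" and D: "normal_in D J"
  shows "M \<inter> D = {\<one>} \<or> M \<subseteq> D"
  using minimal_normalD(3)[OF M normal_in_Int2[OF minimal_normalD(1)[OF M] D]] by auto

lemma minimal_normal_conj:
  assumes M: "minimal_normal M J" and x: "x \<in> carrier G" and J: "conj_set G J x = J"
  shows "minimal_normal (conj_set G M x) J"
proof -
  note m = minimal_normalD[OF M] and n = normal_inD[OF minimal_normalD(1)[OF M]]
  have Mc: "M \<subseteq> carrier G" using n by (simp add: subgroup.subset)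
  have J': "conj_set G J (inv x) = J"
    using conj_set_inverse(1)[of J x] J x n(2) by (simp add: subgroup.subset)
  have one: "conj_set G {\<one>} y = {\<one>}" if "y \<in> carrier G" for y
    using that by (auto simp: conj_set_def)
  show ?thesis unfolding minimal_normal_def
  proof (intro conjI allI impI)
    show "normal_in (conj_set G M x) J" using m(1) x J by (rule conj_set_normal_in)
    show "conj_set G M x \<noteq> {\<one>}"
      using conj_set_inverse(1)[OF Mc x] one[of "inv x"] x m(2) by auto
    fix L assume L: "normal_in L J" "L \<subseteq> conj_set G M x"
    have Lc: "L \<subseteq> carrier G" using normal_inD(1)[OF L(1)] by (rule subgroup.subset)
    have "normal_in (conj_set G L (inv x)) J" using L(1) x J' by (intro conj_set_normal_in) auto
    moreover have "conj_set G L (inv x) \<subseteq> M"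
      using conj_set_mono[OF L(2), of "inv x"] conj_set_inverse(1)[OF Mc x] by simp
    ultimately have "conj_set G L (inv x) = {\<one>} \<or> conj_set G L (inv x) = M" using m(3) by blast
    then show "L = {\<one>} \<or> L = conj_set G M x"
      using conj_set_inverse(2)[OF Lc x] one[OF x] by auto
  qed
qed

lemma conj_set_generate:
  assumes S: "S \<subseteq> carrier G" and x: "x \<in> carrier G"
  shows "conj_set G (generate G S) x = generate G (conj_set G S x)"
proof
  have Sx: "conj_set G S x \<subseteq> carrier G" using S x by (rule conj_set_subset)
  show "conj_set G (generate G S) x \<subseteq> generate G (conj_set G S x)"
  proof
    fix y assume "y \<in> conj_set G (generate G S) x"
    then obtain s where s: "s \<in> generate G S" "y = inv x \<otimes> s \<otimes> x" by (auto simp: conj_set_def)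
    show "y \<in> generate G (conj_set G S x)" unfolding s(2)
      by (rule conj_generate_closed[OF S x generate_is_subgroup[OF Sx] _ s(1)])
         (auto intro: generate.incl conj_set_memI)
  qed
  show "generate G (conj_set G S x) \<subseteq> conj_set G (generate G S) x"
    using S x generate.incl[of _ S G]
    by (intro generate_subgroup_incl conj_set_subgroup generate_is_subgroup conj_set_mono) auto
qed

lemma conj_set_Int:
  assumes "A \<subseteq> carrier G" "B \<subseteq> carrier G" "x \<in> carrier G"
  shows "conj_set G (A \<inter> B) x = conj_set G A x \<inter> conj_set G B x"
proof -
  have "inj_on (\<lambda>p. inv x \<otimes> p \<otimes> x) (carrier G)"
    using assms by (intro inj_onI) auto
  then show ?thesis unfolding conj_set_def using assms by (intro inj_on_image_Int)
qed

lemma conj_permute: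
  assumes "A \<subseteq> carrier G" "B \<subseteq> carrier G" "x \<in> carrier G" "A <#> B = B <#> A"
  shows "conj_set G A x <#> conj_set G B x = conj_set G B x <#> conj_set G A x"
  using conj_set_set_mult[OF assms(1-3)] conj_set_set_mult[OF assms(2,1,3)] assms(4) by simp

text \<open>An element of the join is a product of elements of the members, and \<open>A\<close> is moved
  past the factors one at a time.\<close>

lemma permute_generate:
  assumes A: "subgroup A G" and F: "\<And>V. V \<in> F \<Longrightarrow> subgroup V G \<and> A <#> V = V <#> A"
  shows "A <#> generate G (\<Union>F) = generate G (\<Union>F) <#> A"
proof -
  define W where "W = generate G (\<Union>F)"
  have Fc: "\<Union>F \<subseteq> carrier G" using F by (auto dest: subgroup.mem_carrier)
  have W: "subgroup W G" unfolding W_def using Fc by (rule generate_is_subgroup)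
  have FW: "V \<subseteq> W" if "V \<in> F" for V using that generate.incl[of _ "\<Union>F" G] by (auto simp: W_def)
  have Ac: "A \<subseteq> carrier G" and Wc: "W \<subseteq> carrier G" using A W by (auto dest: subgroup.subset)
  have step: "h \<otimes> a \<in> A <#> W" if "h \<in> V" "V \<in> F" "a \<in> A" for h a V
  proof -
    have "h \<otimes> a \<in> A <#> V" using F that by (auto intro: set_multI)
    then show ?thesis using mono_set_mult[OF order_refl FW[OF that(2)]] by blast
  qed
  have move: "w \<in> generate G (\<Union>F) \<Longrightarrow> \<forall>a\<in>A. w \<otimes> a \<in> A <#> W" for w
  proof (induction rule: generate.induct)
    case one
    then show ?case using subset_set_mult_left[OF Ac] W Ac by (auto simp: subgroup.one_closed subset_iff)
  next
    case (incl h)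
    then show ?case using step by blast
  next
    case (inv h)
    then obtain V where V: "V \<in> F" "h \<in> V" by blast
    then have "inv h \<in> V" using F by (simp add: subgroup.m_inv_closed)
    then show ?case using step V by blast
  next
    case (eng w v)
    show ?case
    proof
      fix a assume a: "a \<in> A"
      obtain a1 v1 where 1: "a1 \<in> A" "v1 \<in> W" "v \<otimes> a = a1 \<otimes> v1" using eng a by (meson set_multE)
      obtain a2 w2 where 2: "a2 \<in> A" "w2 \<in> W" "w \<otimes> a1 = a2 \<otimes> w2" using eng 1 by (meson set_multE)
      have c: "w \<in> carrier G" "v \<in> carrier G" using eng generate_in_carrier[OF Fc] by auto
      have "w \<otimes> v \<otimes> a = (w \<otimes> a1) \<otimes> v1"
        using 1 c a Ac Wc by (simp add: m_assoc subset_iff)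
      also have "\<dots> = a2 \<otimes> (w2 \<otimes> v1)" unfolding 2(3) using 1 2 Ac Wc by (simp add: m_assoc subset_iff)
      finally show "w \<otimes> v \<otimes> a \<in> A <#> W" using 1 2 W by (auto intro: set_multI simp: subgroup.m_closed)
    qed
  qed
  have sub: "W <#> A \<subseteq> A <#> W"
    using move unfolding W_def[symmetric] by (auto elim!: set_multE)
  have "A <#> W \<subseteq> W <#> A"
  proof
    fix x assume "x \<in> A <#> W"
    then obtain a v where av: "a \<in> A" "v \<in> W" "x = a \<otimes> v" by (rule set_multE)
    have "inv v \<otimes> inv a \<in> A <#> W"
      using av by (intro subsetD[OF sub] set_multI subgroup.m_inv_closed A W)
    then obtain b u where bu: "b \<in> A" "u \<in> W" "inv v \<otimes> inv a = b \<otimes> u" by (rule set_multE)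
    have "x = inv (inv v \<otimes> inv a)" using av Ac Wc by (simp add: inv_mult_group subset_iff)
    also have "\<dots> = inv u \<otimes> inv b" unfolding bu(3) using bu Ac Wc by (simp add: inv_mult_group subset_iff)
    finally show "x \<in> W <#> A" using bu A W by (auto intro: set_multI simp: subgroup.m_inv_closed)
  qed
  with sub show ?thesis unfolding W_def by blast
qed

text \<open>Write \<open>g = b \<otimes> a\<close>: conjugation by \<open>b\<close> fixes \<open>B\<close>, and conjugation by \<open>a\<close>
  fixes \<open>A\<close> and \<open>J\<close>.\<close>

lemma set_mult_conj_eq_all:
  assumes A: "subgroup A G" and B: "subgroup B G" and J: "subgroup J G"
    and AB: "A <#> B = J" and g: "g \<in> J"
  shows "A <#> conj_set G B g = J"
proof -
  have sub: "A \<subseteq> carrier G" "B \<subseteq> carrier G" using A B by (auto dest: subgroup.subset)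
  have "J = B <#> A" using subgroup_set_mult_commute[OF A B] AB J by simp
  with g obtain b a where ba: "b \<in> B" "a \<in> A" "g = b \<otimes> a" by (auto elim: set_multE)
  have c: "a \<in> carrier G" "b \<in> carrier G" using ba sub by auto
  have "A \<subseteq> J" using subgroup_set_mult_subsets(1)[OF A B] AB by simp
  have "conj_set G B g = conj_set G B a"
    using conj_set_conj_set[OF sub(2) c(2,1)] conj_set_self[OF B ba(1)] ba(3) by simp
  then have "A <#> conj_set G B g = conj_set G A a <#> conj_set G B a"
    using conj_set_self[OF A ba(2)] by simp
  also have "\<dots> = conj_set G J a" using conj_set_set_mult[OF sub c(1)] AB by simp
  also have "\<dots> = J" using conj_set_self[OF J] ba \<open>A \<subseteq> J\<close> by blast
  finally show ?thesis .
qed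

lemma Dedekind_left:
  assumes A: "subgroup A G" and D: "subgroup D G" and "A \<subseteq> D" "B \<subseteq> carrier G"
  shows "A <#> (B \<inter> D) = (A <#> B) \<inter> D"
proof
  show "A <#> (B \<inter> D) \<subseteq> (A <#> B) \<inter> D"
    using assms(3) D by (auto simp: set_mult_def subgroup.m_closed subset_iff)
  show "(A <#> B) \<inter> D \<subseteq> A <#> (B \<inter> D)"
  proof
    fix x assume x: "x \<in> (A <#> B) \<inter> D"
    then obtain a b where ab: "a \<in> A" "b \<in> B" "x = a \<otimes> b" by (auto elim: set_multE)
    have "inv a \<otimes> x \<in> D" using x ab assms by (auto simp: subgroup.m_closed subgroup.m_inv_closed)
    moreover have "inv a \<otimes> x = b" using ab assms by (auto simp: subgroup.mem_carrier)
    ultimately show "x \<in> A <#> (B \<inter> D)" using ab by (auto intro: set_multI)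
  qed
qed

end

context fin_group
begin

text \<open>In a finite group a subgroup mapped into itself by a conjugation is mapped onto
  itself, which gives closure under inverses.\<close>

lemma normalizer_subgroup:
  assumes C: "subgroup C G"
  shows "subgroup {x \<in> carrier G. \<forall>c\<in>C. inv x \<otimes> c \<otimes> x \<in> C} G" (is "subgroup ?N G")
proof -
  have Cc: "C \<subseteq> carrier G" using C by (rule subgroup.subset)
  have conjC: "conj_set G C x = C" if x: "x \<in> ?N" for x
  proof (rule card_subset_eq[OF finite_subgroup[OF C]])
    show "conj_set G C x \<subseteq> C" using x by (auto simp: conj_set_def)
    have "inj_on (\<lambda>p. inv x \<otimes> p \<otimes> x) C" using x Cc by (intro inj_onI) (auto simp: subset_iff)
    then show "card (conj_set G C x) = card C" unfolding conj_set_def by (rule card_image)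
  qed
  show ?thesis
  proof (rule subgroupI)
    show "?N \<noteq> {}" using Cc by (auto intro!: exI[of _ \<one>] simp: subset_iff)
    fix x assume x: "x \<in> ?N"
    then have "conj_set G C (inv x) = C" using conjC[OF x] conj_set_inverse(1)[OF Cc, of x] by simp
    then show "inv x \<in> ?N" using x conj_set_memI[of _ C "inv x"] by auto
  next
    fix x y assume xy: "x \<in> ?N" "y \<in> ?N"
    then have "conj_set G C (x \<otimes> y) = C"
      using conjC[OF xy(1)] conjC[OF xy(2)] conj_set_conj_set[OF Cc, of x y] by simp
    then show "x \<otimes> y \<in> ?N" using xy conj_set_memI[of _ C "x \<otimes> y"] by auto
  qed auto
qed

lemma minimal_normal_exists:
  assumes "normal_in N J" "N \<noteq> {\<one>}"
  obtains M where "minimal_normal M J" "M \<subseteq> N"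
proof -
  let ?S = "{M. normal_in M J \<and> M \<noteq> {\<one>} \<and> M \<subseteq> N}"
  obtain M where M: "M \<in> ?S" "\<And>L. L \<in> ?S \<Longrightarrow> card M \<le> card L"
    using arg_min_natI[of "\<lambda>M. M \<in> ?S" N card] arg_min_nat_le[of "\<lambda>M. M \<in> ?S" _ card] assms by blast
  have "L = M" if "normal_in L J" "L \<subseteq> M" "L \<noteq> {\<one>}" for L
  proof (rule card_subset_eq)
    show "finite M" using M normal_inD(1) finite_subgroup by blast
    show "L \<subseteq> M" by fact
    have "L \<in> ?S" using that M(1) by blast
    then show "card L = card M"
      using M(2)[of L] card_mono[OF \<open>finite M\<close> \<open>L \<subseteq> M\<close>] by (intro antisym)
  qed
  then have "minimal_normal M J" using M unfolding minimal_normal_def by blast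
  then show thesis using that M by blast
qed

text \<open>This is an argument of Kegel. Choose a subgroup \<open>C\<close> containing \<open>B\<close>, as large as
  possible, such that \<open>A\<close> permutes with all conjugates of \<open>C\<close> and \<open>A <#> C\<close> is not \<open>J\<close>. For a
  conjugate \<open>c\<close> of an element of \<open>A\<close>, say \<open>c = g \<otimes> a \<otimes> inv g\<close>, the join of \<open>C\<close>
  and its conjugate by \<open>c\<close> still permutes with \<open>A\<close>; conjugated by \<open>g\<close>, it stays inside
  \<open>A <#> conj_set G C g\<close>, which is proper. So the join is \<open>C\<close>, that is, all conjugates of \<open>A\<close>
  normalise \<open>C\<close>. Either they generate a proper subgroup, which is normal, or \<open>C\<close> itself is
  normal.\<close>

lemma permuting_proper_normal:
  assumes A: "subgroup A G" and B: "subgroup B G" and J: "subgroup J G" and AJ: "A \<subseteq> J" and BJ: "B \<subseteq> J"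
    and perm: "\<And>x. x \<in> J \<Longrightarrow> A <#> conj_set G B x = conj_set G B x <#> A"
    and ne: "A <#> B \<noteq> J"
  obtains D where "normal_in D J" "D \<noteq> J" "A \<subseteq> D \<or> B \<subseteq> D"
proof -
  have Ac: "A \<subseteq> carrier G" and Jc: "J \<subseteq> carrier G" using A J by (auto dest: subgroup.subset)
  define P where "P C \<longleftrightarrow> subgroup C G \<and> B \<subseteq> C \<and> C \<subseteq> J \<and>
      (\<forall>x\<in>J. A <#> conj_set G C x = conj_set G C x <#> A) \<and> A <#> C \<noteq> J" for C
  have PB: "P B" using assms by (simp add: P_def)
  have bound: "\<forall>C. P C \<longrightarrow> card C < Suc (card J)"
    using card_mono[OF finite_subgroup[OF J]] by (auto simp: P_def less_Suc_eq_le)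
  obtain C where C: "P C" and max: "\<And>C'. P C' \<Longrightarrow> card C' \<le> card C"
    using ex_has_greatest_nat[of P B card "Suc (card J)"] PB bound by (meson less_imp_le)
  have Cs: "subgroup C G" "B \<subseteq> C" "C \<subseteq> J" "A <#> C \<noteq> J"
    and Cp: "\<And>x. x \<in> J \<Longrightarrow> A <#> conj_set G C x = conj_set G C x <#> A"
    using C by (auto simp: P_def)
  have Cc: "C \<subseteq> carrier G" using Cs(1) by (rule subgroup.subset)
  have norm: "conj_set G C (g \<otimes> a \<otimes> inv g) \<subseteq> C" if a: "a \<in> A" and g: "g \<in> J" for a g
  proof -
    define c where "c = g \<otimes> a \<otimes> inv g"
    have gc: "g \<in> carrier G" "a \<in> carrier G" using a g Ac Jc by auto
    have cJ: "c \<in> J" using a g AJ J by (auto simp: c_def subgroup.m_closed subgroup.m_inv_closed)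
    then have cc: "c \<in> carrier G" using Jc by auto
    define F where "F = {C, conj_set G C c}"
    define C' where "C' = generate G (\<Union>F)"
    have FJ: "\<Union>F \<subseteq> J"
      using Cs(3) conj_set_mono[OF Cs(3), of c] conj_set_self[OF J cJ] by (auto simp: F_def)
    then have Fc: "\<Union>F \<subseteq> carrier G" using Jc by auto
    have conjF: "conj_set G C' x = generate G (\<Union>{conj_set G C x, conj_set G C (c \<otimes> x)})"
      if "x \<in> carrier G" for x
    proof -
      have "conj_set G C' x = generate G (conj_set G (\<Union>F) x)"
        unfolding C'_def using Fc that by (rule conj_set_generate)
      also have "conj_set G (\<Union>F) x = conj_set G C x \<union> conj_set G (conj_set G C c) x"
        by (auto simp: conj_set_def F_def)
      finally show ?thesis using conj_set_conj_set[OF Cc cc that] by simp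
    qed
    have sub: "subgroup C' G" unfolding C'_def using Fc by (rule generate_is_subgroup)
    have CC': "C \<subseteq> C'" "conj_set G C c \<subseteq> C'" using generate.incl[of _ "\<Union>F" G] by (auto simp: C'_def F_def)
    have C'J: "C' \<subseteq> J" unfolding C'_def using FJ J by (rule generate_subgroup_incl)
    have perm': "A <#> conj_set G C' x = conj_set G C' x <#> A" if x: "x \<in> J" for x
    proof -
      have xc: "x \<in> carrier G" using x Jc by auto
      have cx: "c \<otimes> x \<in> J" using cJ x J by (simp add: subgroup.m_closed)
      show ?thesis unfolding conjF[OF xc]
        by (rule permute_generate[OF A])
           (use Cp x cx Cs(1) Jc in \<open>auto intro!: conj_set_subgroup\<close>)
    qed
    have "A <#> C' \<noteq> J"
    proof
      assume "A <#> C' = J"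
      then have full: "A <#> conj_set G C' g = J" using set_mult_conj_eq_all[OF A sub J] g by simp
      define E where "E = A <#> conj_set G C g"
      have Cg: "subgroup (conj_set G C g) G" using Cs(1) gc by (intro conj_set_subgroup)
      have E: "subgroup E G" unfolding E_def using A Cg Cp[OF g] by (rule permuting_subgroup)
      have in_E: "A \<subseteq> E" "conj_set G C g \<subseteq> E" using subgroup_set_mult_subsets[OF A Cg] by (auto simp: E_def)
      \<comment> \<open>The conjugate of \<open>C\<close> by \<open>c \<otimes> g = g \<otimes> a\<close> stays inside the
        subgroup \<open>E\<close>, because \<open>a\<close> belongs to \<open>E\<close>.\<close>
      have "c \<otimes> g = g \<otimes> a" using gc by (simp add: c_def m_assoc)
      then have "conj_set G C (c \<otimes> g) = conj_set G (conj_set G C g) a"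
        using conj_set_conj_set[OF Cc gc] by simp
      also have "\<dots> \<subseteq> conj_set G E a" using in_E(2) by (rule conj_set_mono)
      also have "\<dots> = E" using E in_E(1) a by (intro conj_set_self) auto
      finally have "conj_set G C' g \<subseteq> E"
        unfolding conjF[OF gc(1)] using in_E(2) E by (intro generate_subgroup_incl) auto
      then have "J \<subseteq> E" using full in_E(1) E set_mult_least[OF E] by blast
      moreover have "E \<subseteq> J" unfolding E_def
        using J AJ conj_set_mono[OF Cs(3), of g] conj_set_self[OF J g] by (intro set_mult_least) auto
      ultimately have "A <#> conj_set G C g = J" by (simp add: E_def)
      then have "A <#> conj_set G (conj_set G C g) (inv g) = J"
        using g J by (intro set_mult_conj_eq_all[OF A Cg J]) (auto simp: subgroup.m_inv_closed)
      then show False using Cs(4) conj_set_inverse(1)[OF Cc gc(1)] by simp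
    qed
    then have "P C'" using sub CC' C'J perm' Cs(2) by (auto simp: P_def)
    then have "card C' \<le> card C" by (rule max)
    then have "C = C'" using card_seteq[OF finite_subgroup[OF sub] CC'(1)] by simp
    then show ?thesis using CC'(2) by (simp add: c_def)
  qed
  define S where "S = (\<Union>g\<in>J. conj_set G A g)"
  define D where "D = generate G S"
  have SJ: "S \<subseteq> J" using conj_set_mono[OF AJ] conj_set_self[OF J] by (auto simp: S_def)
  have D: "normal_in D J" and AD: "A \<subseteq> D"
    unfolding D_def S_def using normal_in_conj_closure[OF AJ J] by auto
  show thesis
  proof (cases "D = J")
    case False then show thesis using that D AD by blast
  next
    case True
    let ?N = "{x \<in> carrier G. \<forall>c\<in>C. inv x \<otimes> c \<otimes> x \<in> C}"
    have "S \<subseteq> ?N"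
    proof
      fix s assume "s \<in> S"
      then obtain g a where ga: "g \<in> J" "a \<in> A" "s = inv g \<otimes> a \<otimes> g" by (auto simp: S_def conj_set_def)
      have "inv g \<in> J" using ga J by (simp add: subgroup.m_inv_closed)
      from norm[OF ga(2) this] have "conj_set G C s \<subseteq> C" using ga Jc by (simp add: subset_iff)
      then show "s \<in> ?N" using \<open>s \<in> S\<close> SJ Jc by (auto simp: conj_set_def)
    qed
    then have "D \<subseteq> ?N" unfolding D_def using normalizer_subgroup[OF Cs(1)] by (rule generate_subgroup_incl)
    then have "normal_in C J" using True Cs J by (intro normal_inI) auto
    moreover have "C \<noteq> J"
    proof
      assume "C = J"
      then have "A <#> C = J" using AJ J set_mult_least[OF J AJ order_refl]
          subgroup_set_mult_subsets(2)[OF A J] by auto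
      then show False using Cs by simp
    qed
    ultimately show thesis using that Cs(2) by blast
  qed
qed

text \<open>Wielandt proved that \<open>A \<inter> B\<close> is subnormal in \<open>J\<close>; what is needed below is
  only that minimal normal subgroups normalise it, and this can be proved directly by induction
  on \<open>J\<close>. If \<open>A <#> B\<close> is \<open>J\<close>, then \<open>A \<inter> B\<close> is normal. Otherwise \<open>A\<close> or \<open>B\<close> lies in a
  proper normal subgroup \<open>D\<close>. The intersections with \<open>D\<close> again permute by Dedekind's law, and
  they have the same intersection as \<open>A\<close> and \<open>B\<close>. If \<open>M\<close> meets \<open>D\<close> trivially, it centralises
  \<open>D\<close>; otherwise \<open>M\<close> is generated by conjugates of a minimal normal subgroup of \<open>D\<close>.\<close>

lemma permuting_Int_normalized:
  assumes "subgroup J G" "subgroup A G" "subgroup B G" "A \<subseteq> J" "B \<subseteq> J"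
    and "\<And>a b. a \<in> A \<Longrightarrow> b \<in> B \<Longrightarrow> inv a \<otimes> b \<otimes> a \<in> B"
    and "\<And>a b. a \<in> A \<Longrightarrow> b \<in> B \<Longrightarrow> inv b \<otimes> a \<otimes> b \<in> A"
    and "\<And>x. x \<in> J \<Longrightarrow> A <#> conj_set G B x = conj_set G B x <#> A"
    and "minimal_normal M J" "x \<in> M" "y \<in> A \<inter> B"
  shows "inv x \<otimes> y \<otimes> x \<in> A \<inter> B"
  using assms
proof (induction "card J" arbitrary: J A B M x y rule: less_induct)
  case less
  note J = less.prems(1) and A = less.prems(2) and B = less.prems(3) and AJ = less.prems(4)
    and BJ = less.prems(5) and AB = less.prems(6) and BA = less.prems(7) and perm = less.prems(8)
    and M = less.prems(9) and x = less.prems(10) and y = less.prems(11)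
  note m = minimal_normalD[OF M] and n = normal_inD[OF minimal_normalD(1)[OF M]]
  have Jc: "J \<subseteq> carrier G" and Ac: "A \<subseteq> carrier G" and Bc: "B \<subseteq> carrier G"
    using J A B by (auto dest: subgroup.subset)
  show ?case
  proof (cases "A <#> B = J")
    case True
    then obtain a b where ab: "a \<in> A" "b \<in> B" "x = a \<otimes> b" using x n(3) by (blast elim: set_multE)
    have 1: "inv a \<otimes> y \<otimes> a \<in> A \<inter> B" using y ab A AB by (auto simp: subgroup.m_closed subgroup.m_inv_closed)
    then have "inv b \<otimes> (inv a \<otimes> y \<otimes> a) \<otimes> b \<in> A \<inter> B"
      using ab B BA by (auto simp: subgroup.m_closed subgroup.m_inv_closed)
    moreover have "inv b \<otimes> (inv a \<otimes> y \<otimes> a) \<otimes> b = inv x \<otimes> y \<otimes> x"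
      using ab y Ac Bc by (auto simp: m_assoc inv_mult_group subset_iff)
    ultimately show ?thesis by simp
  next
    case False
    obtain D where D: "normal_in D J" "D \<noteq> J" "A \<subseteq> D \<or> B \<subseteq> D"
      using permuting_proper_normal[OF A B J AJ BJ perm False] by blast
    note d = normal_inD[OF D(1)]
    have Dc: "D \<subseteq> carrier G" using d(1) by (rule subgroup.subset)
    have cD: "card D < card J" using D(2) d(3) finite_subgroup[OF J] by (meson psubsetI psubset_card_mono)
    have conjD: "conj_set G D g = D" if "g \<in> J" for g using D(1) that by (rule normal_in_conj_set)
    define A' B' where "A' = A \<inter> D" and "B' = B \<inter> D"
    have AB': "A \<inter> B = A' \<inter> B'" using D(3) by (auto simp: A'_def B'_def)
    have subs: "subgroup A' G" "subgroup B' G"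
      unfolding A'_def B'_def using A B d(1) by (auto intro: subgroups_Inter_pair)
    have perm': "A' <#> conj_set G B' g = conj_set G B' g <#> A'" if g: "g \<in> D" for g
    proof -
      have gJ: "g \<in> J" and gc: "g \<in> carrier G" using g d(3) Jc by auto
      have Bg: "subgroup (conj_set G B g) G" using B gc by (rule conj_set_subgroup)
      have B'g: "subgroup (conj_set G B' g) G" using subs(2) gc by (rule conj_set_subgroup)
      have eq: "conj_set G B' g = conj_set G B g \<inter> D"
        unfolding B'_def using conj_set_Int[OF Bc Dc gc] conjD[OF gJ] by simp
      have P: "subgroup (A <#> conj_set G B g) G" using A Bg perm[OF gJ] by (rule permuting_subgroup)
      have "A' <#> conj_set G B' g = (A <#> conj_set G B g) \<inter> D"
      proof (cases "A \<subseteq> D")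
        case True
        then have "A' = A" by (auto simp: A'_def)
        then show ?thesis unfolding eq using Dedekind_left[OF A d(1) True] Bg by (simp add: subgroup.subset)
      next
        case False
        then have BD: "B \<subseteq> D" using D(3) by blast
        then have "conj_set G B g \<subseteq> D" using conj_set_mono[OF BD, of g] conjD[OF gJ] by simp
        then have e: "conj_set G B' g = conj_set G B g" "conj_set G B g \<subseteq> D" unfolding eq by auto
        have "conj_set G B g <#> (A \<inter> D) = (conj_set G B g <#> A) \<inter> D"
          using Bg d(1) e(2) Ac by (rule Dedekind_left)
        then have s: "conj_set G B' g <#> A' = (A <#> conj_set G B g) \<inter> D"
          unfolding e(1) A'_def perm[OF gJ] .
        have "subgroup (conj_set G B' g <#> A') G" unfolding s using P d(1) by (rule subgroups_Inter_pair)
        from subgroup_set_mult_commute[OF B'g subs(1) this] s show ?thesis by simp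
      qed
      then have "subgroup (A' <#> conj_set G B' g) G" using P d(1) by (simp add: subgroups_Inter_pair)
      then show ?thesis by (rule subgroup_set_mult_commute[OF subs(1) B'g])
    qed
    have yD: "y \<in> D" "y \<in> A' \<inter> B'" using y AB' by (auto simp: A'_def)
    have IH: "inv z \<otimes> y' \<otimes> z \<in> A' \<inter> B'" if "minimal_normal R D" "z \<in> R" "y' \<in> A' \<inter> B'" for R z y'
    proof (rule less.hyps[OF cD d(1) subs _ _ _ _ perm' that])
      fix a b assume ab: "a \<in> A'" "b \<in> B'"
      then have "a \<in> J" "b \<in> J" using d(3) by (auto simp: A'_def B'_def)
      then show "inv a \<otimes> b \<otimes> a \<in> B'" "inv b \<otimes> a \<otimes> b \<in> A'"
        using ab AB BA d(4) by (auto simp: A'_def B'_def)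
    qed (auto simp: A'_def B'_def)
    show ?thesis
    proof (cases "M \<inter> D = {\<one>}")
      case True
      have "x \<otimes> y = y \<otimes> x"
        by (rule trivial_Int_commute[OF n(1) d(1) True _ _ x yD(1)]) (use n d in blast)+
      moreover have "x \<in> carrier G" "y \<in> carrier G" using x y n(3) Jc Ac by auto
      ultimately have "inv x \<otimes> y \<otimes> x = y" by (simp add: m_assoc flip: \<open>x \<otimes> y = y \<otimes> x\<close>)
      then show ?thesis using y by simp
    next
      case False
      then have MD: "M \<subseteq> D" using minimal_normal_Int[OF M D(1)] by blast
      have MDn: "normal_in M D" using m(1) d(1) MD d(3) by (rule normal_in_subset)
      obtain R where R: "minimal_normal R D" "R \<subseteq> M" using minimal_normal_exists[OF MDn m(2)] by blast
      note r = minimal_normalD[OF R(1)] and rn = normal_inD[OF minimal_normalD(1)[OF R(1)]]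
      have Rc: "R \<subseteq> carrier G" using rn(1) by (rule subgroup.subset)
      define S where "S = (\<Union>g\<in>J. conj_set G R g)"
      have "generate G S = M" unfolding S_def
        using r(2) subgroup.one_closed[OF rn(1)] by (intro minimal_normal_conj_closure[OF M R(2)]) auto
      moreover have "generate G S \<subseteq> {z \<in> carrier G. \<forall>c\<in>A' \<inter> B'. inv z \<otimes> c \<otimes> z \<in> A' \<inter> B'}"
      proof (rule generate_subgroup_incl)
        show "S \<subseteq> {z \<in> carrier G. \<forall>c\<in>A' \<inter> B'. inv z \<otimes> c \<otimes> z \<in> A' \<inter> B'}"
        proof
          fix s assume "s \<in> S"
          then obtain g where g: "g \<in> J" "s \<in> conj_set G R g" by (auto simp: S_def)
          have gc: "g \<in> carrier G" using g Jc by auto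
          have mn: "minimal_normal (conj_set G R g) D"
            using R(1) gc conjD[OF g(1)] by (rule minimal_normal_conj)
          have "s \<in> carrier G" using g(2) conj_set_subset[OF Rc gc] by auto
          then show "s \<in> {z \<in> carrier G. \<forall>c\<in>A' \<inter> B'. inv z \<otimes> c \<otimes> z \<in> A' \<inter> B'}"
            using IH[OF mn g(2)] by auto
        qed
      qed (rule normalizer_subgroup[OF subgroups_Inter_pair[OF subs]])
      ultimately show ?thesis using x yD(2) unfolding AB' by blast
    qed
  qed
qed

text \<open>The normal closures of \<open>A\<close> and \<open>B\<close> in \<open>A <#> B\<close> are joins of conjugates, so they
  inherit the permutability, and they normalise each other. Their intersection contains the
  commutators.\<close>

lemma permuting_commutators:
  assumes A: "subgroup A G" and B: "subgroup B G"
    and perm: "\<And>x. x \<in> carrier G \<Longrightarrow> A <#> conj_set G B x = conj_set G B x <#> A"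
  obtains S where "normal_in S (A <#> B)" "\<And>a b. a \<in> A \<Longrightarrow> b \<in> B \<Longrightarrow> comm a b \<in> S"
    "\<And>M x y. minimal_normal M (carrier G) \<Longrightarrow> x \<in> M \<Longrightarrow> y \<in> S \<Longrightarrow> inv x \<otimes> y \<otimes> x \<in> S"
proof -
  have Ac: "A \<subseteq> carrier G" and Bc: "B \<subseteq> carrier G" using A B by (auto dest: subgroup.subset)
  define K where "K = A <#> B"
  have K: "subgroup K G" unfolding K_def
    using permuting_subgroup[OF A B] perm[of \<one>] conj_set_one[OF Bc] by simp
  have Kc: "K \<subseteq> carrier G" using K by (rule subgroup.subset)
  have AK: "A \<subseteq> K" and BK: "B \<subseteq> K" unfolding K_def using subgroup_set_mult_subsets[OF A B] by auto
  define cl where "cl C = generate G (\<Union>y\<in>K. conj_set G C y)" for C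
  have cl: "normal_in (cl C) K" "C \<subseteq> cl C" if C: "C \<subseteq> K" for C
    unfolding cl_def using normal_in_conj_closure[OF C K] by auto
  define S where "S = cl A \<inter> cl B"
  note a = normal_inD[OF cl(1)[OF AK]] and b = normal_inD[OF cl(1)[OF BK]]
  have S: "normal_in S K" unfolding S_def using cl AK BK by (intro normal_in_Int2)
  have permxy: "conj_set G A z <#> conj_set G B w = conj_set G B w <#> conj_set G A z"
    if zw: "z \<in> carrier G" "w \<in> carrier G" for z w
  proof -
    have "conj_set G A z <#> conj_set G (conj_set G B (w \<otimes> inv z)) z =
        conj_set G (conj_set G B (w \<otimes> inv z)) z <#> conj_set G A z"
      using zw perm Ac Bc by (intro conj_permute conj_set_subset) auto
    moreover have "conj_set G (conj_set G B (w \<otimes> inv z)) z = conj_set G B w"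
      using zw Bc by (simp add: conj_set_conj_set m_assoc)
    ultimately show ?thesis by simp
  qed
  have permcl: "cl A <#> conj_set G (cl B) x = conj_set G (cl B) x <#> cl A" if x: "x \<in> carrier G" for x
  proof -
    have Bu: "(\<Union>y\<in>K. conj_set G B y) \<subseteq> carrier G" using Bc Kc conj_set_subset by blast
    have eq: "conj_set G (cl B) x = generate G (\<Union>((\<lambda>y. conj_set G B (y \<otimes> x)) ` K))"
    proof -
      have "conj_set G (\<Union>y\<in>K. conj_set G B y) x = (\<Union>y\<in>K. conj_set G (conj_set G B y) x)"
        by (auto simp: conj_set_def)
      also have "\<dots> = (\<Union>y\<in>K. conj_set G B (y \<otimes> x))"
        using conj_set_conj_set[OF Bc _ x] Kc by auto
      finally show ?thesis unfolding cl_def using conj_set_generate[OF Bu x] by simp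
    qed
    have sB: "subgroup (conj_set G (cl B) x) G" using b(1) x by (rule conj_set_subgroup)
    have 1: "conj_set G A z <#> conj_set G (cl B) x = conj_set G (cl B) x <#> conj_set G A z"
      if z: "z \<in> K" for z
    proof -
      have zc: "z \<in> carrier G" using z Kc by auto
      show ?thesis unfolding eq
        by (rule permute_generate[OF conj_set_subgroup[OF A zc]])
           (use permxy zc Kc x B in \<open>auto intro!: conj_set_subgroup\<close>)
    qed
    have "conj_set G (cl B) x <#> generate G (\<Union>((conj_set G A) ` K)) =
        generate G (\<Union>((conj_set G A) ` K)) <#> conj_set G (cl B) x"
      by (rule permute_generate[OF sB]) (use 1 A Kc in \<open>auto intro!: conj_set_subgroup\<close>)
    then show ?thesis by (simp add: cl_def)
  qed
  show thesis
  proof (rule that[of S])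
    show "normal_in S (A <#> B)" using S by (simp add: K_def)
    fix u v assume u: "u \<in> A" and v: "v \<in> B"
    have c: "u \<in> carrier G" "v \<in> carrier G" using u v Ac Bc by auto
    have uv: "u \<in> K" "v \<in> K" "u \<in> cl A" "v \<in> cl B" using u v AK BK cl(2) by auto
    have "comm u v = inv u \<otimes> (inv v \<otimes> u \<otimes> v)" "comm u v = (inv u \<otimes> inv v \<otimes> u) \<otimes> v"
      using c by (simp_all add: comm_def m_assoc)
    moreover have "inv v \<otimes> u \<otimes> v \<in> cl A" "inv u \<otimes> inv v \<otimes> u \<in> cl B"
      using uv a(4) b by (auto simp: subgroup.m_inv_closed)
    ultimately show "comm u v \<in> S"
      unfolding S_def using uv a(1) b(1) by (metis IntI subgroup.m_closed subgroup.m_inv_closed)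
  next
    fix M x y assume "minimal_normal M (carrier G)" "x \<in> M" "y \<in> S"
    then show "inv x \<otimes> y \<otimes> x \<in> S" unfolding S_def
      using permuting_Int_normalized[of "carrier G" "cl A" "cl B" M x y] a b permcl
      by (auto simp: subgroup_self subset_iff subgroup.mem_carrier)
  qed
qed

end

section \<open>Systems of conjugate projectors\<close>

context fin_group
begin

text \<open>A normal \<open>ps\<close>-subgroup of largest order absorbs every other one, because the
  product of two normal \<open>ps\<close>-subgroups is again one.\<close>

lemma pi_over_generate_normal:
  assumes J: "subgroup J G" and F: "\<And>V. V \<in> F \<Longrightarrow> normal_in V J \<and> pi_over ps {\<one>} V"
  shows "pi_over ps {\<one>} (generate G (\<Union>F))"
proof -
  define P where "P W \<longleftrightarrow> normal_in W J \<and> pi_over ps {\<one>} W" for W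
  have P1: "P {\<one>}" using J by (simp add: normal_in_one pi_over_def P_def)
  have bound: "\<forall>W. P W \<longrightarrow> card W < Suc (card J)"
    using card_mono[OF finite_subgroup[OF J]] normal_inD(3) by (auto simp: less_Suc_eq_le P_def)
  obtain W where PW: "P W" and max: "\<And>W'. P W' \<Longrightarrow> card W' \<le> card W"
    using ex_has_greatest_nat[of P "{\<one>}" card "Suc (card J)"] P1 bound by (meson less_imp_le)
  have W: "normal_in W J" "pi_over ps {\<one>} W" using PW by (auto simp: P_def)
  note w = normal_inD[OF W(1)]
  have "V \<subseteq> W" if "V \<in> F" for V
  proof -
    have V: "normal_in V J" "pi_over ps {\<one>} V" using F that by auto
    note v = normal_inD[OF V(1)]
    have comm: "W <#> V = V <#> W" using w v by (intro normalized_permute) auto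
    have sub: "subgroup (W <#> V) G" using w(1) v(1) comm by (rule permuting_subgroup)
    have WV: "W \<subseteq> W <#> V" "V \<subseteq> W <#> V" using subgroup_set_mult_subsets[OF w(1) v(1)] .
    have "normal_in (W <#> V) J"
    proof (rule normal_inI[OF sub J])
      show "W <#> V \<subseteq> J" using J w(3) v(3) by (rule set_mult_least)
      fix x n assume x: "x \<in> J" and "n \<in> W <#> V"
      then obtain a b where ab: "a \<in> W" "b \<in> V" "n = a \<otimes> b" by (auto elim: set_multE)
      have "inv x \<otimes> n \<otimes> x = (inv x \<otimes> a \<otimes> x) \<otimes> (inv x \<otimes> b \<otimes> x)"
        using ab x w v J by (auto simp: m_assoc subgroup.mem_carrier)
      then show "inv x \<otimes> n \<otimes> x \<in> W <#> V" using ab x w(4) v(4) by (auto intro: set_multI)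
    qed
    moreover have "pi_over ps {\<one>} (W <#> V)"
      unfolding pi_over_Cauchy[OF sub]
    proof (intro allI impI)
      fix q assume q: "Factorial_Ring.prime q \<and> q dvd card (W <#> V)"
      obtain n where n: "card (W <#> V) = card W * n" "n dvd card V"
        using index_permuting[OF w(1) v(1)] by blast
      have "q dvd card W \<or> q dvd n" using q unfolding n(1) using prime_dvd_mult_eq_nat by blast
      then have "q dvd card W \<or> q dvd card V" using n(2) dvd_trans by blast
      then show "q \<in> ps" using q W(2) V(2) pi_over_Cauchy w(1) v(1) by blast
    qed
    ultimately have "card (W <#> V) \<le> card W" by (intro max) (simp add: P_def)
    then have "W = W <#> V" using card_seteq[OF finite_subgroup[OF sub] WV(1)] by simp
    then show "V \<subseteq> W" using WV(2) by simp
  qed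
  then have "generate G (\<Union>F) \<subseteq> W" using w(1) by (intro generate_subgroup_incl) auto
  then show ?thesis using W(2) by (rule pi_over_mono[OF _ order_refl, rotated])
qed

lemma q_elt_two_primes:
  assumes "q_elt q x" "q_elt r x" "Factorial_Ring.prime q" "Factorial_Ring.prime r" "q \<noteq> r"
  shows "x = \<one>"
proof -
  obtain a :: nat where a: "x [^] (q ^ a) = \<one>" and x: "x \<in> carrier G"
    using assms(1) by (auto simp: q_elt_def)
  obtain b :: nat where b: "x [^] (r ^ b) = \<one>" using assms(2) by (auto simp: q_elt_def)
  have "coprime (q ^ a) (r ^ b)" using primes_coprime[OF assms(3-5)] by simp
  then have "x \<in> {\<one>}"
    using coprime_powers_mem[OF triv_subgroup x, of "q ^ a" "r ^ b"] a b by simp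
  then show ?thesis by simp
qed

lemma exists_q_elt:
  assumes "subgroup J G" "J \<noteq> {\<one>}"
  obtains q x where "Factorial_Ring.prime q" "q_elt q x" "x \<in> J" "x \<noteq> \<one>"
  using all_q_elts_imp_eq[OF triv_subgroup assms(1)] assms by (auto simp: subgroup.one_closed)

lemma card_generate_q_elt:
  assumes "q_elt q x" "Factorial_Ring.prime q" "Factorial_Ring.prime r" "r dvd card (generate G {x})"
  shows "r = q"
proof -
  obtain n :: nat where n: "x [^] (q ^ n) = \<one>" and x: "x \<in> carrier G"
    using assms by (auto simp: q_elt_def)
  have "card (generate G {x}) dvd q ^ n"
    using n x pow_eq_id generate_pow_card[OF x] by simp
  then have "r dvd q ^ n" using assms(4) dvd_trans by blast
  then show ?thesis using assms prime_dvd_power primes_dvd_imp_eq by blast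
qed

end

text \<open>The family \<open>PP i\<close> stands for the set of all conjugates of a projector for the class
  \<open>sigma i\<close>. With a family closed under conjugation, permuting with all conjugates of a
  projector becomes permuting with all members, and the image of such a system in a quotient
  group is again such a system. The last axiom is the maximality of the image of \<open>Q\<close> in the
  quotient by \<open>N\<close>.\<close>

locale projector_system = fin_group +
  fixes I :: "'i set" and sigma :: "'i \<Rightarrow> nat set" and PP :: "'i \<Rightarrow> 'a set set"
  assumes partition: "prime_partition I sigma"
    and PP_subgroup: "i \<in> I \<Longrightarrow> Q \<in> PP i \<Longrightarrow> subgroup Q G"
    and PP_pi: "i \<in> I \<Longrightarrow> Q \<in> PP i \<Longrightarrow> pi_over (sigma i) {\<one>} Q"
    and PP_conj: "i \<in> I \<Longrightarrow> Q \<in> PP i \<Longrightarrow> x \<in> carrier G \<Longrightarrow> conj_set G Q x \<in> PP i"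
    and PP_nonempty: "i \<in> I \<Longrightarrow> PP i \<noteq> {}"
    and PP_max: "i \<in> I \<Longrightarrow> Q \<in> PP i \<Longrightarrow> normal_in N (carrier G) \<Longrightarrow> subgroup V G \<Longrightarrow>
      Q \<subseteq> V \<Longrightarrow> N \<subseteq> V \<Longrightarrow> pi_over (sigma i) N V \<Longrightarrow> V \<subseteq> Q <#> N"
begin

definition permutable :: "'a set \<Rightarrow> bool" where
  "permutable H \<longleftrightarrow> subgroup H G \<and> (\<forall>i\<in>I. \<forall>Q\<in>PP i. H <#> Q = Q <#> H)"

definition proj_closure :: "'i \<Rightarrow> 'a set" where
  "proj_closure i = generate G (\<Union>(PP i))"

lemma prime_class: "Factorial_Ring.prime q \<Longrightarrow> \<exists>i\<in>I. q \<in> sigma i"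
  using partition unfolding prime_partition_def by blast

lemma prime_class_unique: "i \<in> I \<Longrightarrow> j \<in> I \<Longrightarrow> q \<in> sigma i \<Longrightarrow> q \<in> sigma j \<Longrightarrow> i = j"
  using partition unfolding prime_partition_def disjoint_family_on_def by blast

lemma PP_Union_carrier: "i \<in> I \<Longrightarrow> \<Union>(PP i) \<subseteq> carrier G"
  using PP_subgroup by (auto dest: subgroup.mem_carrier)

lemma PP_Union_conj:
  assumes "i \<in> I" "x \<in> carrier G" "s \<in> \<Union>(PP i)"
  shows "inv x \<otimes> s \<otimes> x \<in> \<Union>(PP i)"
  using assms PP_conj conj_set_memI by blast

lemma proj_closure_normal: "i \<in> I \<Longrightarrow> normal_in (proj_closure i) (carrier G)"
  unfolding proj_closure_def
  by (rule normal_in_generate) (use PP_Union_carrier PP_Union_conj subgroup_self in auto)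

lemma PP_subset_proj_closure: "Q \<in> PP i \<Longrightarrow> Q \<subseteq> proj_closure i"
  by (auto simp: proj_closure_def intro: generate.incl)

text \<open>Modulo this closure the projector becomes trivial, so by its maximality the
  quotient contains no nontrivial elements of \<open>q\<close>-power order.\<close>

lemma q_elt_mem_proj_closure:
  assumes i: "i \<in> I" and q: "Factorial_Ring.prime q" "q \<in> sigma i" and x: "q_elt q x"
  shows "x \<in> proj_closure i"
proof -
  define N where "N = proj_closure i"
  have N: "normal_in N (carrier G)" unfolding N_def using i by (rule proj_closure_normal)
  note n = normal_inD[OF N]
  obtain Q where Q: "Q \<in> PP i" using PP_nonempty[OF i] by blast
  have QN: "Q \<subseteq> N" unfolding N_def using Q by (rule PP_subset_proj_closure)
  define C where "C = generate G {x}"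
  have xc: "x \<in> carrier G" using x by (rule q_elt_closed)
  have C: "subgroup C G" unfolding C_def using xc by (intro generate_is_subgroup) auto
  have "C <#> N = N <#> C"
    using C n by (intro normalized_permute) (auto dest: subgroup.mem_carrier)
  then have V: "subgroup (N <#> C) G" using n(1) C by (intro permuting_subgroup) auto
  have sub: "N \<subseteq> N <#> C" "C \<subseteq> N <#> C" using subgroup_set_mult_subsets[OF n(1) C] .
  obtain m where m: "card (N <#> C) = card N * m" "m dvd card C"
    using index_permuting[OF n(1) C] by blast
  have "pi_over (sigma i) N (N <#> C)"
  proof (rule pi_overI_index[OF _ m(1)])
    show "normal_in N (N <#> C)" using N V sub(1) by (rule normal_in_subset) (simp add: V subgroup.subset)
    fix r assume "Factorial_Ring.prime r" "r dvd m"
    then have "r = q" using card_generate_q_elt[OF x q(1)] m(2) dvd_trans unfolding C_def by blast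
    then show "r \<in> sigma i" using q by simp
  qed
  then have "N <#> C \<subseteq> Q <#> N" using QN sub by (intro PP_max[OF i Q N V]) auto
  also have "\<dots> \<subseteq> N" using n(1) QN by (intro set_mult_least) auto
  finally have "C \<subseteq> N" using sub by auto
  then show ?thesis by (auto simp: C_def N_def intro: generate.incl)
qed

lemma carrier_generated:
  assumes W: "subgroup W G" and PPW: "\<And>i Q. i \<in> I \<Longrightarrow> Q \<in> PP i \<Longrightarrow> Q \<subseteq> W"
  shows "W = carrier G"
proof (rule all_q_elts_imp_eq[OF W subgroup_self])
  show "W \<subseteq> carrier G" using W by (rule subgroup.subset)
  fix q x assume "Factorial_Ring.prime q" "q_elt q x"
  then obtain i where i: "i \<in> I" "x \<in> proj_closure i" using prime_class q_elt_mem_proj_closure by blast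
  have "proj_closure i \<subseteq> W" unfolding proj_closure_def
    using W PPW[OF i(1)] by (intro generate_subgroup_incl) auto
  then show "x \<in> W" using i by auto
qed

text \<open>\<open>Q <#> V\<close> is a \<open>sigma i\<close>-group containing the maximal one \<open>Q\<close>.\<close>

lemma PP_absorbs:
  assumes i: "i \<in> I" and Q: "Q \<in> PP i" and V: "subgroup V G" "pi_over (sigma i) {\<one>} V"
    and nor: "\<And>x v. x \<in> Q \<Longrightarrow> v \<in> V \<Longrightarrow> inv x \<otimes> v \<otimes> x \<in> V"
  shows "V \<subseteq> Q"
proof -
  have Qs: "subgroup Q G" using i Q by (rule PP_subgroup)
  have QV: "subgroup (Q <#> V) G" using Qs V(1) normalized_permute[OF Qs V(1) nor] by (rule permuting_subgroup)
  have sub: "Q \<subseteq> Q <#> V" "V \<subseteq> Q <#> V" using subgroup_set_mult_subsets[OF Qs V(1)] .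
  obtain m where m: "card (Q <#> V) = card Q * m" "m dvd card V"
    using index_permuting[OF Qs V(1)] by blast
  have "pi_over (sigma i) {\<one>} (Q <#> V)" unfolding pi_over_Cauchy[OF QV]
  proof (intro allI impI)
    fix q assume q: "Factorial_Ring.prime q \<and> q dvd card (Q <#> V)"
    have "q dvd card Q \<or> q dvd m" using q unfolding m(1) using prime_dvd_mult_eq_nat by blast
    then have "q dvd card Q \<or> q dvd card V" using m(2) dvd_trans by blast
    then show "q \<in> sigma i" using q V PP_pi[OF i Q] pi_over_Cauchy Qs by blast
  qed
  then have "Q <#> V \<subseteq> Q <#> {\<one>}"
    using QV sub subgroup.one_closed[OF QV]
    by (intro PP_max[OF i Q normal_in_one[OF subgroup_self] QV]) auto
  also have "\<dots> = Q" using Qs by (auto simp: set_mult_def subgroup.mem_carrier)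
  finally show ?thesis using sub by auto
qed

lemma permutable_subgroup: "permutable H \<Longrightarrow> subgroup H G"
  by (simp add: permutable_def)

lemma permutable_product:
  assumes H: "permutable H" and i: "i \<in> I" and Q: "Q \<in> PP i"
  shows "subgroup (H <#> Q) G" "H \<subseteq> H <#> Q" "Q \<subseteq> H <#> Q"
  using permuting_subgroup[of H Q] subgroup_set_mult_subsets[of H Q] H PP_subgroup[OF i Q] i Q
  by (auto simp: permutable_def)

text \<open>The index of \<open>H\<close> in \<open>H <#> Q\<close> divides the order of \<open>Q\<close>.\<close>

lemma permutable_index:
  assumes H: "permutable H" and i: "i \<in> I" and Q: "Q \<in> PP i" and B: "normal_in B (H <#> Q)"
  obtains m where "card B = card (B \<inter> H) * m"
    "\<And>q. Factorial_Ring.prime q \<Longrightarrow> q dvd m \<Longrightarrow> q \<in> sigma i"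
proof -
  have Qs: "subgroup Q G" using i Q by (rule PP_subgroup)
  note Hs = permutable_subgroup[OF H]
  obtain n where n: "card (H <#> Q) = card H * n" "n dvd card Q"
    using index_permuting[OF Hs Qs] by blast
  obtain m where m: "card B = card (B \<inter> H) * m" "m dvd n"
    using index_Int_normal[OF B Hs permutable_product(2)[OF H i Q] n(1)] by blast
  show thesis
  proof (rule that[OF m(1)])
    fix q assume q: "Factorial_Ring.prime q" "q dvd m"
    then have "q dvd card Q" using m n dvd_trans by blast
    then show "q \<in> sigma i" using q PP_pi[OF i Q] pi_over_Cauchy[OF Qs] by blast
  qed
qed

lemma permutable_commutators:
  assumes H: "permutable H" and i: "i \<in> I" and Q: "Q \<in> PP i"
  obtains S where "normal_in S (H <#> Q)" "\<And>a b. a \<in> H \<Longrightarrow> b \<in> Q \<Longrightarrow> comm a b \<in> S"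
    "\<And>M x y. minimal_normal M (carrier G) \<Longrightarrow> x \<in> M \<Longrightarrow> y \<in> S \<Longrightarrow> inv x \<otimes> y \<otimes> x \<in> S"
proof (rule permuting_commutators[OF permutable_subgroup[OF H] PP_subgroup[OF i Q]])
  show "H <#> conj_set G Q x = conj_set G Q x <#> H" if "x \<in> carrier G" for x
    using H i PP_conj[OF i Q that] by (auto simp: permutable_def)
qed (use that in blast)

end

text \<open>The situation of the induction: \<open>H\<close> has trivial core, \<open>M\<close> is minimal normal, and
  the assertion about residuals is known for the larger permutable subgroup \<open>H <#> M\<close>.\<close>

locale corefree_step = projector_system +
  fixes H M :: "'a set"
  assumes H: "permutable H"
    and corefree: "normal_in N (carrier G) \<Longrightarrow> N \<subseteq> H \<Longrightarrow> N = {\<one>}"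
    and M: "minimal_normal M (carrier G)"
    and step: "i \<in> I \<Longrightarrow> Q \<in> PP i \<Longrightarrow> pi_over (sigma i) (H <#> M) (H <#> M <#> Q)"
begin

lemmas Hs = permutable_subgroup[OF H]
lemmas M_normal = minimal_normalD(1)[OF M]
lemmas M_facts = normal_inD[OF M_normal]

lemma M_conj: "x \<in> carrier G \<Longrightarrow> n \<in> M \<Longrightarrow> inv x \<otimes> n \<otimes> x \<in> M"
  by (rule M_facts(4))

lemma H_carrier: "x \<in> H \<Longrightarrow> x \<in> carrier G"
  using Hs by (rule subgroup.mem_carrier)

lemma M_carrier: "x \<in> M \<Longrightarrow> x \<in> carrier G"
  using M_facts(3) by auto

lemma comm_mem_M: "x \<in> M \<Longrightarrow> y \<in> carrier G \<Longrightarrow> comm x y \<in> M"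
proof -
  assume xy: "x \<in> M" "y \<in> carrier G"
  have "comm x y = inv x \<otimes> (inv y \<otimes> x \<otimes> y)" using xy M_carrier by (simp add: comm_def m_assoc)
  then show "comm x y \<in> M" using xy M_conj M_facts(1)
    by (simp add: subgroup.m_closed subgroup.m_inv_closed)
qed

lemma comm_mem_M': "x \<in> M \<Longrightarrow> y \<in> carrier G \<Longrightarrow> comm y x \<in> M"
  using comm_mem_M M_facts(1) M_carrier by (simp add: comm_inv[of x y] subgroup.m_inv_closed)

lemma HM_subgroup: "subgroup (H <#> M) G"
  using Hs M_facts M_conj H_carrier by (intro permuting_subgroup normalized_permute) auto

lemma M_Int_normal:
  assumes "i \<in> I" "Q \<in> PP i"
  shows "normal_in (M \<inter> (H <#> Q)) (H <#> Q)"
proof -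
  note s = permutable_product(1)[OF H assms]
  have "carrier G \<inter> (H <#> Q) = H <#> Q" using subgroup.subset[OF s] by auto
  then show ?thesis using normal_in_Int[OF M_normal s] by simp
qed

lemma HM_Int:
  assumes i: "i \<in> I" "Q \<in> PP i"
  shows "(H <#> M) \<inter> (H <#> Q) = H <#> (M \<inter> (H <#> Q))"
  using Dedekind_left[OF Hs permutable_product(1,2)[OF H i] M_facts(3)] by simp

text \<open>The inductive hypothesis puts the residual of \<open>H <#> Q\<close> into the intersection of
  \<open>H <#> M\<close> and \<open>H <#> Q\<close>, which is \<open>H <#> (M \<inter> (H <#> Q))\<close> by Dedekind's law. So
  everything depends on \<open>M \<inter> (H <#> Q)\<close>.\<close>

lemma q_elt_mem_HM:
  assumes i: "i \<in> I" "Q \<in> PP i" and q: "Factorial_Ring.prime q" "q \<notin> sigma i"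
    and x: "x \<in> H <#> Q" "q_elt q x"
  shows "x \<in> H <#> (M \<inter> (H <#> Q))"
proof -
  have "H <#> Q \<subseteq> H <#> M <#> Q"
    using subgroup_set_mult_subsets(1)[OF Hs M_facts(1)] by (intro mono_set_mult) auto
  then have "x \<in> H <#> M" using pi_overD[OF step[OF i] q] x by blast
  then show ?thesis using x HM_Int[OF i] by blast
qed

lemma pi_over_if_Int_subset:
  assumes i: "i \<in> I" "Q \<in> PP i" and sub: "M \<inter> (H <#> Q) \<subseteq> H"
  shows "pi_over (sigma i) H (H <#> Q)"
  unfolding pi_over_def
  using q_elt_mem_HM[OF i] set_mult_least[OF Hs order_refl sub] by blast

end

section \<open>Minimal normal subgroups belonging to one class of primes\<close>

context fin_group
begin

text \<open>Modulo \<open>E\<close> the elements \<open>u\<close> and \<open>t\<close> commute, so the power of \<open>u\<close> is the quotient of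
  two trivial ones.\<close>

lemma factor_power_mem:
  assumes E: "normal_in E J" and mem: "u \<in> J" "t \<in> J" and e: "e \<in> E"
    and comm: "comm u t \<in> E" and t: "t [^] (a::nat) \<in> E" and s: "(u \<otimes> t \<otimes> e) [^] (b::nat) \<in> E"
  shows "u [^] (a * b) \<in> E"
proof -
  note n = normal_inD[OF E]
  interpret E: normal E "G\<lparr>carrier := J\<rparr>" using E by (rule normal_in_restrict)
  let ?J = "G\<lparr>carrier := J\<rparr>"
  let ?Q = "?J Mod E"
  interpret Q: group ?Q by (rule E.factorgroup_is_group)
  define f where "f x = E #>\<^bsub>?J\<^esub> x" for x
  have f: "f \<in> hom ?J ?Q" unfolding f_def by (rule E.r_coset_hom_Mod)
  interpret f: group_hom ?J ?Q f using f by unfold_locales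
  have Jc: "J \<subseteq> carrier G" using n(2) by (rule subgroup.subset)
  have one: "f x = \<one>\<^bsub>?Q\<^esub> \<longleftrightarrow> x \<in> E" if "x \<in> J" for x
    using that E.rcos_const[of x] E.is_subgroup E.rcos_self[of x E] unfolding f_def
    by (auto simp: E.is_group)
  have pow: "f (x [^] k) = f x [^]\<^bsub>?Q\<^esub> k" if "x \<in> J" for x and k :: nat
    using f.hom_nat_pow[of x k] that by (simp flip: nat_pow_consistent)
  have powJ: "x [^] k \<in> J" if "x \<in> J" for x and k :: nat
    using n(2) that by (rule subgroup_nat_pow)
  have mult: "f (x \<otimes> y) = f x \<otimes>\<^bsub>?Q\<^esub> f y" if "x \<in> J" "y \<in> J" for x y
    using f.hom_mult[of x y] that by simp
  have eJ: "e \<in> J" using e n(3) by auto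
  have utJ: "u \<otimes> t \<in> J" "t \<otimes> u \<in> J" using mem n(2) by (auto simp: subgroup.m_closed)
  have fc: "f x \<in> carrier ?Q" if "x \<in> J" for x using f.hom_closed[of x] that by simp
  have "u \<otimes> t = t \<otimes> u \<otimes> comm u t" using mem Jc by (auto simp: comm_def m_assoc subset_iff)
  then have "f (u \<otimes> t) = f (t \<otimes> u) \<otimes>\<^bsub>?Q\<^esub> f (comm u t)"
    using mult utJ comm n(3) by (metis subsetD)
  moreover have "f (comm u t) = \<one>\<^bsub>?Q\<^esub>" using comm one n(3) by blast
  ultimately have cf: "f u \<otimes>\<^bsub>?Q\<^esub> f t = f t \<otimes>\<^bsub>?Q\<^esub> f u"
    using mult mem fc utJ by (metis Q.r_one)
  have "f (u \<otimes> t \<otimes> e) = f (u \<otimes> t) \<otimes>\<^bsub>?Q\<^esub> f e" using mult utJ eJ by blast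
  also have "f e = \<one>\<^bsub>?Q\<^esub>" using one eJ e by blast
  finally have fs: "f (u \<otimes> t \<otimes> e) = f u \<otimes>\<^bsub>?Q\<^esub> f t" using mult mem fc utJ by (metis Q.r_one)
  have sJ: "u \<otimes> t \<otimes> e \<in> J" using utJ eJ n(2) by (simp add: subgroup.m_closed)
  have "(f u \<otimes>\<^bsub>?Q\<^esub> f t) [^]\<^bsub>?Q\<^esub> b = \<one>\<^bsub>?Q\<^esub>"
    using s one[OF powJ[OF sJ]] pow[OF sJ] fs by simp
  then have 1: "(f u \<otimes>\<^bsub>?Q\<^esub> f t) [^]\<^bsub>?Q\<^esub> (a * b) = \<one>\<^bsub>?Q\<^esub>"
    using fc mem by (metis Q.m_closed Q.nat_pow_one Q.nat_pow_pow mult.commute)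
  have "f t [^]\<^bsub>?Q\<^esub> a = \<one>\<^bsub>?Q\<^esub>" using t one[OF powJ[OF mem(2)]] pow[OF mem(2)] by simp
  then have 2: "f t [^]\<^bsub>?Q\<^esub> (a * b) = \<one>\<^bsub>?Q\<^esub>"
    using fc mem by (metis Q.nat_pow_one Q.nat_pow_pow)
  have "(f u \<otimes>\<^bsub>?Q\<^esub> f t) [^]\<^bsub>?Q\<^esub> (a * b) = f u [^]\<^bsub>?Q\<^esub> (a * b) \<otimes>\<^bsub>?Q\<^esub> f t [^]\<^bsub>?Q\<^esub> (a * b)"
    using fc mem cf by (intro Q.pow_mult_distrib)
  moreover have "f u [^]\<^bsub>?Q\<^esub> (a * b) \<in> carrier ?Q" using fc mem by (intro Q.nat_pow_closed)
  ultimately have "f u [^]\<^bsub>?Q\<^esub> (a * b) = \<one>\<^bsub>?Q\<^esub>" using 1 2 Q.r_one by metis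
  then show ?thesis using one[OF powJ[OF mem(1)]] pow[OF mem(1)] by simp
qed

end

context corefree_step
begin

text \<open>The index of \<open>M \<inter> H\<close> in \<open>M \<inter> (H <#> Q)\<close> is a product of primes from
  \<open>sigma i\<close> and also one of primes from \<open>sigma k\<close>.\<close>

lemma primary_Int:
  assumes k: "k \<in> I" "pi_over (sigma k) {\<one>} M" and i: "i \<in> I" "i \<noteq> k" and Q: "Q \<in> PP i"
  shows "M \<inter> (H <#> Q) \<subseteq> H"
proof -
  define B where "B = M \<inter> (H <#> Q)"
  have B: "normal_in B (H <#> Q)" unfolding B_def using i(1) Q by (rule M_Int_normal)
  note b = normal_inD[OF B]
  obtain m where m: "card B = card (B \<inter> H) * m"
    "\<And>q. Factorial_Ring.prime q \<Longrightarrow> q dvd m \<Longrightarrow> q \<in> sigma i"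
    using permutable_index[OF H i(1) Q B] by blast
  have "card B dvd card M" using b(1) M_facts(1) by (rule card_subgroup_dvd) (auto simp: B_def)
  then have "m dvd card M" using m(1) by (metis dvd_mult_right)
  have "\<not> q dvd m" if q: "Factorial_Ring.prime q" for q
  proof
    assume qm: "q dvd m"
    then have "q dvd card M" using \<open>m dvd card M\<close> by (rule dvd_trans)
    then have "q \<in> sigma k" using k(2) pi_over_Cauchy[OF M_facts(1)] q by blast
    then show False using prime_class_unique[OF k(1) i(1)] m(2)[OF q qm] i(2) by blast
  qed
  then have "m = 1" using prime_factor_nat[of m] by blast
  then have "B \<inter> H = B" using m(1) card_subset_eq[OF finite_subgroup[OF b(1)], of "B \<inter> H"] by auto
  then show ?thesis by (auto simp: B_def)
qed

text \<open>Let \<open>N\<close> be the normal closure of the projectors for the class of \<open>p\<close>, so that \<open>h\<close>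
  lies in \<open>N\<close>. If \<open>M\<close> is not contained in \<open>N\<close>, then \<open>M\<close> and \<open>N\<close> centralise each other. Otherwise
  the residual \<open>E\<close> of \<open>H\<close> for this class is normalised by \<open>N\<close>, hence by \<open>M\<close>, and \<open>h\<close> centralises
  \<open>comm q m\<close> modulo \<open>E\<close> for each projector element \<open>q\<close>: this is the coprimality computation
  \<open>key\<close>. Those commutators generate a normal subgroup, so they generate \<open>M\<close> or are all trivial;
  in the latter case \<open>M\<close> and \<open>N\<close> again commute.\<close>

lemma primary_conj_mem:
  assumes k: "k \<in> I" "pi_over (sigma k) {\<one>} M" and j: "j \<in> I" "j \<noteq> k"
    and p: "Factorial_Ring.prime p" "p \<in> sigma j" and h: "h \<in> H" "q_elt p h" and m: "m \<in> M"
  shows "inv m \<otimes> h \<otimes> m \<in> H"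
proof -
  define N where "N = proj_closure j"
  have N: "normal_in N (carrier G)" unfolding N_def using j(1) by (rule proj_closure_normal)
  note n = normal_inD[OF N]
  have hc: "h \<in> carrier G" and mc: "m \<in> carrier G" using h m H_carrier M_carrier by auto
  have hN: "h \<in> N" unfolding N_def using j(1) p h(2) by (rule q_elt_mem_proj_closure)
  have trivial: "inv m \<otimes> h \<otimes> m \<in> H" if "h \<otimes> m = m \<otimes> h"
    using that hc mc h(1) by (simp add: m_assoc)
  show ?thesis
  proof (cases "M \<inter> N = {\<one>}")
    case True
    have "m \<otimes> h = h \<otimes> m"
      by (rule trivial_Int_commute[OF M_facts(1) n(1) True _ _ m hN]) (use M_carrier M_conj n in auto)
    then show ?thesis using trivial by simp
  next
    case False
    then have MN: "M \<subseteq> N" using minimal_normal_Int[OF M N] by blast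
    \<comment> \<open>\<open>E\<close> is the residual of \<open>H\<close> for the class \<open>sigma j\<close>; every projector for
      \<open>j\<close> normalises it, so \<open>N\<close> does too.\<close>
    define E0 where "E0 = {x \<in> H. \<exists>r. Factorial_Ring.prime r \<and> r \<notin> sigma j \<and> q_elt r x}"
    define E where "E = generate G E0"
    have E0H: "E0 \<subseteq> H" by (auto simp: E0_def)
    have EH: "E \<subseteq> H" unfolding E_def using E0H Hs by (rule generate_subgroup_incl)
    have "E0 \<subseteq> carrier G" using E0H H_carrier by blast
    then have Es: "subgroup E G" unfolding E_def by (rule generate_is_subgroup)
    have rE: "x \<in> E" if "x \<in> H" "Factorial_Ring.prime r" "r \<notin> sigma j" "q_elt r x" for x r
      unfolding E_def by (rule generate.incl) (use that in \<open>auto simp: E0_def\<close>)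
    have over: "pi_over (sigma j) H (H <#> Q)" if Q: "Q \<in> PP j" for Q
      using j(1) Q primary_Int[OF k j Q] by (rule pi_over_if_Int_subset)
    have E: "normal_in E (H <#> Q)" if Q: "Q \<in> PP j" for Q
      unfolding E_def
    proof (rule normal_in_generate)
      note s = permutable_product[OF H j(1) Q]
      show "E0 \<subseteq> H <#> Q" using E0H s(2) by blast
      show "subgroup (H <#> Q) G" by (rule s(1))
      fix x y assume x: "x \<in> H <#> Q" and "y \<in> E0"
      then obtain r where y: "y \<in> H" "Factorial_Ring.prime r" "r \<notin> sigma j" "q_elt r y"
        by (auto simp: E0_def)
      have xc: "x \<in> carrier G" using s(1) x by (rule subgroup.mem_carrier)
      have r: "q_elt r (inv x \<otimes> y \<otimes> x)" using y(4) xc by (rule q_elt_conj)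
      have "inv x \<otimes> y \<otimes> x \<in> H <#> Q"
        using x y(1) s by (auto intro!: subgroup.m_closed subgroup.m_inv_closed)
      then show "inv x \<otimes> y \<otimes> x \<in> E0" using pi_overD[OF over[OF Q]] y r by (auto simp: E0_def)
    qed
    have Epow: "\<exists>a::nat. x [^] a \<in> E \<and> (\<forall>q. Factorial_Ring.prime q \<longrightarrow> q dvd a \<longrightarrow> q \<in> sigma j)"
      if Q: "Q \<in> PP j" and x: "x \<in> H <#> Q" for Q x
    proof -
      note e = normal_inD[OF E[OF Q]]
      obtain a where a: "card (H <#> Q) = card E * a"
        using card_subgroup_dvd[OF e(1-3)] by (elim dvdE)
      have "pi_over (sigma j) E (H <#> Q)"
        using pi_overD[OF over[OF Q]] rE unfolding pi_over_def by blast
      then have "\<forall>q. Factorial_Ring.prime q \<longrightarrow> q dvd a \<longrightarrow> q \<in> sigma j"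
        using pi_over_index[OF e(1-3) _ _ _ a] by blast
      then show ?thesis using index_pow_mem[OF E[OF Q] a x] by blast
    qed
    \<comment> \<open>Elements of \<open>H \<inter> M\<close> have order composed of primes in \<open>sigma k\<close>,
      which are outside \<open>sigma j\<close>.\<close>
    have HME: "x \<in> E" if x: "x \<in> H" "x \<in> M" for x
    proof -
      have HM: "subgroup (H \<inter> M) G" "subgroup (E \<inter> (H \<inter> M)) G"
        using Hs M_facts(1) Es by (auto intro: subgroups_Inter_pair)
      have "E \<inter> (H \<inter> M) = H \<inter> M"
      proof (rule all_q_elts_imp_eq[OF HM(2,1)])
        fix r y assume r: "Factorial_Ring.prime r" and y: "y \<in> H \<inter> M" "q_elt r y"
        show "y \<in> E \<inter> (H \<inter> M)"
        proof (cases "r \<in> sigma j")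
          case True
          then have "r \<notin> sigma k" using prime_class_unique k(1) j by blast
          then have "y = \<one>" using pi_overD[OF k(2) r _ _ y(2)] y(1) by auto
          then show ?thesis using subgroup.one_closed[OF HM(2)] by simp
        next
          case False then show ?thesis using rE r y by auto
        qed
      qed auto
      then show ?thesis using x by blast
    qed
    define NE where "NE = {x \<in> carrier G. \<forall>c\<in>E. inv x \<otimes> c \<otimes> x \<in> E}"
    have NE: "subgroup NE G" unfolding NE_def using Es by (rule normalizer_subgroup)
    have HQ_NE: "H <#> Q \<subseteq> NE" if "Q \<in> PP j" for Q
      using normal_inD(4)[OF E[OF that]] normal_inD(2)[OF E[OF that]]
      by (auto simp: NE_def dest: subgroup.mem_carrier)
    have N_NE: "N \<subseteq> NE" unfolding N_def proj_closure_def
    proof (rule generate_subgroup_incl[OF _ NE])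
      show "\<Union>(PP j) \<subseteq> NE" using HQ_NE permutable_product(3)[OF H j(1)] by blast
    qed
    have H_NE: "H \<subseteq> NE" using PP_nonempty[OF j(1)] HQ_NE permutable_product(2)[OF H j(1)] by blast
    have E_NE: "normal_in E NE"
      using Es NE EH H_NE by (intro normal_inI) (auto simp: NE_def)
    have ec: "x \<in> carrier G" if "x \<in> E" for x using Es that by (rule subgroup.mem_carrier)
    \<comment> \<open>With \<open>c = comm q m'\<close> the conjugate of \<open>q\<close> by \<open>m'\<close> is \<open>q \<otimes> c\<close>,
      again in a projector, and \<open>comm h (q \<otimes> c)\<close> is \<open>u \<otimes> t \<otimes> comm t c\<close>
      with \<open>u = comm h c\<close> and \<open>t = comm h q\<close>. Here \<open>t\<close> and the whole product have
      \<open>sigma j\<close>-order modulo \<open>E\<close>, while \<open>u\<close> lies in \<open>M\<close>, and \<open>t\<close> commutes with \<open>M\<close> modulo \<open>E\<close>.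
      So \<open>u\<close> is trivial modulo \<open>E\<close>.\<close>
    have key: "comm h (comm q m') \<in> E" if Q: "Q \<in> PP j" and q: "q \<in> Q" and m': "m' \<in> M" for Q q m'
    proof -
      have qc: "q \<in> carrier G" using PP_subgroup[OF j(1) Q] q by (rule subgroup.mem_carrier)
      have m'c: "m' \<in> carrier G" using m' by (rule M_carrier)
      define c where "c = comm q m'"
      have cM: "c \<in> M" unfolding c_def using m' qc by (rule comm_mem_M')
      then have cc: "c \<in> carrier G" by (rule M_carrier)
      define Q' where "Q' = conj_set G Q m'"
      have Q': "Q' \<in> PP j" unfolding Q'_def using j(1) Q m'c by (rule PP_conj)
      have "inv m' \<otimes> q \<otimes> m' = q \<otimes> c" using qc m'c by (simp add: c_def comm_def m_assoc)
      then have qcQ': "q \<otimes> c \<in> Q'" using conj_set_memI[OF q, of m'] by (simp add: Q'_def)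
      obtain S where S: "normal_in S (H <#> Q)" "\<And>a b. a \<in> H \<Longrightarrow> b \<in> Q \<Longrightarrow> comm a b \<in> S"
        "\<And>x y. x \<in> M \<Longrightarrow> y \<in> S \<Longrightarrow> inv x \<otimes> y \<otimes> x \<in> S"
        using permutable_commutators[OF H j(1) Q] M by metis
      note s = normal_inD[OF S(1)]
      define t where "t = comm h q"
      have tS: "t \<in> S" unfolding t_def using h(1) q by (rule S(2))
      have tHQ: "t \<in> H <#> Q" using tS s(3) by blast
      have tc: "t \<in> carrier G" using s(1) tS by (rule subgroup.mem_carrier)
      have tM: "comm x t \<in> E" if x: "x \<in> M" for x
      proof (rule HME)
        have xc: "x \<in> carrier G" using x by (rule M_carrier)
        show 1: "comm x t \<in> M" using x tc by (rule comm_mem_M)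
        have "comm x t = (inv x \<otimes> inv t \<otimes> x) \<otimes> t" using xc tc by (simp add: comm_def m_assoc)
        then have "comm x t \<in> S"
          using S(3)[OF x subgroup.m_inv_closed[OF s(1) tS]] tS s(1) by (simp add: subgroup.m_closed)
        then show "comm x t \<in> H" using 1 s(3) primary_Int[OF k j Q] by blast
      qed
      define u where "u = comm h c"
      have uM: "u \<in> M" unfolding u_def using cM hc by (rule comm_mem_M')
      have uc: "u \<in> carrier G" using uM by (rule M_carrier)
      have "comm h (q \<otimes> c) = u \<otimes> (inv c \<otimes> t \<otimes> c)"
        using hc qc cc by (simp add: u_def t_def comm_def m_assoc inv_mult_group)
      also have "\<dots> = u \<otimes> t \<otimes> comm t c" using uc tc cc by (simp add: comm_def m_assoc)
      finally have s_eq: "comm h (q \<otimes> c) = u \<otimes> t \<otimes> comm t c" .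
      have tcE: "comm t c \<in> E"
        using tM[OF cM] Es cc tc by (simp add: comm_inv[of c t] subgroup.m_inv_closed)
      have "comm h (q \<otimes> c) \<in> H <#> Q'"
        using permutable_product[OF H j(1) Q'] h(1) qcQ' by (intro comm_mem_subgroup) auto
      then obtain b :: nat where b: "(u \<otimes> t \<otimes> comm t c) [^] b \<in> E"
        "\<forall>q. Factorial_Ring.prime q \<longrightarrow> q dvd b \<longrightarrow> q \<in> sigma j"
        using Epow[OF Q'] s_eq by metis
      obtain a :: nat where a: "t [^] a \<in> E" "\<forall>q. Factorial_Ring.prime q \<longrightarrow> q dvd a \<longrightarrow> q \<in> sigma j"
        using Epow[OF Q tHQ] by blast
      have uNE: "u \<in> NE" using uM MN N_NE by blast
      have tNE: "t \<in> NE" using tHQ HQ_NE[OF Q] by blast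
      have 1: "u [^] (a * b) \<in> E"
        using E_NE uNE tNE tcE tM[OF uM] a(1) b(1) by (rule factor_power_mem)
      have "u [^] card M \<in> {\<one>}"
        by (rule index_pow_mem[OF normal_in_one[OF M_facts(1)] _ uM]) simp
      then have 2: "u [^] card M \<in> E" using Es by (simp add: subgroup.one_closed)
      have "coprime (a * b) (card M)"
      proof (rule coprime_if_no_common_prime)
        fix r assume r: "Factorial_Ring.prime r" "r dvd a * b" "r dvd card M"
        then have "r dvd a \<or> r dvd b" using prime_dvd_mult_eq_nat by blast
        then have "r \<in> sigma j" using r a b by blast
        moreover have "r \<in> sigma k" using r k(2) pi_over_Cauchy[OF M_facts(1)] by blast
        ultimately show False using prime_class_unique k(1) j by blast
      qed
      then show ?thesis using coprime_powers_mem[OF Es uc 1 2] by (simp add: u_def c_def)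
    qed
    define S0 where "S0 = {comm q m' | q m'. q \<in> \<Union>(PP j) \<and> m' \<in> M}"
    have PPc: "\<Union>(PP j) \<subseteq> carrier G" using j(1) by (rule PP_Union_carrier)
    show ?thesis
    proof (cases "S0 \<subseteq> {\<one>}")
      case True
      define C where "C = {x \<in> carrier G. \<forall>s\<in>M. x \<otimes> s = s \<otimes> x}"
      have C: "subgroup C G" unfolding C_def using M_facts(3) by (rule centralizer_subgroup)
      have "\<Union>(PP j) \<subseteq> C"
      proof
        fix q assume q: "q \<in> \<Union>(PP j)"
        have "q \<otimes> s = s \<otimes> q" if s: "s \<in> M" for s
        proof -
          have "comm q s \<in> S0" using q s by (auto simp: S0_def)
          then have "comm q s = \<one>" using True by auto
          then show ?thesis using comm_eq_one_iff[of q s] q s PPc M_carrier by auto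
        qed
        then show "q \<in> C" using q PPc by (auto simp: C_def)
      qed
      then have "N \<subseteq> C" unfolding N_def proj_closure_def using C by (rule generate_subgroup_incl)
      then show ?thesis using trivial hN m by (auto simp: C_def)
    next
      case False
      have S0M: "S0 \<subseteq> M" using comm_mem_M' PPc by (auto simp: S0_def)
      have gen: "generate G S0 = M"
      proof (rule minimal_normal_generate[OF M S0M False])
        fix x s assume x: "x \<in> carrier G" and "s \<in> S0"
        then obtain q m' where qm: "q \<in> \<Union>(PP j)" "m' \<in> M" "s = comm q m'" by (auto simp: S0_def)
        have c: "q \<in> carrier G" "m' \<in> carrier G" using qm PPc M_carrier by auto
        have "inv x \<otimes> s \<otimes> x = comm (inv x \<otimes> q \<otimes> x) (inv x \<otimes> m' \<otimes> x)"
          using c x by (simp add: qm(3) comm_def m_assoc inv_mult_group)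
        then show "inv x \<otimes> s \<otimes> x \<in> S0"
          using PP_Union_conj[OF j(1) x qm(1)] M_conj[OF x qm(2)] by (auto simp: S0_def)
      qed
      define L where "L = {c \<in> M. comm h c \<in> E}"
      have L: "subgroup L G" unfolding L_def
      proof (rule subgroup_comm_mem[OF hc M_facts(1) Es])
        show "inv x \<otimes> e \<otimes> x \<in> E" if "x \<in> M" "e \<in> E" for x e using that MN N_NE by (auto simp: NE_def)
      qed
      have "S0 \<subseteq> L" using S0M key by (auto simp: S0_def L_def)
      then have "M \<subseteq> L" unfolding gen[symmetric] using L by (intro generate_subgroup_incl)
      then have "comm h m \<in> H" using m EH by (auto simp: L_def)
      moreover have "inv m \<otimes> h \<otimes> m = h \<otimes> comm h m" using hc mc by (simp add: comm_def m_assoc)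
      ultimately show ?thesis using h(1) Hs by (simp add: subgroup.m_closed)
    qed
  qed
qed

text \<open>For the class of \<open>M\<close>, the residual of \<open>H\<close> is normal in \<open>H <#> M\<close> by the previous
  lemma, and its index there is a product of primes from \<open>sigma k\<close>.\<close>

lemma primary_pi_over:
  assumes k: "k \<in> I" "pi_over (sigma k) {\<one>} M" and i: "i \<in> I" "Q \<in> PP i"
  shows "pi_over (sigma i) H (H <#> Q)"
proof (cases "i = k")
  case False
  then show ?thesis using primary_Int[OF k i(1) _ i(2)] i by (intro pi_over_if_Int_subset)
next
  case True
  define E0 where "E0 = {x \<in> H. \<exists>r. Factorial_Ring.prime r \<and> r \<notin> sigma k \<and> q_elt r x}"
  define E where "E = generate G E0"
  have E0H: "E0 \<subseteq> H" by (auto simp: E0_def)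
  have EH: "E \<subseteq> H" unfolding E_def using E0H Hs by (rule generate_subgroup_incl)
  have HMsub: "H \<subseteq> H <#> M" "M \<subseteq> H <#> M" using subgroup_set_mult_subsets[OF Hs M_facts(1)] .
  have E: "normal_in E (H <#> M)" unfolding E_def
  proof (rule normal_in_generate[OF _ HM_subgroup])
    show "E0 \<subseteq> H <#> M" using E0H HMsub by blast
    fix x y assume x: "x \<in> H <#> M" and y: "y \<in> E0"
    obtain g m where g: "g \<in> H" "m \<in> M" "x = g \<otimes> m" using x by (rule set_multE)
    obtain r where r: "y \<in> H" "Factorial_Ring.prime r" "r \<notin> sigma k" "q_elt r y"
      using y by (auto simp: E0_def)
    have c: "g \<in> carrier G" "m \<in> carrier G" "y \<in> carrier G" using g r H_carrier M_carrier by auto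
    obtain j where j: "j \<in> I" "r \<in> sigma j" using prime_class[OF r(2)] by blast
    have jk: "j \<noteq> k" using j r by blast
    define z where "z = inv g \<otimes> y \<otimes> g"
    have z: "z \<in> H" "q_elt r z" using g r(1) Hs q_elt_conj[OF r(4) c(1)]
      by (auto simp: z_def subgroup.m_closed subgroup.m_inv_closed)
    have "inv m \<otimes> z \<otimes> m \<in> H" using k j(1) jk r(2) j(2) z g(2) by (rule primary_conj_mem)
    moreover have "q_elt r (inv m \<otimes> z \<otimes> m)" using z(2) c(2) by (rule q_elt_conj)
    moreover have "inv m \<otimes> z \<otimes> m = inv x \<otimes> y \<otimes> x"
      using c by (simp add: z_def g(3) m_assoc inv_mult_group)
    ultimately show "inv x \<otimes> y \<otimes> x \<in> E0" using r by (auto simp: E0_def)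
  qed
  note e = normal_inD[OF E]
  obtain n1 where n1: "card (H <#> M) = card H * n1" "n1 dvd card M"
    using index_permuting[OF Hs M_facts(1)] by blast
  obtain n2 where n2: "card H = card E * n2" using card_subgroup_dvd[OF e(1) Hs EH] by (elim dvdE)
  have card: "card (H <#> M) = card E * (n2 * n1)" using n1 n2 by simp
  show ?thesis unfolding pi_over_def
  proof (intro allI impI)
    fix q x assume q: "Factorial_Ring.prime q" "q \<notin> sigma i" and x: "x \<in> H <#> Q" "q_elt q x"
    have "H <#> (M \<inter> (H <#> Q)) \<subseteq> H <#> M" by (intro mono_set_mult) auto
    then have xHM: "x \<in> H <#> M" using q_elt_mem_HM[OF i q x] by blast
    have "\<not> q dvd n1"
      using q True n1(2) k(2) pi_over_Cauchy[OF M_facts(1)] dvd_trans by blast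
    moreover have "\<not> q dvd n2"
    proof (rule index_coprime_if_q_elts[OF e(1) Hs EH q(1) _ n2])
      fix y assume "y \<in> H" "q_elt q y"
      then show "y \<in> E" unfolding E_def using q True by (auto intro!: generate.incl simp: E0_def)
    qed
    ultimately have "\<not> q dvd n2 * n1" using q(1) prime_dvd_mult_eq_nat by blast
    then have "x \<in> E" using q_elt_mem_normal[OF E card q(1) _ xHM x(2)] by blast
    then show "x \<in> H" using EH by blast
  qed
qed

end

section \<open>Minimal normal subgroups involving several classes of primes\<close>

context fin_group
begin

lemma pi_over_conj_set:
  assumes V: "subgroup V G" and x: "x \<in> carrier G" and over: "pi_over ps {\<one>} (conj_set G V x)"
  shows "pi_over ps {\<one>} V"
  unfolding pi_over_def
proof (intro allI impI)
  fix q v assume q: "Factorial_Ring.prime q" "q \<notin> ps" and v: "v \<in> V" "q_elt q v"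
  have vc: "v \<in> carrier G" using v(2) by (rule q_elt_closed)
  have "inv x \<otimes> v \<otimes> x \<in> {\<one>}"
    using pi_overD[OF over q conj_set_memI[OF v(1)] q_elt_conj[OF v(2) x]] .
  then have "x \<otimes> (inv x \<otimes> v \<otimes> x) \<otimes> inv x = x \<otimes> \<one> \<otimes> inv x" by simp
  then show "v \<in> {\<one>}" using x vc by (simp add: m_assoc)
qed

lemma minimal_normal_distinct:
  assumes T: "minimal_normal T J" and U: "minimal_normal U J" and ne: "T \<noteq> U"
    and x: "x \<in> T" and y: "y \<in> U"
  shows "T \<inter> U = {\<one>}" "x \<otimes> y = y \<otimes> x"
proof -
  note t = minimal_normalD[OF T] and u = minimal_normalD[OF U]
  note tn = normal_inD[OF t(1)] and un = normal_inD[OF u(1)]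
  show "T \<inter> U = {\<one>}"
    using minimal_normal_Int[OF T u(1)] u(3)[OF t(1)] t(2) ne by blast
  then show "x \<otimes> y = y \<otimes> x"
    by (rule trivial_Int_commute[OF tn(1) un(1) _ _ _ x y]) (use tn un in blast)+
qed

end

locale mixed_step = corefree_step +
  assumes mixed: "k \<in> I \<Longrightarrow> \<not> pi_over (sigma k) {\<one>} M"
begin

text \<open>A nontrivial centre would be all of \<open>M\<close>; in an abelian group the elements of
  \<open>q\<close>-power order form a subgroup, so \<open>M\<close> would be a \<open>q\<close>-group for a single prime \<open>q\<close>.\<close>

lemma M_centerless:
  assumes z: "z \<in> M" "\<And>m. m \<in> M \<Longrightarrow> z \<otimes> m = m \<otimes> z"
  shows "z = \<one>"
proof -
  define Z where "Z = {z \<in> M. \<forall>m\<in>M. z \<otimes> m = m \<otimes> z}"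
  have "Z = {x \<in> carrier G. \<forall>s\<in>M. x \<otimes> s = s \<otimes> x} \<inter> M" using M_carrier by (auto simp: Z_def)
  then have "normal_in Z (carrier G)" using normal_in_Int2[OF normal_in_centralizer[OF M_normal] M_normal] by simp
  then have "Z = {\<one>} \<or> Z = M" by (rule minimal_normalD(3)[OF M]) (auto simp: Z_def)
  moreover have "Z \<noteq> M"
  proof
    assume "Z = M"
    then have ab: "x \<otimes> y = y \<otimes> x" if "x \<in> M" "y \<in> M" for x y using that unfolding Z_def by blast
    obtain q x where q: "Factorial_Ring.prime q" and x: "q_elt q x" "x \<in> M" "x \<noteq> \<one>"
      using exists_q_elt[OF M_facts(1) minimal_normalD(2)[OF M]] by blast
    obtain k where k: "k \<in> I" "q \<in> sigma k" using prime_class[OF q] by blast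
    define W where "W = {x \<in> M. q_elt q x}"
    have W: "subgroup W G"
    proof (rule subgroupI)
      show "W \<subseteq> carrier G" using M_carrier by (auto simp: W_def)
      show "W \<noteq> {}" using x by (auto simp: W_def)
    next
      fix a assume "a \<in> W"
      then obtain n :: nat where n: "a [^] (q ^ n) = \<one>" "a \<in> M" by (auto simp: W_def q_elt_def)
      have "inv a [^] (q ^ n) = \<one>" using n nat_pow_inv[OF M_carrier[OF n(2)]] by simp
      then show "inv a \<in> W" using n M_facts(1) M_carrier
        by (auto simp: W_def q_elt_def subgroup.m_inv_closed)
    next
      fix a b assume "a \<in> W" "b \<in> W"
      then obtain n m :: nat where nm: "a [^] (q ^ n) = \<one>" "b [^] (q ^ m) = \<one>" "a \<in> M" "b \<in> M"
        by (auto simp: W_def q_elt_def)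
      have c: "a \<in> carrier G" "b \<in> carrier G" using nm M_carrier by auto
      have "(a \<otimes> b) [^] (q ^ (n + m)) = (a [^] (q ^ n)) [^] (q ^ m) \<otimes> (b [^] (q ^ m)) [^] (q ^ n)"
        using pow_mult_distrib[OF ab[OF nm(3,4)] c] c
        by (simp add: nat_pow_pow power_add mult.commute)
      then have "(a \<otimes> b) [^] (q ^ (n + m)) = \<one>" using nm by simp
      then show "a \<otimes> b \<in> W" using nm c M_facts(1) unfolding W_def q_elt_def
        by (auto simp: subgroup.m_closed)
    qed
    have "normal_in W (carrier G)"
      by (rule normal_inI[OF W subgroup_self]) (use M_conj q_elt_conj M_carrier in \<open>auto simp: W_def\<close>)
    then have "W = {\<one>} \<or> W = M" by (rule minimal_normalD(3)[OF M]) (auto simp: W_def)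
    then have "W = M" using x by (auto simp: W_def)
    have "pi_over (sigma k) {\<one>} M" unfolding pi_over_def
    proof (intro allI impI)
      fix r y assume r: "Factorial_Ring.prime r" "r \<notin> sigma k" and y: "y \<in> M" "q_elt r y"
      have "q_elt q y" using y(1) \<open>W = M\<close> by (auto simp: W_def)
      then show "y \<in> {\<one>}" using q_elt_two_primes[OF _ y(2) q r(1)] k r(2) by auto
    qed
    then show False using mixed[OF k(1)] by blast
  qed
  ultimately show ?thesis using z by (auto simp: Z_def)
qed

lemma conj_M: "x \<in> carrier G \<Longrightarrow> conj_set G M x = M"
  by (rule normal_in_conj_set[OF M_normal])

lemma factor_conj: "minimal_normal T M \<Longrightarrow> x \<in> carrier G \<Longrightarrow> minimal_normal (conj_set G T x) M"
  using minimal_normal_conj conj_M by blast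

lemma factors_generate:
  assumes T: "minimal_normal T M"
  shows "generate G (\<Union>x\<in>carrier G. conj_set G T x) = M"
  using normal_inD[OF minimal_normalD(1)[OF T]] minimal_normalD(2)[OF T]
  by (intro minimal_normal_conj_closure[OF M]) (auto dest: subgroup.one_closed)

text \<open>A minimal normal subgroup \<open>T\<close> of \<open>M\<close> that is abelian commutes with all its
  conjugates, and these generate \<open>M\<close>.\<close>

lemma factor_centerless:
  assumes T: "minimal_normal T M" and z: "z \<in> T" "\<And>t. t \<in> T \<Longrightarrow> z \<otimes> t = t \<otimes> z"
  shows "z = \<one>"
proof (rule M_centerless)
  note t = normal_inD[OF minimal_normalD(1)[OF T]]
  have Tc: "T \<subseteq> carrier G" using t(1) by (rule subgroup.subset)
  show "z \<in> M" using z t(3) by blast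
  define Z where "Z = {z \<in> T. \<forall>t\<in>T. z \<otimes> t = t \<otimes> z}"
  have "Z = {x \<in> M. \<forall>s\<in>T. x \<otimes> s = s \<otimes> x} \<inter> T" using t(3) by (auto simp: Z_def)
  then have "normal_in Z M"
    using normal_in_Int2[OF normal_in_centralizer minimal_normalD(1)[OF T]] minimal_normalD(1)[OF T] by simp
  then have ZT: "Z = {\<one>} \<or> Z = T" by (rule minimal_normalD(3)[OF T]) (auto simp: Z_def)
  fix m assume m: "m \<in> M"
  show "z \<otimes> m = m \<otimes> z"
  proof (cases "Z = T")
    case False
    then have "z = \<one>" using ZT z unfolding Z_def by blast
    then show ?thesis using m M_carrier by simp
  next
    case True
    let ?C = "{x \<in> carrier G. \<forall>s\<in>{z}. x \<otimes> s = s \<otimes> x}"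
    have "(\<Union>x\<in>carrier G. conj_set G T x) \<subseteq> ?C"
    proof
      fix s assume "s \<in> (\<Union>x\<in>carrier G. conj_set G T x)"
      then obtain g where g: "g \<in> carrier G" "s \<in> conj_set G T g" by auto
      have sc: "s \<in> carrier G" using conj_set_subset[OF Tc g(1)] g(2) by blast
      have "z \<otimes> s = s \<otimes> z"
      proof (cases "T = conj_set G T g")
        case eq: True
        then show ?thesis using g(2) True z(1) unfolding Z_def by blast
      next
        case False
        then show ?thesis using minimal_normal_distinct(2)[OF T factor_conj[OF T g(1)] _ z(1) g(2)] by blast
      qed
      then show "s \<in> ?C" using sc by simp
    qed
    moreover have "subgroup ?C G" using z(1) Tc by (intro centralizer_subgroup) auto
    ultimately have "M \<subseteq> ?C" unfolding factors_generate[OF T, symmetric] by (rule generate_subgroup_incl)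
    then show ?thesis using m by auto
  qed
qed

lemma factor_mixed:
  assumes T: "minimal_normal T M" and k: "k \<in> I"
  shows "\<not> pi_over (sigma k) {\<one>} T"
proof
  assume over: "pi_over (sigma k) {\<one>} T"
  note t = normal_inD[OF minimal_normalD(1)[OF T]]
  have Tc: "T \<subseteq> carrier G" using t(1) by (rule subgroup.subset)
  have "pi_over (sigma k) {\<one>} (generate G (\<Union>(conj_set G T ` carrier G)))"
  proof (rule pi_over_generate_normal[OF M_facts(1)])
    fix V assume "V \<in> conj_set G T ` carrier G"
    then obtain x where x: "x \<in> carrier G" "V = conj_set G T x" by auto
    have "conj_set G V (inv x) = T" using conj_set_inverse(1)[OF Tc x(1)] x(2) by simp
    then have "pi_over (sigma k) {\<one>} V"
      using over t(1) x by (intro pi_over_conj_set[of V "inv x"]) (auto intro: conj_set_subgroup)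
    then show "normal_in V M \<and> pi_over (sigma k) {\<one>} V"
      using minimal_normalD(1)[OF factor_conj[OF T x(1)]] x(2) by simp
  qed
  then show False using factors_generate[OF T] mixed[OF k] by simp
qed

text \<open>If \<open>h\<close> centralised all projectors for its class, all of them would contain \<open>h\<close> by
  maximality, so their intersection with \<open>M\<close> would be a nontrivial normal subgroup of \<open>G\<close> and
  therefore \<open>M\<close>.\<close>

lemma not_centralized:
  assumes k: "k \<in> I" and q: "Factorial_Ring.prime q" "q \<in> sigma k"
    and h: "h \<in> M" "q_elt q h" "h \<noteq> \<one>"
  shows "\<exists>Q\<in>PP k. \<exists>p\<in>Q. h \<otimes> p \<noteq> p \<otimes> h"
proof (rule ccontr)
  assume neg: "\<not> (\<exists>Q\<in>PP k. \<exists>p\<in>Q. h \<otimes> p \<noteq> p \<otimes> h)"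
  have hc: "h \<in> carrier G" using h(1) by (rule M_carrier)
  define V where "V = generate G {h}"
  have V: "subgroup V G" unfolding V_def using hc by (intro generate_is_subgroup) auto
  have Vpi: "pi_over (sigma k) {\<one>} V"
    unfolding pi_over_Cauchy[OF V] using card_generate_q_elt[OF h(2) q(1)] q(2) by (auto simp: V_def)
  have hQ: "h \<in> Q" if Q: "Q \<in> PP k" for Q
  proof -
    have "V \<subseteq> Q"
    proof (rule PP_absorbs[OF k Q V Vpi])
      fix x v assume x: "x \<in> Q" and v: "v \<in> V"
      have xc: "x \<in> carrier G" using PP_subgroup[OF k Q] x by (rule subgroup.mem_carrier)
      show "inv x \<otimes> v \<otimes> x \<in> V"
      proof (rule conj_generate_closed[OF _ xc V _ v[unfolded V_def]])
        show "{h} \<subseteq> carrier G" using hc by simp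
        fix s assume "s \<in> {h}"
        moreover have "h \<otimes> x = x \<otimes> h" using neg Q x by blast
        ultimately have "inv x \<otimes> s \<otimes> x = h" using hc xc by (simp add: m_assoc)
        then show "inv x \<otimes> s \<otimes> x \<in> V" by (simp add: V_def generate.incl)
      qed
    qed
    then show ?thesis by (auto simp: V_def generate.incl)
  qed
  define W where "W = M \<inter> \<Inter>(PP k)"
  have Q0: "\<Inter>(PP k) \<subseteq> carrier G" "subgroup (\<Inter>(PP k)) G"
    using PP_nonempty[OF k] PP_subgroup[OF k] by (auto intro: subgroups_Inter dest: subgroup.mem_carrier)
  have "normal_in W (carrier G)"
  proof (rule normal_inI[OF _ subgroup_self])
    show "subgroup W G" unfolding W_def using M_facts(1) Q0(2) by (rule subgroups_Inter_pair)
    show "W \<subseteq> carrier G" using Q0 by (auto simp: W_def)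
    fix x n assume x: "x \<in> carrier G" and n: "n \<in> W"
    have nc: "n \<in> carrier G" using n Q0 by (auto simp: W_def)
    have "inv x \<otimes> n \<otimes> x \<in> Q" if Q: "Q \<in> PP k" for Q
    proof -
      have Qc: "Q \<subseteq> carrier G" using PP_subgroup[OF k Q] by (rule subgroup.subset)
      have "n \<in> conj_set G Q (inv x)" using PP_conj[OF k Q, of "inv x"] x n by (auto simp: W_def)
      then show ?thesis using conj_set_mem_iff[OF Qc inv_closed[OF x] nc] x by simp
    qed
    then show "inv x \<otimes> n \<otimes> x \<in> W" using M_conj[OF x] n by (auto simp: W_def)
  qed
  then have "W = {\<one>} \<or> W = M" by (rule minimal_normalD(3)[OF M]) (auto simp: W_def)
  moreover have "h \<in> W" using h(1) hQ by (auto simp: W_def)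
  ultimately have "W = M" using h(3) by auto
  moreover obtain Q where "Q \<in> PP k" using PP_nonempty[OF k] by blast
  ultimately show False using pi_over_mono[OF PP_pi[OF k], of Q "{\<one>}" M] mixed[OF k] by (auto simp: W_def)
qed

text \<open>The set \<open>S\<close> collects the commutators of \<open>H\<close> and \<open>Q\<close>; its intersection with \<open>M\<close> is
  normal in \<open>M\<close> because \<open>M\<close> normalises \<open>S\<close>.\<close>

lemma commutator_bridge:
  assumes i: "i \<in> I" and Q: "Q \<in> PP i"
  obtains S where "S \<subseteq> H <#> Q" "normal_in (M \<inter> S) M" "\<And>a b. a \<in> H \<Longrightarrow> b \<in> Q \<Longrightarrow> comm a b \<in> S"
proof -
  obtain S where S: "normal_in S (H <#> Q)" "\<And>a b. a \<in> H \<Longrightarrow> b \<in> Q \<Longrightarrow> comm a b \<in> S"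
    "\<And>x y. x \<in> M \<Longrightarrow> y \<in> S \<Longrightarrow> inv x \<otimes> y \<otimes> x \<in> S"
    using permutable_commutators[OF H i Q] M by metis
  note s = normal_inD[OF S(1)]
  have "normal_in (M \<inter> S) M"
  proof (rule normal_inI[OF subgroups_Inter_pair[OF M_facts(1) s(1)] M_facts(1)])
    show "inv x \<otimes> n \<otimes> x \<in> M \<inter> S" if "x \<in> M" "n \<in> M \<inter> S" for x n
      using that S(3) M_conj M_carrier by auto
  qed auto
  then show thesis using that S s(3) by blast
qed

text \<open>The index of \<open>H\<close> in \<open>H <#> Q\<close> is a product of primes from \<open>sigma k\<close>, and \<open>T\<close> is
  normal in the normal subgroup \<open>M \<inter> (H <#> Q)\<close> of \<open>H <#> Q\<close>.\<close>

lemma factor_index: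
  assumes T: "normal_in T M" and k: "k \<in> I" and Q: "Q \<in> PP k" and TQ: "T \<subseteq> H <#> Q"
  obtains m where "card T = card (T \<inter> H) * m" "\<And>q. Factorial_Ring.prime q \<Longrightarrow> q dvd m \<Longrightarrow> q \<in> sigma k"
proof -
  define B where "B = M \<inter> (H <#> Q)"
  have B: "normal_in B (H <#> Q)" unfolding B_def using k Q by (rule M_Int_normal)
  note b = normal_inD[OF B] and t = normal_inD[OF T]
  have TB: "normal_in T B" using T b(1) by (rule normal_in_subset) (use t TQ in \<open>auto simp: B_def\<close>)
  obtain n where n: "card B = card (B \<inter> H) * n"
    "\<And>q. Factorial_Ring.prime q \<Longrightarrow> q dvd n \<Longrightarrow> q \<in> sigma k"
    using permutable_index[OF H k Q B] by blast
  obtain m where m: "card T = card (T \<inter> (B \<inter> H)) * m" "m dvd n"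
    using index_Int_normal[OF TB subgroups_Inter_pair[OF b(1) Hs] _ n(1)] by blast
  have "T \<inter> (B \<inter> H) = T \<inter> H" using normal_inD(3)[OF TB] by blast
  then show thesis using that[of m] m n dvd_trans by (metis (no_types))
qed

text \<open>By \<open>not_centralized\<close> there is an element \<open>p\<close> of a projector \<open>Q\<close> that does not
  commute with \<open>h\<close>. Let \<open>S \<subseteq> H <#> Q\<close> be the subgroup from \<open>commutator_bridge\<close>. If \<open>T\<close>
  is not contained in \<open>S\<close>, then \<open>T\<close> meets \<open>M \<inter> S\<close> trivially and commutes with it. The
  conjugate \<open>h'\<close> of \<open>h\<close> by \<open>p\<close> equals \<open>h\<close> times a commutator in \<open>M \<inter> S\<close>. If \<open>p\<close>
  normalises \<open>T\<close>, that commutator lies in \<open>T\<close>; if not, it and \<open>h'\<close> centralise \<open>T\<close>, so \<open>h\<close> is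
  central in \<open>T\<close> and thus trivial. In both cases there is a contradiction, so \<open>T\<close> lies in
  \<open>H <#> Q\<close>, and \<open>factor_index\<close> applies.\<close>

lemma factor_meets_H_index:
  assumes T: "minimal_normal T M" and k: "k \<in> I" and q: "Factorial_Ring.prime q" "q \<in> sigma k"
    and h: "h \<in> T" "h \<in> H" "q_elt q h" "h \<noteq> \<one>"
  obtains m where "card T = card (T \<inter> H) * m" "\<And>q. Factorial_Ring.prime q \<Longrightarrow> q dvd m \<Longrightarrow> q \<in> sigma k"
proof -
  note t = minimal_normalD[OF T] and tn = normal_inD[OF minimal_normalD(1)[OF T]]
  have hM: "h \<in> M" using h(1) tn(3) by blast
  obtain Q p where Q: "Q \<in> PP k" "p \<in> Q" and np: "h \<otimes> p \<noteq> p \<otimes> h"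
    using not_centralized[OF k q hM h(3,4)] by blast
  obtain S where S: "S \<subseteq> H <#> Q" "normal_in (M \<inter> S) M" "\<And>a b. a \<in> H \<Longrightarrow> b \<in> Q \<Longrightarrow> comm a b \<in> S"
    using commutator_bridge[OF k Q(1)] by blast
  note s = normal_inD[OF S(2)]
  have hc: "h \<in> carrier G" using hM by (rule M_carrier)
  have pc: "p \<in> carrier G" using PP_subgroup[OF k Q(1)] Q(2) by (rule subgroup.mem_carrier)
  have "T \<subseteq> S"
  proof (rule ccontr)
    assume "\<not> T \<subseteq> S"
    then have tr: "T \<inter> (M \<inter> S) = {\<one>}" using minimal_normal_Int[OF T S(2)] by blast
    have com: "x \<otimes> y = y \<otimes> x" if "x \<in> T" "y \<in> M \<inter> S" for x y
      by (rule trivial_Int_commute[OF tn(1) s(1) tr _ _ that]) (use tn s in blast)+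
    define U where "U = conj_set G T p"
    have U: "minimal_normal U M" unfolding U_def using T pc by (rule factor_conj)
    define h' where "h' = inv p \<otimes> h \<otimes> p"
    have h'U: "h' \<in> U" unfolding U_def h'_def using h(1) by (rule conj_set_memI)
    have h'c: "h' \<in> carrier G" using hc pc by (simp add: h'_def)
    define e where "e = comm h p"
    have e_eq: "h' = h \<otimes> e" using hc pc by (simp add: h'_def e_def comm_def m_assoc)
    have ec: "e \<in> carrier G" using hc pc by (simp add: e_def)
    have eS: "e \<in> M \<inter> S" using S(3)[OF h(2) Q(2)] comm_mem_M[OF hM pc] by (simp add: e_def)
    have "e = \<one>"
    proof (cases "T = U")
      case True
      have "e = inv h \<otimes> h'" unfolding e_eq using hc ec by simp
      then have "e \<in> T" using True h'U h(1) tn(1) by (simp add: subgroup.m_closed subgroup.m_inv_closed)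
      then show ?thesis using tr eS by blast
    next
      case False
      have "h = \<one>"
      proof (rule factor_centerless[OF T h(1)])
        fix t assume tT: "t \<in> T"
        have tc: "t \<in> carrier G" using tn(1) tT by (rule subgroup.mem_carrier)
        have 1: "t \<otimes> (h \<otimes> e) = h \<otimes> e \<otimes> t"
          using minimal_normal_distinct(2)[OF T U False tT h'U] by (simp add: e_eq)
        have 2: "t \<otimes> e = e \<otimes> t" using com[OF tT eS] .
        have "(t \<otimes> h) \<otimes> e = h \<otimes> (e \<otimes> t)" using 1 tc hc ec by (simp add: m_assoc)
        also have "\<dots> = (h \<otimes> t) \<otimes> e" using tc hc ec by (simp add: m_assoc flip: 2)
        finally show "h \<otimes> t = t \<otimes> h" using tc hc ec by simp
      qed
      then show ?thesis using h(4) by simp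
    qed
    then show False using np comm_eq_one_iff[OF hc pc] by (simp add: e_def)
  qed
  then show thesis using factor_index[OF t(1) k Q(1)] S(1) that by blast
qed

text \<open>The index of \<open>T \<inter> H\<close> in \<open>T\<close> is a product of primes from \<open>sigma k\<close> for each
  class \<open>sigma k\<close> that occurs in \<open>T \<inter> H\<close>. If only one class occurred, \<open>T\<close> would belong to
  it; with two classes, the index is \<open>1\<close>.\<close>

lemma factor_Int_H:
  assumes T: "minimal_normal T M" and ne: "T \<inter> H \<noteq> {\<one>}"
  shows "T \<subseteq> H"
proof -
  note t = minimal_normalD[OF T] and tn = normal_inD[OF minimal_normalD(1)[OF T]]
  have TH: "subgroup (T \<inter> H) G" using tn(1) Hs by (rule subgroups_Inter_pair)
  obtain q h where q: "Factorial_Ring.prime q" and h: "q_elt q h" "h \<in> T" "h \<in> H" "h \<noteq> \<one>"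
    using exists_q_elt[OF TH ne] by blast
  obtain k where k: "k \<in> I" "q \<in> sigma k" using prime_class[OF q] by blast
  obtain m where m: "card T = card (T \<inter> H) * m"
    "\<And>q. Factorial_Ring.prime q \<Longrightarrow> q dvd m \<Longrightarrow> q \<in> sigma k"
    using factor_meets_H_index[OF T k(1) q k(2) h(2,3,1,4)] by blast
  \<comment> \<open>A second class must occur in \<open>T \<inter> H\<close>, otherwise \<open>T\<close> would be a
    \<open>sigma k\<close>-group.\<close>
  obtain r x where r: "Factorial_Ring.prime r" "r \<notin> sigma k" and x: "q_elt r x" "x \<in> T" "x \<in> H" "x \<noteq> \<one>"
  proof (rule ccontr)
    assume neg: "\<not> thesis"
    have "pi_over (sigma k) {\<one>} (T \<inter> H)" unfolding pi_over_def using neg that by blast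
    then have "pi_over (sigma k) {\<one>} T"
      unfolding pi_over_Cauchy[OF TH] pi_over_Cauchy[OF tn(1)] m(1)
      using m(2) prime_dvd_mult_eq_nat by blast
    then show False using factor_mixed[OF T k(1)] by blast
  qed
  obtain l where l: "l \<in> I" "r \<in> sigma l" using prime_class[OF r(1)] by blast
  have lk: "l \<noteq> k" using l r by blast
  obtain n where n: "card T = card (T \<inter> H) * n"
    "\<And>q. Factorial_Ring.prime q \<Longrightarrow> q dvd n \<Longrightarrow> q \<in> sigma l"
    using factor_meets_H_index[OF T l(1) r(1) l(2) x(2,3,1,4)] by blast
  have "m = n" using m(1) n(1) card_subgroup_pos[OF TH] by simp
  then have "\<not> p dvd m" if "Factorial_Ring.prime p" for p
    using m(2)[OF that] n(2)[OF that] prime_class_unique[OF l(1) k(1)] lk by blast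
  then have "m = 1" using prime_factor_nat[of m] by blast
  then have "T \<inter> H = T" using m(1) card_subset_eq[OF finite_subgroup[OF tn(1)], of "T \<inter> H"] by auto
  then show ?thesis by blast
qed

text \<open>The minimal normal subgroups of \<open>M\<close> contained in \<open>H\<close> are permuted by every
  projector: a conjugate of one of them by an element of \<open>Q\<close> lies in \<open>H <#> Q\<close>, so it still
  meets \<open>H\<close> nontrivially and lies in \<open>H\<close>. Hence they generate a normal subgroup of \<open>G\<close> inside
  \<open>H\<close>, which is trivial.\<close>

lemma no_factor_in_H:
  assumes T: "minimal_normal T M"
  shows "T \<inter> H = {\<one>}"
proof (rule ccontr)
  assume "T \<inter> H \<noteq> {\<one>}"
  then have TH: "T \<subseteq> H" using T by (intro factor_Int_H)
  define F where "F = {T. minimal_normal T M \<and> T \<subseteq> H}"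
  define M0 where "M0 = generate G (\<Union>F)"
  have Fc: "\<Union>F \<subseteq> carrier G" using H_carrier by (auto simp: F_def)
  have M0: "subgroup M0 G" unfolding M0_def using Fc by (rule generate_is_subgroup)
  have conjF: "conj_set G U p \<in> F" if U: "U \<in> F" and k: "k \<in> I" and Q: "Q \<in> PP k" "p \<in> Q" for U k Q p
  proof -
    have mU: "minimal_normal U M" "U \<subseteq> H" using U by (auto simp: F_def)
    have pc: "p \<in> carrier G" using PP_subgroup[OF k Q(1)] Q(2) by (rule subgroup.mem_carrier)
    have mV: "minimal_normal (conj_set G U p) M" using mU(1) pc by (rule factor_conj)
    note v = minimal_normalD[OF mV] and vn = normal_inD[OF minimal_normalD(1)[OF mV]]
    note P = permutable_product[OF H k Q(1)]
    have "conj_set G U p \<subseteq> conj_set G (H <#> Q) p" using mU(2) P(2) by (intro conj_set_mono) blast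
    also have "\<dots> = H <#> Q" using P Q(2) by (intro conj_set_self) auto
    finally have VQ: "conj_set G U p \<subseteq> H <#> Q" .
    obtain m where m: "card (conj_set G U p) = card (conj_set G U p \<inter> H) * m"
      "\<And>q. Factorial_Ring.prime q \<Longrightarrow> q dvd m \<Longrightarrow> q \<in> sigma k"
      using factor_index[OF v(1) k Q(1) VQ] by blast
    have "conj_set G U p \<inter> H \<noteq> {\<one>}"
    proof
      assume "conj_set G U p \<inter> H = {\<one>}"
      then have "pi_over (sigma k) {\<one>} (conj_set G U p)"
        using m unfolding pi_over_Cauchy[OF vn(1)] by simp
      then show False using factor_mixed[OF mV k] by blast
    qed
    then show ?thesis using factor_Int_H[OF mV] mV by (simp add: F_def)
  qed
  define NM where "NM = {x \<in> carrier G. \<forall>s\<in>M0. inv x \<otimes> s \<otimes> x \<in> M0}"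
  have "NM = carrier G"
  proof (rule carrier_generated)
    show "subgroup NM G" unfolding NM_def using M0 by (rule normalizer_subgroup)
    fix k Q assume k: "k \<in> I" and Q: "Q \<in> PP k"
    show "Q \<subseteq> NM"
    proof
      fix p assume p: "p \<in> Q"
      have pc: "p \<in> carrier G" using PP_subgroup[OF k Q] p by (rule subgroup.mem_carrier)
      have "inv p \<otimes> s \<otimes> p \<in> M0" if "s \<in> M0" for s
      proof (rule conj_generate_closed[OF Fc pc M0 _ that[unfolded M0_def]])
        fix s assume "s \<in> \<Union>F"
        then obtain U where U: "U \<in> F" "s \<in> U" by blast
        then show "inv p \<otimes> s \<otimes> p \<in> M0"
          using conjF[OF U(1) k Q p] conj_set_memI[OF U(2), of p] unfolding M0_def
          by (blast intro: generate.incl)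
      qed
      then show "p \<in> NM" using pc by (simp add: NM_def)
    qed
  qed
  then have "normal_in M0 (carrier G)"
    using M0 by (intro normal_inI subgroup_self) (auto simp: NM_def subgroup.mem_carrier)
  moreover have "M0 \<subseteq> H" unfolding M0_def using Hs by (intro generate_subgroup_incl) (auto simp: F_def)
  ultimately have "M0 = {\<one>}" by (rule corefree)
  moreover have "T \<subseteq> M0" using T TH unfolding M0_def F_def by (blast intro: generate.incl)
  ultimately show False
    using minimal_normalD(2)[OF T] subgroup.one_closed[OF normal_inD(1)[OF minimal_normalD(1)[OF T]]] by blast
qed

text \<open>By the index computation a minimal normal subgroup of \<open>M\<close> contained in \<open>H <#> Q\<close>
  would belong to the class \<open>sigma i\<close>.\<close>

lemma normal_in_product_trivial:
  assumes i: "i \<in> I" and Q: "Q \<in> PP i" and K: "normal_in K M" "K \<subseteq> H <#> Q"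
  shows "K = {\<one>}"
proof (rule ccontr)
  assume "K \<noteq> {\<one>}"
  then obtain T where T: "minimal_normal T M" "T \<subseteq> K" using minimal_normal_exists[OF K(1)] by blast
  note t = minimal_normalD[OF T(1)] and tn = normal_inD[OF minimal_normalD(1)[OF T(1)]]
  obtain m where m: "card T = card (T \<inter> H) * m"
    "\<And>q. Factorial_Ring.prime q \<Longrightarrow> q dvd m \<Longrightarrow> q \<in> sigma i"
    using factor_index[OF t(1) i Q] T(2) K(2) by blast
  then have "pi_over (sigma i) {\<one>} T"
    using no_factor_in_H[OF T(1)] unfolding pi_over_Cauchy[OF tn(1)] by simp
  then show False using factor_mixed[OF T(1) i] by blast
qed

lemma commutators_in_M_trivial:
  assumes i: "i \<in> I" and Q: "Q \<in> PP i" and a: "a \<in> H" and b: "b \<in> Q" and M: "comm a b \<in> M"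
  shows "a \<otimes> b = b \<otimes> a"
proof -
  obtain S where S: "S \<subseteq> H <#> Q" "normal_in (M \<inter> S) M" "\<And>a b. a \<in> H \<Longrightarrow> b \<in> Q \<Longrightarrow> comm a b \<in> S"
    using commutator_bridge[OF i Q] by blast
  have "M \<inter> S = {\<one>}" using S by (intro normal_in_product_trivial[OF i Q]) auto
  then have "comm a b = \<one>" using S(3)[OF a b] M by blast
  then show ?thesis
    using comm_eq_one_iff[OF H_carrier[OF a] subgroup.mem_carrier[OF PP_subgroup[OF i Q] b]] by simp
qed

text \<open>An element of \<open>H \<inter> M\<close> commutes with all projectors for its class, since its
  commutators with them lie in \<open>M\<close> and are therefore trivial, which \<open>not_centralized\<close> excludes
  unless the element is trivial.\<close>

lemma H_Int_M: "H \<inter> M = {\<one>}"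
proof (rule ccontr)
  assume ne: "H \<inter> M \<noteq> {\<one>}"
  obtain q h where q: "Factorial_Ring.prime q" and h: "q_elt q h" "h \<in> H" "h \<in> M" "h \<noteq> \<one>"
    using exists_q_elt[OF subgroups_Inter_pair[OF Hs M_facts(1)] ne] by blast
  obtain k where k: "k \<in> I" "q \<in> sigma k" using prime_class[OF q] by blast
  obtain Q p where Q: "Q \<in> PP k" "p \<in> Q" and np: "h \<otimes> p \<noteq> p \<otimes> h"
    using not_centralized[OF k(1) q k(2) h(3,1,4)] by blast
  have "comm h p \<in> M"
    using h(3) subgroup.mem_carrier[OF PP_subgroup[OF k(1) Q(1)] Q(2)] by (rule comm_mem_M)
  then show False using commutators_in_M_trivial[OF k(1) Q(1) h(2) Q(2)] np by blast
qed

text \<open>Now \<open>M \<inter> (H <#> Q)\<close> meets \<open>H\<close> trivially, so it is a \<open>sigma i\<close>-group. It is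
  normalised by \<open>Q\<close> and therefore contained in \<open>Q\<close>, so its commutators with \<open>H\<close> are trivial.
  Thus \<open>H\<close> is normal in \<open>H <#> (M \<inter> (H <#> Q))\<close>.\<close>

lemma mixed_pi_over:
  assumes i: "i \<in> I" and Q: "Q \<in> PP i"
  shows "pi_over (sigma i) H (H <#> Q)"
proof -
  define B where "B = M \<inter> (H <#> Q)"
  have B: "normal_in B (H <#> Q)" unfolding B_def using i Q by (rule M_Int_normal)
  note b = normal_inD[OF B] and P = permutable_product[OF H i Q]
  obtain m where m: "card B = card (B \<inter> H) * m"
    "\<And>q. Factorial_Ring.prime q \<Longrightarrow> q dvd m \<Longrightarrow> q \<in> sigma i"
    using permutable_index[OF H i Q B] by blast
  have "B \<inter> H = {\<one>}" using H_Int_M subgroup.one_closed[OF b(1)] subgroup.one_closed[OF Hs] by (auto simp: B_def)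
  then have cB: "card B = m" using m(1) by simp
  have Bpi: "pi_over (sigma i) {\<one>} B" unfolding pi_over_Cauchy[OF b(1)] using m(2) cB by simp
  have BQ: "B \<subseteq> Q" using i Q b(1) Bpi by (rule PP_absorbs) (use b(4) P(3) in blast)
  have com: "h \<otimes> c = c \<otimes> h" if h: "h \<in> H" and c: "c \<in> B" for h c
    using h c BQ comm_mem_M'[of c h] H_carrier by (intro commutators_in_M_trivial[OF i Q]) (auto simp: B_def)
  obtain n where n: "card (H <#> B) = card H * n" "n dvd card B"
    using index_permuting[OF Hs b(1)] by blast
  have HB: "subgroup (H <#> B) G"
    using Hs b(1) by (rule permuting_subgroup) (use com in \<open>force simp: set_mult_def\<close>)
  have nor: "normal_in H (H <#> B)"
  proof (rule normal_inI[OF Hs HB subgroup_set_mult_subsets(1)[OF Hs b(1)]])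
    fix x h assume x: "x \<in> H <#> B" and h: "h \<in> H"
    obtain g c where g: "g \<in> H" "c \<in> B" "x = g \<otimes> c" using x by (rule set_multE)
    have cc: "g \<in> carrier G" "c \<in> carrier G" "h \<in> carrier G"
      using g h H_carrier b(1) by (auto dest: subgroup.mem_carrier)
    have z: "inv g \<otimes> h \<otimes> g \<in> H" using g h Hs by (simp add: subgroup.m_closed subgroup.m_inv_closed)
    have "inv x \<otimes> h \<otimes> x = inv c \<otimes> ((inv g \<otimes> h \<otimes> g) \<otimes> c)"
      using cc by (simp add: g(3) m_assoc inv_mult_group)
    also have "\<dots> = inv g \<otimes> h \<otimes> g" unfolding com[OF z g(2)] using cc by simp
    finally show "inv x \<otimes> h \<otimes> x \<in> H" using z by simp
  qed
  show ?thesis unfolding pi_over_def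
  proof (intro allI impI)
    fix q x assume q: "Factorial_Ring.prime q" "q \<notin> sigma i" and x: "x \<in> H <#> Q" "q_elt q x"
    have xHB: "x \<in> H <#> B" unfolding B_def using q_elt_mem_HM[OF i Q q x] .
    have "\<not> q dvd n" using q m(2) n(2) cB dvd_trans by blast
    then show "x \<in> H" using q_elt_mem_normal[OF nor n(1) q(1) _ xHB x(2)] by blast
  qed
qed

end

context corefree_step
begin

lemma corefree_pi_over:
  assumes "i \<in> I" "Q \<in> PP i"
  shows "pi_over (sigma i) H (H <#> Q)"
proof (cases "\<exists>k\<in>I. pi_over (sigma k) {\<one>} M")
  case True
  then show ?thesis using primary_pi_over assms by blast
next
  case False
  then interpret mixed_step G I sigma PP H M by unfold_locales blast
  show ?thesis using assms by (rule mixed_pi_over)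
qed

end

section \<open>Transfer into a central subgroup\<close>

context fin_group
begin

text \<open>The transfer homomorphism into a central subgroup: for coset representatives \<open>s V\<close>
  one multiplies the elements \<open>s V \<otimes> x \<otimes> inv (s (V #> x))\<close> of \<open>Z\<close> over all
  cosets \<open>V\<close>. On \<open>Z\<close> itself each factor equals the argument.\<close>

lemma central_transfer:
  assumes C: "subgroup C G" and Z: "subgroup Z G" and ZC: "Z \<subseteq> C"
    and central: "\<And>z c. z \<in> Z \<Longrightarrow> c \<in> C \<Longrightarrow> z \<otimes> c = c \<otimes> z"
    and card: "card C = card Z * n"
  obtains tr where "\<And>x. x \<in> C \<Longrightarrow> tr x \<in> Z"
    "\<And>x y. x \<in> C \<Longrightarrow> y \<in> C \<Longrightarrow> tr (x \<otimes> y) = tr x \<otimes> tr y"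
    "\<And>z. z \<in> Z \<Longrightarrow> tr z = z [^] n"
proof -
  have Cc: "C \<subseteq> carrier G" and Zc: "Z \<subseteq> carrier G" using C Z by (auto dest: subgroup.subset)
  interpret Z: group "G\<lparr>carrier := Z\<rparr>"
    using Z by (rule subgroup.subgroup_is_group) (rule is_group)
  interpret Z: comm_group "G\<lparr>carrier := Z\<rparr>"
    by (rule Z.group_comm_groupI) (use central ZC in auto)
  interpret C: group "G\<lparr>carrier := C\<rparr>"
    using C by (rule subgroup.subgroup_is_group) (rule is_group)
  define R where "R = (\<lambda>x. Z #> x) ` C"
  have ZsubC: "subgroup Z (G\<lparr>carrier := C\<rparr>)" using Z C ZC by (rule subgroup_incl)
  have "rcosets\<^bsub>G\<lparr>carrier := C\<rparr>\<^esub> Z = R" by (auto simp: RCOSETS_def R_def r_coset_def)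
  then have "card R * card Z = card C" using C.lagrange[OF ZsubC] by (simp add: order_def)
  then have cR: "card R = n" using card card_subgroup_pos[OF Z] by simp
  have fR: "finite R" using finite_subgroup[OF C] by (simp add: R_def)
  define s where "s V = (SOME x. x \<in> C \<and> V = Z #> x)" for V
  have s: "s V \<in> C" "V = Z #> s V" if "V \<in> R" for V
    using someI_ex[of "\<lambda>x. x \<in> C \<and> V = Z #> x"] that by (auto simp: s_def R_def)
  have act: "(Z #> x) #> g = Z #> (x \<otimes> g)" if "x \<in> C" "g \<in> C" for x g
    using that Cc Zc by (intro coset_mult_assoc) auto
  have actR: "V #> g \<in> R" if "V \<in> R" "g \<in> C" for V g
    using that act C by (auto simp: R_def subgroup.m_closed)
  define f where "f V g = s V \<otimes> g \<otimes> inv (s (V #> g))" for V g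
  have f: "f V g \<in> Z" if V: "V \<in> R" and g: "g \<in> C" for V g
  proof -
    have 1: "s V \<in> C" "s (V #> g) \<in> C" using s V actR[OF V g] by auto
    have "Z #> (s V \<otimes> g) = Z #> s (V #> g)"
      using act[OF 1(1) g] s(2)[OF V] s(2)[OF actR[OF V g]] by simp
    moreover have "s V \<otimes> g \<in> Z #> (s V \<otimes> g)"
      using 1 g Cc Z by (intro rcos_self) auto
    ultimately have "s V \<otimes> g \<in> Z #> s (V #> g)" by simp
    then show ?thesis unfolding f_def
      using subgroup.rcos_module_imp[OF Z is_group, of "s (V #> g)" "s V \<otimes> g"] 1 g Cc by auto
  qed
  have fmul: "f V (g \<otimes> h) = f V g \<otimes> f (V #> g) h" if V: "V \<in> R" and gh: "g \<in> C" "h \<in> C" for V g h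
  proof -
    have "V #> g \<in> R" using V gh(1) by (rule actR)
    moreover from this have "(V #> g) #> h \<in> R" using gh(2) by (rule actR)
    ultimately have c: "s V \<in> carrier G" "s (V #> g) \<in> carrier G" "s ((V #> g) #> h) \<in> carrier G"
      "g \<in> carrier G" "h \<in> carrier G"
      using s V gh Cc by auto
    obtain x where x: "x \<in> C" "V = Z #> x" using V by (auto simp: R_def)
    have "V #> (g \<otimes> h) = (V #> g) #> h"
      using x gh C Cc by (simp add: act subgroup.m_closed m_assoc subset_iff)
    then show ?thesis using c by (simp add: f_def m_assoc)
  qed
  \<comment> \<open>Right multiplication permutes the cosets, so the product over all cosets may
    be reindexed by it.\<close>
  have inj: "inj_on (\<lambda>V. V #> g) R" if g: "g \<in> C" for g
  proof (rule inj_on_inverseI)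
    fix V assume "V \<in> R"
    then obtain x where x: "x \<in> C" "V = Z #> x" by (auto simp: R_def)
    then show "(V #> g) #> inv g = V"
      using g C Cc by (simp add: act subgroup.m_closed subgroup.m_inv_closed m_assoc subset_iff)
  qed
  have img: "(\<lambda>V. V #> g) ` R = R" if g: "g \<in> C" for g
    using fR inj[OF g] actR[OF _ g] by (intro endo_inj_surj) auto
  define tr where "tr g = finprod (G\<lparr>carrier := Z\<rparr>) (\<lambda>V. f V g) R" for g
  show thesis
  proof (rule that[of tr])
    fix x assume x: "x \<in> C"
    have "finprod (G\<lparr>carrier := Z\<rparr>) (\<lambda>V. f V x) R \<in> carrier (G\<lparr>carrier := Z\<rparr>)"
      by (rule Z.finprod_closed) (use f x in auto)
    then show "tr x \<in> Z" by (simp add: tr_def)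
    fix y assume y: "y \<in> C"
    have "tr (x \<otimes> y) = finprod (G\<lparr>carrier := Z\<rparr>) (\<lambda>V. f V x \<otimes>\<^bsub>G\<lparr>carrier := Z\<rparr>\<^esub> f (V #> x) y) R"
      unfolding tr_def by (rule Z.finprod_cong') (use f fmul actR x y Z in \<open>auto simp: subgroup.m_closed\<close>)
    also have "\<dots> = tr x \<otimes> finprod (G\<lparr>carrier := Z\<rparr>) (\<lambda>V. f (V #> x) y) R"
      unfolding tr_def using f actR x y by (subst Z.finprod_multf) auto
    also have "finprod (G\<lparr>carrier := Z\<rparr>) (\<lambda>V. f (V #> x) y) R = tr y"
    proof -
      have "finprod (G\<lparr>carrier := Z\<rparr>) (\<lambda>V. f V y) ((\<lambda>V. V #> x) ` R) =
          finprod (G\<lparr>carrier := Z\<rparr>) (\<lambda>V. f (V #> x) y) R"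
        by (rule Z.finprod_reindex) (use f actR x y inj in auto)
      then show ?thesis using img[OF x] by (simp add: tr_def)
    qed
    finally show "tr (x \<otimes> y) = tr x \<otimes> tr y" .
  next
    fix z assume z: "z \<in> Z"
    have zC: "z \<in> C" using z ZC by blast
    have fz: "f V z = z" if V: "V \<in> R" for V
    proof -
      obtain x where x: "x \<in> C" "V = Z #> x" using V by (auto simp: R_def)
      have "V #> z = Z #> (z \<otimes> x)" using x zC z central by (simp add: act)
      also have "\<dots> = V" using x z Z Zc Cc coset_mult_assoc[of Z z x] coset_join2[of z Z] by auto
      finally have "f V z = s V \<otimes> z \<otimes> inv (s V)" by (simp add: f_def)
      also have "\<dots> = z \<otimes> s V \<otimes> inv (s V)" using central[OF z s(1)[OF V]] by simp
      also have "\<dots> = z" using s(1)[OF V] Cc Zc z by (simp add: m_assoc subset_iff)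
      finally show ?thesis .
    qed
    have "tr z = finprod (G\<lparr>carrier := Z\<rparr>) (\<lambda>V. z) R"
      unfolding tr_def by (rule Z.finprod_cong') (use fz z in auto)
    also have "\<dots> = z [^]\<^bsub>G\<lparr>carrier := Z\<rparr>\<^esub> card R" using z by (intro Z.finprod_const) simp
    also have "\<dots> = z [^] n" by (simp add: cR flip: nat_pow_consistent)
    finally show "tr z = z [^] n" .
  qed
qed

definition pi_radical_free :: "nat set \<Rightarrow> bool" where
  "pi_radical_free ps \<longleftrightarrow> (\<forall>V. normal_in V (carrier G) \<longrightarrow> pi_over ps {\<one>} V \<longrightarrow> V = {\<one>})"

text \<open>The normal \<open>ps\<close>-subgroups of \<open>J\<close> generate a \<open>ps\<close>-group, which is invariant under
  all of \<open>G\<close>.\<close>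

lemma pi_radical_free_normal:
  assumes free: "pi_radical_free ps" and J: "normal_in J (carrier G)"
    and V: "normal_in V J" "pi_over ps {\<one>} V"
  shows "V = {\<one>}"
proof -
  note j = normal_inD[OF J]
  define F where "F = {V. normal_in V J \<and> pi_over ps {\<one>} V}"
  define W where "W = generate G (\<Union>F)"
  have Fc: "\<Union>F \<subseteq> carrier G" using normal_inD(3) j(3) by (auto simp: F_def)
  have "pi_over ps {\<one>} W" unfolding W_def using j(1) by (rule pi_over_generate_normal) (simp add: F_def)
  moreover have "normal_in W (carrier G)" unfolding W_def
  proof (rule normal_in_generate[OF Fc subgroup_self])
    fix x s assume x: "x \<in> carrier G" and "s \<in> \<Union>F"
    then obtain U where U: "normal_in U J" "pi_over ps {\<one>} U" "s \<in> U" by (auto simp: F_def)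
    have Uc: "U \<subseteq> carrier G" using normal_inD(1)[OF U(1)] by (rule subgroup.subset)
    have "normal_in (conj_set G U x) J"
      using U(1) x normal_in_conj_set[OF J x] by (rule conj_set_normal_in)
    moreover have "pi_over ps {\<one>} (conj_set G U x)"
      using conj_set_subgroup[OF normal_inD(1)[OF U(1)] x] inv_closed[OF x]
      by (rule pi_over_conj_set) (simp add: conj_set_inverse(1)[OF Uc x] U(2))
    ultimately show "inv x \<otimes> s \<otimes> x \<in> \<Union>F" using conj_set_memI[OF U(3), of x] by (auto simp: F_def)
  qed
  ultimately have "W = {\<one>}" using free by (simp add: pi_radical_free_def)
  moreover have "V \<subseteq> W" using V by (auto simp: W_def F_def intro: generate.incl)
  ultimately show ?thesis using subgroup.one_closed[OF normal_inD(1)[OF V(1)]] by blast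
qed

text \<open>Since \<open>D \<inter> Y\<close> is a normal \<open>ps\<close>-subgroup of \<open>Y\<close>, it is trivial, so \<open>D\<close> lies
  in the centraliser \<open>C\<close> of \<open>Y\<close>. The subgroup \<open>Z = C \<inter> Y\<close> is central in \<open>C\<close> and contains
  no elements of \<open>q\<close>-power order for \<open>q\<close> in \<open>ps\<close>, whereas the index of \<open>Z\<close> in \<open>C\<close> is a product
  of primes from \<open>ps\<close>. The transfer from \<open>C\<close> to \<open>Z\<close> is therefore trivial on elements of such
  \<open>q\<close>-power order and injective on \<open>Z\<close>. So these elements of \<open>C\<close> generate a subgroup meeting \<open>Z\<close>
  trivially, a normal \<open>ps\<close>-subgroup of \<open>G\<close> containing \<open>D\<close>.\<close>

lemma normalized_pi_subgroup_trivial: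
  assumes free: "pi_radical_free ps" and Y: "normal_in Y (carrier G)" "pi_over ps Y (carrier G)"
    and D: "subgroup D G" "pi_over ps {\<one>} D"
    and nor: "\<And>y d. y \<in> Y \<Longrightarrow> d \<in> D \<Longrightarrow> inv y \<otimes> d \<otimes> y \<in> D"
  shows "D = {\<one>}"
proof -
  note y = normal_inD[OF Y(1)]
  have Dc: "D \<subseteq> carrier G" using D(1) by (rule subgroup.subset)
  have DY: "D \<inter> Y = {\<one>}"
  proof (rule pi_radical_free_normal[OF free Y(1)])
    show "normal_in (D \<inter> Y) Y"
      using nor y(1) by (intro normal_inI subgroups_Inter_pair D y)
        (auto simp: subgroup.m_closed subgroup.m_inv_closed)
    show "pi_over ps {\<one>} (D \<inter> Y)" using D(2) by (rule pi_over_mono) auto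
  qed
  define C where "C = {x \<in> carrier G. \<forall>s\<in>Y. x \<otimes> s = s \<otimes> x}"
  have Cn: "normal_in C (carrier G)" unfolding C_def using Y(1) by (rule normal_in_centralizer)
  then have C: "subgroup C G" by (rule normal_inD(1))
  have DC: "D \<subseteq> C"
  proof
    fix d assume d: "d \<in> D"
    have "d \<otimes> s = s \<otimes> d" if "s \<in> Y" for s
      by (rule trivial_Int_commute[OF D(1) y(1) DY _ _ d that]) (use nor y Dc in auto)
    then show "d \<in> C" using d Dc by (auto simp: C_def)
  qed
  define Z where "Z = C \<inter> Y"
  have Z: "subgroup Z G" unfolding Z_def using C y(1) by (rule subgroups_Inter_pair)
  have Zn: "normal_in Z (carrier G)" unfolding Z_def using Cn Y(1) by (rule normal_in_Int2)
  have central: "z \<otimes> c = c \<otimes> z" if "z \<in> Z" "c \<in> C" for z c using that by (auto simp: Z_def C_def)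
  have Zfree: "z = \<one>" if q: "Factorial_Ring.prime q" "q \<in> ps" and z: "z \<in> Z" "q_elt q z" for q z
  proof -
    have zc: "z \<in> carrier G" using z(2) by (rule q_elt_closed)
    define V where "V = generate G {z}"
    have V: "subgroup V G" unfolding V_def using zc by (intro generate_is_subgroup) auto
    have VZ: "V \<subseteq> Z" unfolding V_def using z(1) Z by (intro generate_subgroup_incl) auto
    have nVZ: "normal_in V Z"
      proof (rule normal_inI[OF V Z VZ])
        fix x v assume x: "x \<in> Z" and v: "v \<in> V"
        have "x \<in> carrier G" "v \<in> carrier G" using x v Z V by (auto dest: subgroup.mem_carrier)
        moreover have "v \<otimes> x = x \<otimes> v" using central[of v x] v VZ x by (auto simp: Z_def)
        ultimately have "inv x \<otimes> v \<otimes> x = v" by (simp add: m_assoc)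
        then show "inv x \<otimes> v \<otimes> x \<in> V" using v by simp
      qed
    have piV: "pi_over ps {\<one>} V"
        unfolding pi_over_Cauchy[OF V] using card_generate_q_elt[OF z(2) q(1)] q(2) by (auto simp: V_def)
    have "V = {\<one>}" using free Zn nVZ piV by (rule pi_radical_free_normal)
    moreover have "z \<in> V" by (simp add: V_def generate.incl)
    ultimately show ?thesis by simp
  qed
  have ZC: "Z \<subseteq> C" by (auto simp: Z_def)
  obtain n where n: "card C = card Z * n" using card_subgroup_dvd[OF Z C ZC] by (elim dvdE)
  have overZ: "pi_over ps Z C"
    using Y(2) C unfolding pi_over_def by (auto simp: Z_def dest: subgroup.mem_carrier)
  have n_pi: "q \<in> ps" if "Factorial_Ring.prime q" "q dvd n" for q
    using pi_over_index[OF Z C ZC overZ that(1) _ n] that(2) by blast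
  have cop: "coprime n (card Z)"
  proof (rule coprime_if_no_common_prime)
    fix r assume r: "Factorial_Ring.prime r" "r dvd n" "r dvd card Z"
    have "\<not> r dvd card Z"
    proof (rule index_coprime_if_q_elts[OF triv_subgroup Z _ r(1)])
      show "{\<one>} \<subseteq> Z" using subgroup.one_closed[OF Z] by simp
      show "x \<in> {\<one>}" if "x \<in> Z" "q_elt r x" for x using Zfree[OF r(1) n_pi[OF r(1,2)] that] by simp
    qed simp
    then show False using r(3) by simp
  qed
  obtain tr where tr: "\<And>x. x \<in> C \<Longrightarrow> tr x \<in> Z"
    "\<And>x y. x \<in> C \<Longrightarrow> y \<in> C \<Longrightarrow> tr (x \<otimes> y) = tr x \<otimes> tr y" "\<And>z. z \<in> Z \<Longrightarrow> tr z = z [^] n"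
    using central_transfer[OF C Z ZC central n] by blast
  have tr1: "tr \<one> = \<one>" using tr(3)[OF subgroup.one_closed[OF Z]] by simp
  have trpow: "tr (x [^] k) = tr x [^] k" if "x \<in> C" for x and k :: nat
    using tr1 tr(2) subgroup_nat_pow[OF C that] that by (induction k) auto
  define K where "K = {x \<in> C. tr x = \<one>}"
  have Cc: "x \<in> carrier G" if "x \<in> C" for x using C that by (rule subgroup.mem_carrier)
  have Zc: "x \<in> carrier G" if "x \<in> Z" for x using Z that by (rule subgroup.mem_carrier)
  have K: "subgroup K G"
  proof (rule subgroupI)
    show "K \<subseteq> carrier G" using Cc by (auto simp: K_def)
    show "K \<noteq> {}" using tr1 subgroup.one_closed[OF C] by (auto simp: K_def)
  next
    fix a assume a: "a \<in> K"
    then have aC: "a \<in> C" "inv a \<in> C" using C by (auto simp: K_def subgroup.m_inv_closed)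
    have "tr (a \<otimes> inv a) = tr a \<otimes> tr (inv a)" using aC by (rule tr(2))
    moreover have "tr a = \<one>" using a by (simp add: K_def)
    moreover have "a \<otimes> inv a = \<one>" using Cc[OF aC(1)] by simp
    ultimately have "tr (inv a) = \<one>" using tr1 l_one[OF Zc[OF tr(1)[OF aC(2)]]] by metis
    then show "inv a \<in> K" using aC by (simp add: K_def)
  next
    fix a b assume "a \<in> K" "b \<in> K"
    then show "a \<otimes> b \<in> K" using tr(2) C by (simp add: K_def subgroup.m_closed)
  qed
  define U0 where "U0 = {x \<in> C. \<exists>q. Factorial_Ring.prime q \<and> q \<in> ps \<and> q_elt q x}"
  define U where "U = generate G U0"
  have U0K: "U0 \<subseteq> K"
  proof
    fix x assume "x \<in> U0"
    then obtain q where q: "x \<in> C" "Factorial_Ring.prime q" "q \<in> ps" "q_elt q x" by (auto simp: U0_def)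
    then obtain k :: nat where "x [^] (q ^ k) = \<one>" by (auto simp: q_elt_def)
    then have "tr x [^] (q ^ k) = \<one>" using trpow[OF q(1)] tr1 by metis
    then have "q_elt q (tr x)" using Zc tr(1)[OF q(1)] by (auto simp: q_elt_def)
    then have "tr x = \<one>" using Zfree q tr(1) by blast
    then show "x \<in> K" using q(1) by (simp add: K_def)
  qed
  then have UK: "U \<subseteq> K" unfolding U_def using K by (rule generate_subgroup_incl)
  have U: "normal_in U (carrier G)" unfolding U_def
  proof (rule normal_in_generate[OF _ subgroup_self])
    show "U0 \<subseteq> carrier G" using Cc by (auto simp: U0_def)
    fix x s assume "x \<in> carrier G" "s \<in> U0"
    then show "inv x \<otimes> s \<otimes> x \<in> U0" using normal_inD(4)[OF Cn] q_elt_conj by (auto simp: U0_def)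
  qed
  have "pi_over ps {\<one>} U" unfolding pi_over_def
  proof (intro allI impI)
    fix q x assume q: "Factorial_Ring.prime q" "q \<notin> ps" and x: "x \<in> U" "q_elt q x"
    have xC: "x \<in> C" "tr x = \<one>" using x UK by (auto simp: K_def)
    have xZ: "x \<in> Z" using pi_overD[OF overZ q xC(1) x(2)] .
    have 1: "x [^] n \<in> {\<one>}" using tr(3)[OF xZ] xC by simp
    have 2: "x [^] card Z \<in> {\<one>}" by (rule index_pow_mem[OF normal_in_one[OF Z] _ xZ]) simp
    show "x \<in> {\<one>}" using coprime_powers_mem[OF triv_subgroup Cc[OF xC(1)] 1 2 cop] .
  qed
  then have U1: "U = {\<one>}" using free U by (simp add: pi_radical_free_def)
  have "{\<one>} = D"
  proof (rule all_q_elts_imp_eq[OF triv_subgroup D(1)])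
    show "{\<one>} \<subseteq> D" using subgroup.one_closed[OF D(1)] by simp
    fix q x assume q: "Factorial_Ring.prime q" and x: "x \<in> D" "q_elt q x"
    show "x \<in> {\<one>}"
    proof (cases "q \<in> ps")
      case True
      then have "x \<in> U" unfolding U_def using q x DC by (auto intro!: generate.incl simp: U0_def)
      then show ?thesis using U1 by simp
    next
      case False then show ?thesis using pi_overD[OF D(2) q _ x] by blast
    qed
  qed
  then show ?thesis by simp
qed

end

section \<open>Quotients\<close>

text \<open>Subgroups, normality, conjugation and residuals are transported along the
  projection onto the quotient by \<open>K\<close> and back along preimages.\<close>

locale fin_quotient = fin_group +
  fixes K :: "'a set"
  assumes K: "normal_in K (carrier G)"
begin

abbreviation quo where "quo \<equiv> G Mod K"
definition proj :: "'a \<Rightarrow> 'a set" where "proj x = K #> x"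
definition pre :: "'a set set \<Rightarrow> 'a set" where "pre B = {x \<in> carrier G. proj x \<in> B}"

lemma K_normal: "K \<lhd> G"
  using K by (simp add: normal_in_carrier_iff)

lemmas K_facts = normal_inD[OF K]

sublocale q: group quo
  using K_normal by (rule normal.factorgroup_is_group)

lemma carrier_quo: "carrier quo = proj ` carrier G"
  by (auto simp: carrier_FactGroup proj_def)

sublocale q: fin_group quo
  by unfold_locales (simp add: carrier_quo fin)

sublocale hom: group_hom G quo proj
proof
  have "(\<lambda>x. K #> x) \<in> hom G quo" using normal.r_coset_hom_Mod[OF K_normal] .
  then show "proj \<in> hom G quo" by (simp add: proj_def[abs_def])
qed

lemma proj_eq_one_iff: "x \<in> carrier G \<Longrightarrow> proj x = \<one>\<^bsub>quo\<^esub> \<longleftrightarrow> x \<in> K"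
  using coset_join1[of K x] coset_join2[of x K] K_facts by (auto simp: proj_def)

lemma proj_eq_iff:
  assumes "x \<in> carrier G" "y \<in> carrier G"
  shows "proj x = proj y \<longleftrightarrow> x \<otimes> inv y \<in> K"
proof -
  have "proj (x \<otimes> inv y) = proj x \<otimes>\<^bsub>quo\<^esub> inv\<^bsub>quo\<^esub> proj y" using assms by simp
  moreover have "proj x \<otimes>\<^bsub>quo\<^esub> inv\<^bsub>quo\<^esub> proj y = \<one>\<^bsub>quo\<^esub> \<longleftrightarrow> proj x = proj y"
    using assms by (metis hom.hom_closed q.inv_closed q.inv_inv q.inv_equality q.r_inv)
  ultimately show ?thesis using proj_eq_one_iff[of "x \<otimes> inv y"] assms by auto
qed

lemma proj_pow: "x \<in> carrier G \<Longrightarrow> proj (x [^] (n::nat)) = proj x [^]\<^bsub>quo\<^esub> n"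
  by (rule hom.hom_nat_pow)

lemma image_subgroup: "subgroup A G \<Longrightarrow> subgroup (proj ` A) quo"
  by (rule hom.subgroup_img_is_subgroup)

lemma pre_subgroup:
  assumes B: "subgroup B quo"
  shows "subgroup (pre B) G"
proof (rule subgroupI)
  show "pre B \<subseteq> carrier G" by (auto simp: pre_def)
  have "\<one> \<in> pre B" using subgroup.one_closed[OF B] unfolding pre_def using hom.hom_one by simp
  then show "pre B \<noteq> {}" by blast
next
  fix a assume "a \<in> pre B"
  then have a: "a \<in> carrier G" "proj a \<in> B" by (auto simp: pre_def)
  then show "inv a \<in> pre B" using subgroup.m_inv_closed[OF B a(2)] by (simp add: pre_def)
next
  fix a b assume "a \<in> pre B" "b \<in> pre B"
  then have a: "a \<in> carrier G" "proj a \<in> B" and b: "b \<in> carrier G" "proj b \<in> B" by (auto simp: pre_def)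
  have "proj (a \<otimes> b) \<in> B" unfolding hom.hom_mult[OF a(1) b(1)] using B a(2) b(2) by (rule subgroup.m_closed)
  then show "a \<otimes> b \<in> pre B" using a b by (simp add: pre_def)
qed

lemma image_pre: "B \<subseteq> carrier quo \<Longrightarrow> proj ` pre B = B"
  by (auto simp: pre_def carrier_quo)

lemma pre_image:
  assumes A: "subgroup A G" and KA: "K \<subseteq> A"
  shows "pre (proj ` A) = A"
proof
  show "A \<subseteq> pre (proj ` A)" using subgroup.mem_carrier[OF A] by (auto simp: pre_def)
  show "pre (proj ` A) \<subseteq> A"
  proof
    fix x assume "x \<in> pre (proj ` A)"
    then obtain a where a: "x \<in> carrier G" "a \<in> A" "proj x = proj a" by (auto simp: pre_def)
    have ac: "a \<in> carrier G" using A a(2) by (rule subgroup.mem_carrier)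
    have "x \<otimes> inv a \<in> A" using a proj_eq_iff[OF a(1) ac] KA by auto
    then have "x \<otimes> inv a \<otimes> a \<in> A" using A a(2) by (simp add: subgroup.m_closed)
    then show "x \<in> A" using a(1) ac by (simp add: m_assoc)
  qed
qed

lemma pre_mono: "B \<subseteq> C \<Longrightarrow> pre B \<subseteq> pre C"
  by (auto simp: pre_def)

lemma image_set_mult:
  assumes "A \<subseteq> carrier G" "B \<subseteq> carrier G"
  shows "proj ` (A <#> B) = (proj ` A) <#>\<^bsub>quo\<^esub> (proj ` B)"
proof -
  have "proj (a \<otimes> b) = proj a \<otimes>\<^bsub>quo\<^esub> proj b" if "a \<in> A" "b \<in> B" for a b
    using assms that by (intro hom.hom_mult) auto
  then show ?thesis unfolding set_mult_def image_UN by simp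
qed

lemma image_conj_set:
  assumes "A \<subseteq> carrier G" "x \<in> carrier G"
  shows "proj ` conj_set G A x = conj_set quo (proj ` A) (proj x)"
  unfolding conj_set_def image_image
  by (rule image_cong) (use assms in \<open>auto simp: subset_iff simp del: mult_FactGroup\<close>)

lemma image_normal_in:
  assumes "normal_in A J"
  shows "q.normal_in (proj ` A) (proj ` J)"
proof -
  note a = normal_inD[OF assms]
  show ?thesis
  proof (rule q.normal_inI[OF image_subgroup[OF a(1)] image_subgroup[OF a(2)]])
    show "proj ` A \<subseteq> proj ` J" using a(3) by blast
    fix x n assume "x \<in> proj ` J" "n \<in> proj ` A"
    then obtain y m where ym: "y \<in> J" "m \<in> A" "x = proj y" "n = proj m" by auto
    have c: "y \<in> carrier G" "m \<in> carrier G" using ym a(1,2) by (auto dest: subgroup.mem_carrier)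
    have "inv\<^bsub>quo\<^esub> x \<otimes>\<^bsub>quo\<^esub> n \<otimes>\<^bsub>quo\<^esub> x = proj (inv y \<otimes> m \<otimes> y)"
      using c ym by (simp del: mult_FactGroup)
    then show "inv\<^bsub>quo\<^esub> x \<otimes>\<^bsub>quo\<^esub> n \<otimes>\<^bsub>quo\<^esub> x \<in> proj ` A" using a(4)[OF ym(1,2)] by blast
  qed
qed

lemma image_normal_in_carrier: "normal_in A (carrier G) \<Longrightarrow> q.normal_in (proj ` A) (carrier quo)"
  using image_normal_in carrier_quo by metis

lemma pre_normal_in:
  assumes "q.normal_in B (carrier quo)"
  shows "normal_in (pre B) (carrier G)"
proof -
  note b = q.normal_inD[OF assms]
  show ?thesis
  proof (rule normal_inI[OF pre_subgroup[OF b(1)] subgroup_self])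
    show "pre B \<subseteq> carrier G" by (auto simp: pre_def)
    fix x n assume x: "x \<in> carrier G" and n: "n \<in> pre B"
    have nc: "n \<in> carrier G" "proj n \<in> B" using n by (auto simp: pre_def)
    have "proj (inv x \<otimes> n \<otimes> x) = inv\<^bsub>quo\<^esub> proj x \<otimes>\<^bsub>quo\<^esub> proj n \<otimes>\<^bsub>quo\<^esub> proj x"
      using x nc by (simp del: mult_FactGroup)
    then show "inv x \<otimes> n \<otimes> x \<in> pre B"
      using b(4)[OF hom.hom_closed[OF x] nc(2)] x nc by (simp add: pre_def del: mult_FactGroup)
  qed
qed

lemma image_q_elt: "q_elt p x \<Longrightarrow> q.q_elt p (proj x)"
  unfolding q_elt_def q.q_elt_def using proj_pow hom.hom_closed hom.hom_one by metis

text \<open>An element of prime power order in the quotient is the image of one that is a power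
  of any given preimage.\<close>

lemma image_pi_over:
  assumes J: "subgroup J G" and over: "pi_over ps N J"
  shows "q.pi_over ps (proj ` N) (proj ` J)"
  unfolding q.pi_over_def
proof (intro allI impI)
  fix p w assume p: "Factorial_Ring.prime p" "p \<notin> ps" and w: "w \<in> proj ` J" "q.q_elt p w"
  obtain x where x: "x \<in> J" "w = proj x" using w by auto
  have xc: "x \<in> carrier G" using J x(1) by (rule subgroup.mem_carrier)
  obtain k :: nat where "w [^]\<^bsub>quo\<^esub> (p ^ k) = \<one>\<^bsub>quo\<^esub>" using w(2) unfolding q.q_elt_def by blast
  then have "x [^] (p ^ k) \<in> K" using proj_eq_one_iff[of "x [^] (p ^ k)"] proj_pow[OF xc] x(2) xc by simp
  then obtain y n where y: "q_elt p y" "y = x [^] (n::int)" "y \<otimes> inv x \<in> K"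
    using q_elt_representative[OF K_facts(1) xc p(1)] by blast
  have yJ: "y \<in> J" using subgroup_int_pow_closed[OF J x(1)] y(2) by simp
  have "proj y = proj x" using proj_eq_iff[OF q_elt_closed[OF y(1)] xc] y(3) by simp
  then show "w \<in> proj ` N" using pi_overD[OF over p yJ y(1)] x(2) by (metis imageI)
qed

lemma pre_pi_over: "q.pi_over ps B C \<Longrightarrow> pi_over ps (pre B) (pre C)"
  unfolding pi_over_def q.pi_over_def pre_def using image_q_elt by (auto dest: q_elt_closed)

end

section \<open>Subgroups normalised by a residual\<close>

context fin_group
begin

text \<open>Divide by the largest normal \<open>ps\<close>-subgroup and apply
  \<open>normalized_pi_subgroup_trivial\<close>.\<close>

lemma normalized_pi_subgroup:
  assumes Y: "normal_in Y (carrier G)" "pi_over ps Y (carrier G)"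
    and D: "subgroup D G" "pi_over ps {\<one>} D"
    and nor: "\<And>y d. y \<in> Y \<Longrightarrow> d \<in> D \<Longrightarrow> inv y \<otimes> d \<otimes> y \<in> D"
  obtains U where "normal_in U (carrier G)" "pi_over ps {\<one>} U" "D \<subseteq> U"
proof -
  define F where "F = {V. normal_in V (carrier G) \<and> pi_over ps {\<one>} V}"
  define U where "U = generate G (\<Union>F)"
  have Fc: "\<Union>F \<subseteq> carrier G" using normal_inD(3) by (auto simp: F_def)
  have Upi: "pi_over ps {\<one>} U" unfolding U_def using subgroup_self
    by (rule pi_over_generate_normal) (simp add: F_def)
  have U: "normal_in U (carrier G)" unfolding U_def
  proof (rule normal_in_generate[OF Fc subgroup_self])
    show "inv x \<otimes> s \<otimes> x \<in> \<Union>F" if "x \<in> carrier G" "s \<in> \<Union>F" for x s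
      using that normal_inD(4) unfolding F_def by blast
  qed
  interpret Q: fin_quotient G U by unfold_locales (rule U)
  have free: "Q.q.pi_radical_free ps" unfolding Q.q.pi_radical_free_def
  proof (intro allI impI)
    fix V assume V: "Q.q.normal_in V (carrier Q.quo)" "Q.q.pi_over ps {\<one>\<^bsub>Q.quo\<^esub>} V"
    have P: "normal_in (Q.pre V) (carrier G)" using V(1) by (rule Q.pre_normal_in)
    have "pi_over ps (Q.pre {\<one>\<^bsub>Q.quo\<^esub>}) (Q.pre V)" using V(2) by (rule Q.pre_pi_over)
    moreover have "Q.pre {\<one>\<^bsub>Q.quo\<^esub>} \<subseteq> U" using Q.proj_eq_one_iff by (auto simp: Q.pre_def)
    ultimately have "pi_over ps {\<one>} (Q.pre V)"
      using Upi unfolding pi_over_def by blast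
    then have "Q.pre V \<subseteq> U" using P by (auto simp: U_def F_def intro: generate.incl)
    then have "Q.proj ` Q.pre V \<subseteq> {\<one>\<^bsub>Q.quo\<^esub>}"
      using Q.proj_eq_one_iff by (auto simp: Q.pre_def simp del: one_FactGroup)
    then have "V \<subseteq> {\<one>\<^bsub>Q.quo\<^esub>}" using Q.image_pre[of V] Q.q.normal_inD(3)[OF V(1)] by simp
    then show "V = {\<one>\<^bsub>Q.quo\<^esub>}" using subgroup.one_closed[OF Q.q.normal_inD(1)[OF V(1)]] by blast
  qed
  have 1: "Q.q.normal_in (Q.proj ` Y) (carrier Q.quo)" using Y(1) by (rule Q.image_normal_in_carrier)
  have 2: "Q.q.pi_over ps (Q.proj ` Y) (carrier Q.quo)"
    unfolding Q.carrier_quo using subgroup_self Y(2) by (rule Q.image_pi_over)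
  have 3: "subgroup (Q.proj ` D) Q.quo" using D(1) by (rule Q.image_subgroup)
  have "Q.q.pi_over ps (Q.proj ` {\<one>}) (Q.proj ` D)" using D by (rule Q.image_pi_over)
  then have 4: "Q.q.pi_over ps {\<one>\<^bsub>Q.quo\<^esub>} (Q.proj ` D)" by (simp del: one_FactGroup)
  have 5: "inv\<^bsub>Q.quo\<^esub> y \<otimes>\<^bsub>Q.quo\<^esub> d \<otimes>\<^bsub>Q.quo\<^esub> y \<in> Q.proj ` D"
    if yd: "y \<in> Q.proj ` Y" "d \<in> Q.proj ` D" for y d
  proof -
    obtain z e where z: "z \<in> Y" "e \<in> D" "y = Q.proj z" "d = Q.proj e" using yd by blast
    have c: "z \<in> carrier G" "e \<in> carrier G"
      using z normal_inD(1)[OF Y(1)] D(1) by (simp_all add: subgroup.mem_carrier)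
    have "inv\<^bsub>Q.quo\<^esub> y \<otimes>\<^bsub>Q.quo\<^esub> d \<otimes>\<^bsub>Q.quo\<^esub> y = Q.proj (inv z \<otimes> e \<otimes> z)"
      unfolding z(3,4) using c by (simp del: mult_FactGroup)
    then show ?thesis using nor[OF z(1,2)] by blast
  qed
  have "Q.proj ` D = {\<one>\<^bsub>Q.quo\<^esub>}"
    using free 1 2 3 4 5 by (rule Q.q.normalized_pi_subgroup_trivial)
  have "D \<subseteq> U"
  proof
    fix x assume x: "x \<in> D"
    then have "Q.proj x = \<one>\<^bsub>Q.quo\<^esub>" using \<open>Q.proj ` D = {\<one>\<^bsub>Q.quo\<^esub>}\<close> by blast
    then show "x \<in> U" using Q.proj_eq_one_iff[OF subgroup.mem_carrier[OF D(1) x]] by simp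
  qed
  then show thesis using U Upi by (intro that)
qed

end

section \<open>Core-free permutable subgroups\<close>

context projector_system
begin

text \<open>Let \<open>D\<close> be generated by the elements of \<open>H\<close> whose order is a power of a prime in
  \<open>sigma i\<close>, and \<open>E\<close> by those for the other primes. Projectors for the classes other than \<open>i\<close>
  normalise \<open>D\<close>, those for \<open>i\<close> normalise \<open>E\<close>. Every element of \<open>G\<close> is a product \<open>a \<otimes> b\<close>
  with \<open>a\<close> in the closure \<open>Y\<close> of the former and \<open>b\<close> in that of the latter. An element of \<open>D\<close> of
  prime power order for a prime outside \<open>sigma i\<close> is conjugated by \<open>a\<close> into \<open>D \<inter> E\<close> and
  then by \<open>b\<close> into \<open>E\<close>, so it stays in \<open>H\<close>. The core being trivial, \<open>D\<close> is a \<open>sigma i\<close>-group,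
  and \<open>normalized_pi_subgroup\<close> applies to \<open>D\<close> and \<open>Y\<close>.\<close>

lemma corefree_pi_part:
  assumes H: "permutable H"
    and corefree: "\<And>N. normal_in N (carrier G) \<Longrightarrow> N \<subseteq> H \<Longrightarrow> N = {\<one>}"
    and over: "\<And>i Q. i \<in> I \<Longrightarrow> Q \<in> PP i \<Longrightarrow> pi_over (sigma i) H (H <#> Q)"
    and i: "i \<in> I"
  obtains U where "normal_in U (carrier G)" "pi_over (sigma i) {\<one>} U"
    "\<And>q x. Factorial_Ring.prime q \<Longrightarrow> q \<in> sigma i \<Longrightarrow> x \<in> H \<Longrightarrow> q_elt q x \<Longrightarrow> x \<in> U"
proof -
  note Hs = permutable_subgroup[OF H]
  have Hc: "x \<in> carrier G" if "x \<in> H" for x using Hs that by (rule subgroup.mem_carrier)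
  have conjQ: "inv p \<otimes> x \<otimes> p \<in> H"
    if jQ: "j \<in> I" "Q \<in> PP j" and p: "p \<in> Q" and r: "Factorial_Ring.prime r" "r \<notin> sigma j"
      and x: "x \<in> H" "q_elt r x" for j Q p r x
  proof -
    note P = permutable_product[OF H jQ]
    have pc: "p \<in> carrier G" using PP_subgroup[OF jQ] p by (rule subgroup.mem_carrier)
    have "inv p \<otimes> x \<otimes> p \<in> H <#> Q"
      using x(1) p P by (auto intro!: subgroup.m_closed subgroup.m_inv_closed)
    then show ?thesis using pi_overD[OF over[OF jQ] r] q_elt_conj[OF x(2) pc] by blast
  qed
  define E0 where "E0 = {x \<in> H. \<exists>r. Factorial_Ring.prime r \<and> r \<notin> sigma i \<and> q_elt r x}"
  define E where "E = generate G E0"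
  define D0 where "D0 = {x \<in> H. \<exists>q. Factorial_Ring.prime q \<and> q \<in> sigma i \<and> q_elt q x}"
  define D where "D = generate G D0"
  have sub: "E0 \<subseteq> carrier G" "D0 \<subseteq> carrier G" using Hc by (auto simp: E0_def D0_def)
  have "E0 \<subseteq> H" by (auto simp: E0_def)
  then have E: "subgroup E G" "E \<subseteq> H" unfolding E_def
    using generate_is_subgroup[OF sub(1)] generate_subgroup_incl[OF _ Hs] by auto
  have "D0 \<subseteq> H" by (auto simp: D0_def)
  then have D: "subgroup D G" "D \<subseteq> H" unfolding D_def
    using generate_is_subgroup[OF sub(2)] generate_subgroup_incl[OF _ Hs] by auto
  define NE where "NE = {x \<in> carrier G. \<forall>c\<in>E. inv x \<otimes> c \<otimes> x \<in> E}"
  define ND where "ND = {x \<in> carrier G. \<forall>c\<in>D. inv x \<otimes> c \<otimes> x \<in> D}"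
  have NE: "subgroup NE G" unfolding NE_def using E(1) by (rule normalizer_subgroup)
  have ND: "subgroup ND G" unfolding ND_def using D(1) by (rule normalizer_subgroup)
  have PiNE: "proj_closure i \<subseteq> NE" unfolding proj_closure_def
  proof (rule generate_subgroup_incl[OF _ NE], rule subsetI)
    fix p assume "p \<in> \<Union>(PP i)"
    then obtain Q where Q: "Q \<in> PP i" "p \<in> Q" by blast
    have pc: "p \<in> carrier G" using PP_subgroup[OF i Q(1)] Q(2) by (rule subgroup.mem_carrier)
    have "inv p \<otimes> s \<otimes> p \<in> E" if "s \<in> E" for s
    proof (rule conj_generate_closed[OF sub(1) pc E(1) _ that[unfolded E_def]])
      fix s assume "s \<in> E0"
      then obtain r where r: "s \<in> H" "Factorial_Ring.prime r" "r \<notin> sigma i" "q_elt r s" by (auto simp: E0_def)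
      have "inv p \<otimes> s \<otimes> p \<in> E0"
        using conjQ[OF i Q r(2,3,1,4)] q_elt_conj[OF r(4) pc] r(2,3) by (auto simp: E0_def)
      then show "inv p \<otimes> s \<otimes> p \<in> E" by (simp add: E_def generate.incl)
    qed
    then show "p \<in> NE" using pc by (simp add: NE_def)
  qed
  define S where "S = (\<Union>j\<in>I - {i}. \<Union>(PP j))"
  define Y where "Y = generate G S"
  have Sc: "S \<subseteq> carrier G" using PP_Union_carrier by (auto simp: S_def)
  have Y: "normal_in Y (carrier G)" unfolding Y_def
  proof (rule normal_in_generate[OF Sc subgroup_self])
    fix x s assume x: "x \<in> carrier G" and "s \<in> S"
    then obtain j where j: "j \<in> I - {i}" "s \<in> \<Union>(PP j)" unfolding S_def by blast
    have "inv x \<otimes> s \<otimes> x \<in> \<Union>(PP j)" using j x by (intro PP_Union_conj) auto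
    then show "inv x \<otimes> s \<otimes> x \<in> S" unfolding S_def using j(1) by blast
  qed
  note y = normal_inD[OF Y]
  have closure_Y: "proj_closure j \<subseteq> Y" if "j \<in> I" "j \<noteq> i" for j
    unfolding proj_closure_def Y_def using that Sc
    by (intro mono_generate) (auto simp: S_def)
  have Ypi: "pi_over (sigma i) Y (carrier G)" unfolding pi_over_def
  proof (intro allI impI)
    fix q x assume q: "Factorial_Ring.prime q" "q \<notin> sigma i" and x: "q_elt q x"
    obtain j where j: "j \<in> I" "q \<in> sigma j" using prime_class[OF q(1)] by blast
    then have "x \<in> proj_closure j" using q(1) x by (intro q_elt_mem_proj_closure)
    moreover have "j \<noteq> i" using j q(2) by blast
    ultimately show "x \<in> Y" using closure_Y[OF j(1)] by blast
  qed
  have YND: "Y \<subseteq> ND" unfolding Y_def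
  proof (rule generate_subgroup_incl[OF _ ND], rule subsetI)
    fix p assume "p \<in> S"
    then obtain j Q where j: "j \<in> I" "j \<noteq> i" and Q: "Q \<in> PP j" "p \<in> Q" by (auto simp: S_def)
    have pc: "p \<in> carrier G" using PP_subgroup[OF j(1) Q(1)] Q(2) by (rule subgroup.mem_carrier)
    have "inv p \<otimes> s \<otimes> p \<in> D" if "s \<in> D" for s
    proof (rule conj_generate_closed[OF sub(2) pc D(1) _ that[unfolded D_def]])
      fix s assume "s \<in> D0"
      then obtain r where r: "s \<in> H" "Factorial_Ring.prime r" "r \<in> sigma i" "q_elt r s" by (auto simp: D0_def)
      have rj: "r \<notin> sigma j" using r(3) prime_class_unique[OF j(1) i] j(2) by blast
      have "inv p \<otimes> s \<otimes> p \<in> D0"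
        using conjQ[OF j(1) Q r(2) rj r(1,4)] q_elt_conj[OF r(4) pc] r(2,3) by (auto simp: D0_def)
      then show "inv p \<otimes> s \<otimes> p \<in> D" by (simp add: D_def generate.incl)
    qed
    then show "p \<in> ND" using pc by (simp add: ND_def)
  qed
  \<comment> \<open>Together the projectors for all classes generate \<open>G\<close>.\<close>
  have factor: "Y <#> proj_closure i = carrier G"
  proof (rule carrier_generated)
    note p = normal_inD[OF proj_closure_normal[OF i]]
    have "Y <#> proj_closure i = proj_closure i <#> Y"
      using y(1) p(1) by (rule normalized_permute) (use p y(3) in auto)
    then show "subgroup (Y <#> proj_closure i) G" using y(1) p(1) by (intro permuting_subgroup)
    fix j Q assume j: "j \<in> I" and Q: "Q \<in> PP j"
    have "Q \<subseteq> proj_closure j" using Q by (rule PP_subset_proj_closure)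
    then show "Q \<subseteq> Y <#> proj_closure i"
      using subgroup_set_mult_subsets[OF y(1) p(1)] closure_Y[OF j] by (cases "j = i") auto
  qed
  have Dpi: "pi_over (sigma i) {\<one>} D"
  proof -
    define R where "R = {x \<in> D. \<exists>r. Factorial_Ring.prime r \<and> r \<notin> sigma i \<and> q_elt r x}"
    define W where "W = generate G (\<Union>g\<in>carrier G. conj_set G R g)"
    have Rc: "R \<subseteq> carrier G" using D(1) by (auto simp: R_def dest: subgroup.mem_carrier)
    have conjR: "inv g \<otimes> x \<otimes> g \<in> H" if g: "g \<in> carrier G" and "x \<in> R" for g x
    proof -
      obtain r where r: "x \<in> D" "Factorial_Ring.prime r" "r \<notin> sigma i" "q_elt r x"
        using \<open>x \<in> R\<close> by (auto simp: R_def)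
      obtain a b where ab: "a \<in> Y" "b \<in> proj_closure i" "g = a \<otimes> b"
        using g unfolding factor[symmetric] by (rule set_multE)
      have bNE: "b \<in> NE" using ab(2) PiNE by blast
      have c: "a \<in> carrier G" "b \<in> carrier G" "x \<in> carrier G"
        using ab(1) y(3) bNE q_elt_closed[OF r(4)] by (auto simp: NE_def)
      define z where "z = inv a \<otimes> x \<otimes> a"
      have "z \<in> D" using ab(1) YND r(1) by (auto simp: ND_def z_def)
      moreover have "q_elt r z" unfolding z_def using r(4) c(1) by (rule q_elt_conj)
      ultimately have "z \<in> E" using r(2,3) D(2) unfolding E_def by (auto intro!: generate.incl simp: E0_def)
      then have "inv b \<otimes> z \<otimes> b \<in> E" using bNE by (simp add: NE_def)
      moreover have "inv b \<otimes> z \<otimes> b = inv g \<otimes> x \<otimes> g"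
        using c by (simp add: z_def ab(3) m_assoc inv_mult_group)
      ultimately show ?thesis using E(2) by auto
    qed
    have Wn: "normal_in W (carrier G)" and RW: "R \<subseteq> W"
      unfolding W_def using normal_in_conj_closure[OF Rc subgroup_self] by auto
    have "W \<subseteq> H" unfolding W_def
      using conjR Hs by (intro generate_subgroup_incl) (auto simp: conj_set_def)
    with Wn have "W = {\<one>}" by (rule corefree)
    then show ?thesis unfolding pi_over_def using RW by (auto simp: R_def)
  qed
  obtain U where U: "normal_in U (carrier G)" "pi_over (sigma i) {\<one>} U" "D \<subseteq> U"
  proof (rule normalized_pi_subgroup[OF Y Ypi D(1) Dpi])
    show "inv a \<otimes> d \<otimes> a \<in> D" if "a \<in> Y" "d \<in> D" for a d using that YND by (auto simp: ND_def)
  qed blast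
  show thesis
  proof (rule that[OF U(1,2)])
    fix q x assume "Factorial_Ring.prime q" "q \<in> sigma i" "x \<in> H" "q_elt q x"
    then have "x \<in> D" unfolding D_def by (auto intro!: generate.incl simp: D0_def)
    then show "x \<in> U" using U(3) by blast
  qed
qed

end

section \<open>Residuals of permutable subgroups\<close>

locale projector_quotient = projector_system + fin_quotient
begin

definition PPq :: "'c \<Rightarrow> 'a set set set" where
  "PPq i = (\<lambda>Q. proj ` Q) ` PP i"

lemma PP_carrier: "i \<in> I \<Longrightarrow> Q \<in> PP i \<Longrightarrow> Q \<subseteq> carrier G"
  using PP_subgroup by (blast dest: subgroup.subset)

sublocale qp: projector_system quo I sigma PPq
proof (intro projector_system.intro projector_system_axioms.intro)
  show "fin_group quo" by (rule q.fin_group_axioms)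
  show "prime_partition I sigma" by (rule partition)
  fix i assume i: "i \<in> I"
  show "PPq i \<noteq> {}" using PP_nonempty[OF i] by (simp add: PPq_def)
  fix B assume "B \<in> PPq i"
  then obtain Q where Q: "Q \<in> PP i" "B = proj ` Q" by (auto simp: PPq_def)
  note Qs = PP_subgroup[OF i Q(1)] and Qc = PP_carrier[OF i Q(1)]
  show "subgroup B quo" unfolding Q(2) using Qs by (rule image_subgroup)
  have "q.pi_over (sigma i) (proj ` {\<one>}) (proj ` Q)" using Qs PP_pi[OF i Q(1)] by (rule image_pi_over)
  then show "q.pi_over (sigma i) {\<one>\<^bsub>quo\<^esub>} B" unfolding Q(2) by (simp del: one_FactGroup)
  show "conj_set quo B w \<in> PPq i" if w: "w \<in> carrier quo" for w
  proof -
    obtain x where x: "x \<in> carrier G" "w = proj x" using w by (auto simp: carrier_quo)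
    have "conj_set quo B w = proj ` conj_set G Q x" unfolding Q(2) x(2) using Qc x(1) by (rule image_conj_set[symmetric])
    then show ?thesis using PP_conj[OF i Q(1) x(1)] by (auto simp: PPq_def)
  qed
  fix N V assume N: "q.normal_in N (carrier quo)" and V: "subgroup V quo" and sub: "B \<subseteq> V" "N \<subseteq> V"
    and over: "q.pi_over (sigma i) N V"
  have Nc: "N \<subseteq> carrier quo" and Vc: "V \<subseteq> carrier quo" using q.normal_inD(3)[OF N] V by (auto dest: subgroup.mem_carrier)
  have pN: "pre N \<subseteq> carrier G" by (auto simp: pre_def)
  have "pre V \<subseteq> Q <#> pre N"
  proof (rule PP_max[OF i Q(1) pre_normal_in[OF N] pre_subgroup[OF V]])
    show "Q \<subseteq> pre V" using sub(1) Qc unfolding Q(2) by (auto simp: pre_def)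
    show "pre N \<subseteq> pre V" using sub(2) by (rule pre_mono)
    show "pi_over (sigma i) (pre N) (pre V)" using over by (rule pre_pi_over)
  qed
  then have "proj ` pre V \<subseteq> proj ` (Q <#> pre N)" by blast
  then show "V \<subseteq> B <#>\<^bsub>quo\<^esub> N"
    unfolding image_set_mult[OF Qc pN] image_pre[OF Nc] image_pre[OF Vc] Q(2) .
qed

lemma image_permutable:
  assumes H: "permutable H"
  shows "qp.permutable (proj ` H)"
  unfolding qp.permutable_def
proof (intro conjI ballI)
  note Hs = permutable_subgroup[OF H]
  have Hc: "H \<subseteq> carrier G" using Hs by (rule subgroup.subset)
  show "subgroup (proj ` H) quo" using Hs by (rule image_subgroup)
  fix i B assume i: "i \<in> I" and "B \<in> PPq i"
  then obtain Q where Q: "Q \<in> PP i" "B = proj ` Q" by (auto simp: PPq_def)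
  have Qc: "Q \<subseteq> carrier G" using i Q(1) by (rule PP_carrier)
  have "H <#> Q = Q <#> H" using H i Q(1) by (auto simp: permutable_def)
  then show "proj ` H <#>\<^bsub>quo\<^esub> B = B <#>\<^bsub>quo\<^esub> proj ` H"
    unfolding Q(2) using image_set_mult[OF Hc Qc] image_set_mult[OF Qc Hc] by simp
qed

end

context projector_system
begin

lemma permutable_mult_normal:
  assumes H: "permutable H" and M: "normal_in M (carrier G)"
  shows "permutable (H <#> M)"
  unfolding permutable_def
proof (intro conjI ballI)
  note Hs = permutable_subgroup[OF H] and m = normal_inD[OF M]
  have Hc: "H \<subseteq> carrier G" using Hs by (rule subgroup.subset)
  have comm: "A <#> M = M <#> A" if "subgroup A G" for A
    using that m(1) by (rule normalized_permute) (use m that in \<open>auto dest: subgroup.mem_carrier\<close>)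
  show "subgroup (H <#> M) G" using Hs m(1) comm[OF Hs] by (rule permuting_subgroup)
  fix i Q assume i: "i \<in> I" and Q: "Q \<in> PP i"
  note Qs = PP_subgroup[OF i Q]
  have Qc: "Q \<subseteq> carrier G" using Qs by (rule subgroup.subset)
  have "H <#> M <#> Q = H <#> (Q <#> M)" using set_mult_assoc[OF Hc m(3) Qc] comm[OF Qs] by simp
  also have "\<dots> = Q <#> H <#> M" using set_mult_assoc[OF Hc Qc m(3)] H i Q by (simp add: permutable_def)
  finally show "H <#> M <#> Q = Q <#> (H <#> M)" using set_mult_assoc[OF Qc Hc m(3)] by simp
qed

text \<open>The preimage of \<open>N\<close> is a normal subgroup of \<open>G\<close> inside \<open>H\<close>, so it lies in the core
  \<open>K\<close>.\<close>

lemma core_quotient_corefree: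
  assumes Q: "fin_quotient G K" and Hs: "subgroup H G" and KH: "K \<subseteq> H"
    and core: "\<And>N. normal_in N (carrier G) \<Longrightarrow> N \<subseteq> H \<Longrightarrow> N \<subseteq> K"
    and N: "group.normal_in (G Mod K) N (carrier (G Mod K))" "N \<subseteq> fin_quotient.proj G K ` H"
  shows "N = {\<one>\<^bsub>G Mod K\<^esub>}"
proof -
  interpret Q: fin_quotient G K by (rule Q)
  have "Q.pre N \<subseteq> H" using Q.pre_mono[OF N(2)] Q.pre_image[OF Hs KH] by simp
  with Q.pre_normal_in[OF N(1)] have "Q.pre N \<subseteq> K" by (rule core)
  then have "Q.proj x = \<one>\<^bsub>Q.quo\<^esub>" if "x \<in> Q.pre N" for x
    using that Q.proj_eq_one_iff[of x] Q.K_facts(3) by blast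
  then have "Q.proj ` Q.pre N \<subseteq> {\<one>\<^bsub>Q.quo\<^esub>}" by blast
  then have "N \<subseteq> {\<one>\<^bsub>Q.quo\<^esub>}" using Q.image_pre[OF Q.q.normal_inD(3)[OF N(1)]] by simp
  then show ?thesis using subgroup.one_closed[OF Q.q.normal_inD(1)[OF N(1)]] by blast
qed

text \<open>Induction on the index of \<open>H\<close>. Modulo the core of \<open>H\<close> choose a minimal normal
  subgroup. Its preimage \<open>L\<close> is not contained in \<open>H\<close>, so the inductive hypothesis applies to
  \<open>H <#> L\<close>, and \<open>corefree_pi_over\<close> in the quotient gives the assertion.\<close>

lemma permutable_pi_over:
  assumes "permutable H" "i \<in> I" "Q \<in> PP i"
  shows "pi_over (sigma i) H (H <#> Q)"
  using assms
proof (induction "card (carrier G) - card H" arbitrary: H i Q rule: less_induct)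
  case less
  note H = less.prems(1) and i = less.prems(2) and Q = less.prems(3)
  note Hs = permutable_subgroup[OF H]
  have Hc: "H \<subseteq> carrier G" using Hs by (rule subgroup.subset)
  define K where "K = normal_core G H"
  have K: "normal_in K (carrier G)" "K \<subseteq> H" and core: "\<And>N. normal_in N (carrier G) \<Longrightarrow> N \<subseteq> H \<Longrightarrow> N \<subseteq> K"
    using normal_core_greatest[OF Hs] by (auto simp: K_def normal_in_carrier_iff)
  interpret R: projector_quotient G I sigma PP K by unfold_locales (rule K)
  have Qc: "Q \<subseteq> carrier G" using i Q by (rule R.PP_carrier)
  show ?case
  proof (cases "carrier R.quo = {\<one>\<^bsub>R.quo\<^esub>}")
    case True
    have "carrier G \<subseteq> K"
    proof
      fix x assume x: "x \<in> carrier G"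
      then have "R.proj x = \<one>\<^bsub>R.quo\<^esub>" using True R.carrier_quo by blast
      then show "x \<in> K" using R.proj_eq_one_iff[OF x] by simp
    qed
    then have "carrier G \<subseteq> H" using K(2) by blast
    then show ?thesis unfolding pi_over_def using q_elt_closed by blast
  next
    case False
    obtain M where M: "R.q.minimal_normal M (carrier R.quo)"
      using R.q.minimal_normal_exists[OF R.q.normal_in_refl[OF R.q.subgroup_self] False] by blast
    note m = R.q.minimal_normalD[OF M]
    have Mc: "M \<subseteq> carrier R.quo" using m(1) by (rule R.q.normal_inD(3))
    define L where "L = R.pre M"
    have L: "normal_in L (carrier G)" unfolding L_def using m(1) by (rule R.pre_normal_in)
    note l = normal_inD[OF L]
    have HL: "permutable (H <#> L)" using H L by (rule permutable_mult_normal)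
    note HLs = permutable_subgroup[OF HL]
    have sub: "H \<subseteq> H <#> L" "L \<subseteq> H <#> L" using subgroup_set_mult_subsets[OF Hs l(1)] .
    have "H \<noteq> H <#> L"
    proof
      assume "H = H <#> L"
      then have "L \<subseteq> K" using sub(2) L by (intro core) auto
      then have "R.proj x = \<one>\<^bsub>R.quo\<^esub>" if "x \<in> L" for x
        using that R.proj_eq_one_iff[of x] R.K_facts(3) by blast
      then have "R.proj ` L \<subseteq> {\<one>\<^bsub>R.quo\<^esub>}" by blast
      then have "M \<subseteq> {\<one>\<^bsub>R.quo\<^esub>}" using R.image_pre[OF Mc] by (simp add: L_def)
      then show False using m(2) subgroup.one_closed[OF R.q.normal_inD(1)[OF m(1)]] by blast
    qed
    then have "card H < card (H <#> L)"
      using sub(1) finite_subgroup[OF HLs] by (meson psubsetI psubset_card_mono)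
    moreover have "card (H <#> L) \<le> card (carrier G)" using subgroup.subset[OF HLs] fin by (intro card_mono)
    ultimately have IH: "pi_over (sigma j) (H <#> L) (H <#> L <#> P)" if "j \<in> I" "P \<in> PP j" for j P
      using less.hyps[OF _ HL that] by simp
    have HM: "R.proj ` (H <#> L) = R.proj ` H <#>\<^bsub>R.quo\<^esub> M"
      using R.image_set_mult[OF Hc l(3)] R.image_pre[OF Mc] by (simp add: L_def)
    interpret S: corefree_step R.quo I sigma R.PPq "R.proj ` H" M
    proof (intro corefree_step.intro corefree_step_axioms.intro)
      show "projector_system R.quo I sigma R.PPq" by (rule R.qp.projector_system_axioms)
      show "R.qp.permutable (R.proj ` H)" using H by (rule R.image_permutable)
      show "R.q.minimal_normal M (carrier R.quo)" by (rule M)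
      show "N = {\<one>\<^bsub>R.quo\<^esub>}" if "R.q.normal_in N (carrier R.quo)" "N \<subseteq> R.proj ` H" for N
        using R.fin_quotient_axioms Hs K(2) core that by (rule core_quotient_corefree)
      fix j B assume j: "j \<in> I" and "B \<in> R.PPq j"
      then obtain P where P: "P \<in> PP j" "B = R.proj ` P" by (auto simp: R.PPq_def)
      have Pc: "P \<subseteq> carrier G" using j P(1) by (rule R.PP_carrier)
      have "R.q.pi_over (sigma j) (R.proj ` (H <#> L)) (R.proj ` (H <#> L <#> P))"
        using permutable_product(1)[OF HL j P(1)] IH[OF j P(1)] by (rule R.image_pi_over)
      then show "R.q.pi_over (sigma j) (R.proj ` H <#>\<^bsub>R.quo\<^esub> M) (R.proj ` H <#>\<^bsub>R.quo\<^esub> M <#>\<^bsub>R.quo\<^esub> B)"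
        unfolding R.image_set_mult[OF subgroup.subset[OF HLs] Pc] HM P(2) .
    qed
    have "R.q.pi_over (sigma i) (R.proj ` H) (R.proj ` H <#>\<^bsub>R.quo\<^esub> R.proj ` Q)"
      using i Q by (intro S.corefree_pi_over) (auto simp: R.PPq_def)
    then have "R.q.pi_over (sigma i) (R.proj ` H) (R.proj ` (H <#> Q))"
      using R.image_set_mult[OF Hc Qc] by simp
    then have "pi_over (sigma i) (R.pre (R.proj ` H)) (R.pre (R.proj ` (H <#> Q)))" by (rule R.pre_pi_over)
    moreover have "H <#> Q \<subseteq> R.pre (R.proj ` (H <#> Q))"
      using setmult_subset_G[OF Hc Qc] by (auto simp: R.pre_def)
    ultimately show ?thesis unfolding R.pre_image[OF Hs K(2)] by (rule pi_over_mono[OF _ order_refl])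
  qed
qed

end

section \<open>A criterion for \<open>\<sigma>\<close>-nilpotency\<close>

context fin_group
begin

lemma pi_subgroup_iff: "pi_subgroup ps V G \<longleftrightarrow> subgroup V G \<and> pi_over ps {\<one>} V"
proof (cases "subgroup V G")
  case True
  have "group (G\<lparr>carrier := V\<rparr>)" using True by (rule subgroup.subgroup_is_group) (rule is_group)
  then show ?thesis
    using True finite_subgroup[OF True] pi_over_Cauchy[OF True]
    by (simp add: pi_subgroup_def pi_group_def order_def)
qed (simp add: pi_subgroup_def)

text \<open>An element of \<open>N\<close> whose order is a power of a prime in \<open>sigma i\<close> lies in \<open>U i\<close>,
  because the other factors generate a normal subgroup of order prime to \<open>sigma i\<close>. Hence the
  intersections \<open>N \<inter> U i\<close> are Hall subgroups of \<open>N\<close>, and they form its direct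
  decomposition.\<close>

lemma sigma_nilpotent_if_generated:
  fixes I :: "'i set" and sigma :: "'i \<Rightarrow> nat set"
  assumes part: "prime_partition I sigma" and N: "normal_in N (carrier G)"
    and U: "\<And>i. i \<in> I \<Longrightarrow> normal_in (U i) (carrier G)" "\<And>i. i \<in> I \<Longrightarrow> pi_over (sigma i) {\<one>} (U i)"
    and NU: "N \<subseteq> generate G (\<Union>i\<in>I. U i)"
  shows "sigma_nilpotent I sigma (G\<lparr>carrier := N\<rparr>)"
proof -
  let ?N = "G\<lparr>carrier := N\<rparr>"
  note n = normal_inD[OF N]
  have Us: "subgroup (U i) G" if "i \<in> I" for i using U(1)[OF that] by (rule normal_inD(1))
  interpret N: group ?N using n(1) by (rule subgroup.subgroup_is_group) (rule is_group)
  define R where "R i = generate G (\<Union>(U ` (I - {i})))" for i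
  have unique: "i = j" if "i \<in> I" "j \<in> I" "q \<in> sigma i" "q \<in> sigma j" for i j q
    using part that unfolding prime_partition_def disjoint_family_on_def by blast
  have Uc: "U i \<subseteq> carrier G" if "i \<in> I" for i using U(1)[OF that] by (rule normal_inD(3))
  have Rpi: "pi_over (- sigma i) {\<one>} (R i)" if i: "i \<in> I" for i
    unfolding R_def
  proof (rule pi_over_generate_normal[OF subgroup_self])
    fix V assume "V \<in> U ` (I - {i})"
    then obtain j where j: "j \<in> I" "j \<noteq> i" "V = U j" by auto
    have "pi_over (- sigma i) {\<one>} V" unfolding pi_over_def
    proof (intro allI impI)
      fix q x assume q: "Factorial_Ring.prime q" "q \<notin> - sigma i" and x: "x \<in> V" "q_elt q x"
      have "q \<notin> sigma j" using q(2) unique[OF i j(1)] j(2) by blast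
      then show "x \<in> {\<one>}" using pi_overD[OF U(2)[OF j(1)] q(1) _ _ x(2)] x(1) j(3) by blast
    qed
    then show "normal_in V (carrier G) \<and> pi_over (- sigma i) {\<one>} V" using U(1)[OF j(1)] j(3) by simp
  qed
  have Rs: "normal_in (R i) (carrier G)" for i unfolding R_def
  proof (rule normal_in_generate[OF _ subgroup_self])
    show "\<Union>(U ` (I - {i})) \<subseteq> carrier G" using Uc by blast
    fix x s assume x: "x \<in> carrier G" and "s \<in> \<Union>(U ` (I - {i}))"
    then obtain j where j: "j \<in> I - {i}" "s \<in> U j" by blast
    then show "inv x \<otimes> s \<otimes> x \<in> \<Union>(U ` (I - {i}))" using normal_inD(4)[OF U(1) x] by blast
  qed
  have mem: "x \<in> U i" if i: "i \<in> I" and q: "Factorial_Ring.prime q" "q \<in> sigma i" and x: "x \<in> N" "q_elt q x" for i q x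
  proof -
    note u = normal_inD[OF U(1)[OF i]] and r = normal_inD[OF Rs[of i]]
    have "U i <#> R i = R i <#> U i" using u(1) r(1) by (rule normalized_permute) (use r u in auto)
    then have s: "subgroup (U i <#> R i) G" using u(1) r(1) by (intro permuting_subgroup)
    have sub: "U i \<subseteq> U i <#> R i" "R i \<subseteq> U i <#> R i" using subgroup_set_mult_subsets[OF u(1) r(1)] .
    have "U j \<subseteq> U i <#> R i" if j: "j \<in> I" for j
    proof (cases "j = i")
      case False
      then have "U j \<subseteq> R i" unfolding R_def using j by (auto intro: generate.incl)
      then show ?thesis using sub(2) by blast
    qed (use sub in simp)
    then have "N \<subseteq> U i <#> R i" using NU generate_subgroup_incl[OF _ s, of "\<Union>i\<in>I. U i"] by blast
    then have xs: "x \<in> U i <#> R i" using x(1) by blast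
    obtain m where m: "card (U i <#> R i) = card (U i) * m" "m dvd card (R i)"
      using index_permuting[OF u(1) r(1)] by blast
    have nor: "normal_in (U i) (U i <#> R i)"
      using U(1)[OF i] s sub(1) by (rule normal_in_subset) (simp add: s subgroup.subset)
    have "\<not> q dvd m"
    proof
      assume "q dvd m"
      then have "q dvd card (R i)" using m(2) by (rule dvd_trans)
      then have "q \<in> - sigma i" using iffD1[OF pi_over_Cauchy[OF r(1)] Rpi[OF i]] q(1) by blast
      then show False using q(2) by blast
    qed
    then show ?thesis using q_elt_mem_normal[OF nor m(1) q(1) _ xs x(2)] by blast
  qed
  define A where "A i = N \<inter> U i" for i
  have As: "subgroup (A i) G" if "i \<in> I" for i
    unfolding A_def using n(1) Us[OF that] by (rule subgroups_Inter_pair)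
  have Asub: "A i \<subseteq> N" for i by (auto simp: A_def)
  have AN: "subgroup (A i) ?N" if "i \<in> I" for i using As[OF that] n(1) Asub by (rule subgroup_incl)
  have Apos: "card (A i) > 0" if "i \<in> I" for i using As[OF that] by (rule card_subgroup_pos)
  have Api: "pi_over (sigma i) {\<one>} (A i)" if "i \<in> I" for i
    using U(2)[OF that] by (rule pi_over_mono) (auto simp: A_def)
  have hall: "hall_subgroup (sigma i) (A i) ?N" if i: "i \<in> I" for i
    unfolding hall_subgroup_def
  proof (intro conjI ballI impI)
    have "pi_subgroup (sigma i) (A i) G" using As[OF i] Api[OF i] by (simp add: pi_subgroup_iff)
    then show "pi_subgroup (sigma i) (A i) ?N" using AN[OF i] by (simp add: pi_subgroup_def)
    fix q assume q: "q \<in> sigma i" "Factorial_Ring.prime q"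
    have "card N = card (A i) * card (rcosets\<^bsub>?N\<^esub> A i)"
      using N.lagrange[OF AN[OF i]] by (simp add: order_def mult.commute)
    then show "\<not> q dvd card (rcosets\<^bsub>?N\<^esub> A i)"
      using mem[OF i q(2,1)] by (intro index_coprime_if_q_elts[OF As[OF i] n(1) Asub q(2)]) (auto simp: A_def)
  qed
  have gen: "generate ?N S = generate G S" if "S \<subseteq> N" for S
    using generate_consistent[OF that n(1)] by simp
  have idp: "internal_direct_product ?N I A"
    unfolding internal_direct_product_def
  proof (intro conjI ballI)
    fix i assume i: "i \<in> I"
    have "normal_in (N \<inter> U i) (carrier G)" using N U(1)[OF i] by (rule normal_in_Int2)
    then have "normal_in (A i) N" unfolding A_def
      using n(1) by (rule normal_in_subset) (use n(3) in auto)
    then show "A i \<lhd> ?N" by (rule normal_in_restrict)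
    show "A i \<inter> generate ?N (\<Union>j\<in>I - {i}. A j) = {\<one>\<^bsub>?N\<^esub>}"
    proof -
      have sub: "(\<Union>j\<in>I - {i}. A j) \<subseteq> N" using Asub by blast
      define B where "B = A i \<inter> generate G (\<Union>j\<in>I - {i}. A j)"
      have c: "(\<Union>j\<in>I - {i}. A j) \<subseteq> carrier G" using sub n(3) by blast
      have B: "subgroup B G" unfolding B_def
        using As[OF i] generate_is_subgroup[OF c] by (rule subgroups_Inter_pair)
      have "generate G (\<Union>j\<in>I - {i}. A j) \<subseteq> R i" unfolding R_def
        using Uc by (intro mono_generate) (auto simp: A_def)
      then have BR: "B \<subseteq> R i" by (auto simp: B_def)
      have "{\<one>} = B"
      proof (rule all_q_elts_imp_eq[OF triv_subgroup B])
        show "{\<one>} \<subseteq> B" using subgroup.one_closed[OF B] by simp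
        fix q x assume q: "Factorial_Ring.prime q" and x: "x \<in> B" "q_elt q x"
        show "x \<in> {\<one>}"
        proof (cases "q \<in> sigma i")
          case True
          then show ?thesis using pi_overD[OF Rpi[OF i] q _ _ x(2)] x(1) BR by blast
        next
          case False
          then show ?thesis using pi_overD[OF Api[OF i] q _ _ x(2)] x(1) by (auto simp: B_def)
        qed
      qed
      then show ?thesis using gen[OF sub] by (simp add: B_def)
    qed
  next
    have sub: "(\<Union>i\<in>I. A i) \<subseteq> N" using Asub by blast
    have "generate G (\<Union>i\<in>I. A i) = N"
    proof (rule all_q_elts_imp_eq[OF _ n(1)])
      show "subgroup (generate G (\<Union>i\<in>I. A i)) G" using sub n(3) by (intro generate_is_subgroup) auto
      show "generate G (\<Union>i\<in>I. A i) \<subseteq> N" using sub n(1) by (rule generate_subgroup_incl)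
      fix q x assume q: "Factorial_Ring.prime q" and x: "x \<in> N" "q_elt q x"
      obtain i where i: "i \<in> I" "q \<in> sigma i" using part q unfolding prime_partition_def by blast
      then have "x \<in> A i" using mem[OF i(1) q i(2) x] x(1) by (simp add: A_def)
      then show "x \<in> generate G (\<Union>i\<in>I. A i)" using i(1) by (intro generate.incl) blast
    qed
    then show "generate ?N (\<Union>i\<in>I. A i) = carrier ?N" using gen[OF sub] by simp
  qed
  show ?thesis
    unfolding sigma_nilpotent_def
    using N.is_group finite_subgroup[OF n(1)] hall idp by auto
qed

end

section \<open>Conjugates of projectors and the main result\<close>

context fin_group
begin

text \<open>The image of \<open>P <#> N\<close> in the quotient is maximal among the \<open>ps\<close>-subgroups, and the
  image of \<open>V\<close> is one of them.\<close>

lemma pi_projector_absorbs: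
  assumes P: "pi_projector ps P G" and N: "normal_in N (carrier G)" and V: "subgroup V G"
    and sub: "P \<subseteq> V" "N \<subseteq> V" and over: "pi_over ps N V"
  shows "V \<subseteq> P <#> N"
proof -
  interpret R: fin_quotient G N by unfold_locales (rule N)
  have Ps: "subgroup P G" using P by (simp add: pi_projector_def)
  note n = normal_inD[OF N]
  have Pc: "P \<subseteq> carrier G" using Ps by (rule subgroup.subset)
  have "P <#> N = N <#> P" using Ps n(1) by (rule normalized_permute) (use n Pc in auto)
  then have PN: "subgroup (P <#> N) G" using Ps n(1) by (intro permuting_subgroup)
  have subPN: "P \<subseteq> P <#> N" "N \<subseteq> P <#> N" using subgroup_set_mult_subsets[OF Ps n(1)] .
  have "rcosets\<^bsub>G\<lparr>carrier := P <#> N\<rparr>\<^esub> N = R.proj ` (P <#> N)"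
    by (auto simp: RCOSETS_def R.proj_def r_coset_def)
  then have max: "pi_maximal ps (R.proj ` (P <#> N)) R.quo"
    using P R.K_normal unfolding pi_projector_def by metis
  have one: "R.proj ` N = {\<one>\<^bsub>R.quo\<^esub>}"
  proof
    show "R.proj ` N \<subseteq> {\<one>\<^bsub>R.quo\<^esub>}"
    proof
      fix w assume "w \<in> R.proj ` N"
      then obtain x where x: "x \<in> N" "w = R.proj x" by blast
      then show "w \<in> {\<one>\<^bsub>R.quo\<^esub>}" using R.proj_eq_one_iff[of x] n(3) by blast
    qed
    show "{\<one>\<^bsub>R.quo\<^esub>} \<subseteq> R.proj ` N" using subgroup.one_closed[OF n(1)] R.hom.hom_one by blast
  qed
  have "R.q.pi_over ps (R.proj ` N) (R.proj ` V)" using V over by (rule R.image_pi_over)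
  then have "pi_subgroup ps (R.proj ` V) R.quo"
    using R.image_subgroup[OF V] unfolding R.q.pi_subgroup_iff one by blast
  then have "\<not> R.proj ` (P <#> N) \<subset> R.proj ` V" using max by (simp add: pi_maximal_def)
  moreover have "R.proj ` (P <#> N) \<subseteq> R.proj ` V"
    using set_mult_least[OF V sub] by (rule image_mono)
  ultimately have "R.proj ` V = R.proj ` (P <#> N)" by blast
  then have "V \<subseteq> R.pre (R.proj ` (P <#> N))" using R.pre_image[OF V sub(2)] by simp
  then show ?thesis using R.pre_image[OF PN subPN(2)] by simp
qed

lemma pi_projector_pi_over:
  assumes P: "pi_projector ps P G"
  shows "pi_over ps {\<one>} P"
proof -
  have N: "normal_in {\<one>} (carrier G)" using subgroup_self by (rule normal_in_one)
  interpret R: fin_quotient G "{\<one>}" by unfold_locales (rule N)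
  have Ps: "subgroup P G" using P by (simp add: pi_projector_def)
  have "P <#> {\<one>} = P" using Ps by (auto simp: set_mult_def subgroup.mem_carrier)
  then have "rcosets\<^bsub>G\<lparr>carrier := P <#> {\<one>}\<rparr>\<^esub> {\<one>} = R.proj ` P"
    by (auto simp: RCOSETS_def R.proj_def r_coset_def)
  then have "pi_maximal ps (R.proj ` P) R.quo"
    using P R.K_normal unfolding pi_projector_def by metis
  then have over: "R.q.pi_over ps {\<one>\<^bsub>R.quo\<^esub>} (R.proj ` P)"
    unfolding pi_maximal_def R.q.pi_subgroup_iff by blast
  show ?thesis unfolding pi_over_def
  proof (intro allI impI)
    fix q x assume q: "Factorial_Ring.prime q" "q \<notin> ps" and x: "x \<in> P" "q_elt q x"
    have "R.proj x \<in> {\<one>\<^bsub>R.quo\<^esub>}" using R.q.pi_overD[OF over q _ R.image_q_elt[OF x(2)]] x(1) by blast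
    then show "x \<in> {\<one>}" using R.proj_eq_one_iff[OF q_elt_closed[OF x(2)]] by blast
  qed
qed

lemma projector_system_conjugates:
  fixes I :: "'i set" and sigma :: "'i \<Rightarrow> nat set"
  assumes part: "prime_partition I sigma" and P: "\<And>i. i \<in> I \<Longrightarrow> pi_projector (sigma i) (P i) G"
  shows "projector_system G I sigma (\<lambda>i. conj_set G (P i) ` carrier G)"
proof (intro projector_system.intro projector_system_axioms.intro)
  show "fin_group G" by (rule fin_group_axioms)
  show "prime_partition I sigma" by (rule part)
  fix i assume i: "i \<in> I"
  have Ps: "subgroup (P i) G" using P[OF i] by (simp add: pi_projector_def)
  have Pc: "P i \<subseteq> carrier G" using Ps by (rule subgroup.subset)
  show "conj_set G (P i) ` carrier G \<noteq> {}" by (simp add: carrier_not_empty)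
  fix Q assume "Q \<in> conj_set G (P i) ` carrier G"
  then obtain x where x: "x \<in> carrier G" "Q = conj_set G (P i) x" by blast
  have Qs: "subgroup Q G" unfolding x(2) using Ps x(1) by (rule conj_set_subgroup)
  have Qx: "conj_set G Q (inv x) = P i" unfolding x(2) using Pc x(1) by (rule conj_set_inverse)
  show "subgroup Q G" by (rule Qs)
  show "pi_over (sigma i) {\<one>} Q"
    using Qs inv_closed[OF x(1)] by (rule pi_over_conj_set) (simp add: Qx pi_projector_pi_over[OF P[OF i]])
  show "conj_set G Q y \<in> conj_set G (P i) ` carrier G" if "y \<in> carrier G" for y
    unfolding x(2) using conj_set_conj_set[OF Pc x(1) that] x(1) that by simp
  fix N V assume N: "normal_in N (carrier G)" and V: "subgroup V G" and QV: "Q \<subseteq> V" and NV: "N \<subseteq> V"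
    and over: "pi_over (sigma i) N V"
  define V' where "V' = conj_set G V (inv x)"
  have Vc: "V \<subseteq> carrier G" using V by (rule subgroup.subset)
  have xi: "inv x \<in> carrier G" using x(1) by simp
  have Nc: "N \<subseteq> carrier G" using N by (rule normal_inD(3))
  have "V' \<subseteq> P i <#> N"
  proof (rule pi_projector_absorbs[OF P[OF i] N])
    show "subgroup V' G" unfolding V'_def using V xi by (rule conj_set_subgroup)
    show "P i \<subseteq> V'" unfolding V'_def Qx[symmetric] using QV by (rule conj_set_mono)
    show "N \<subseteq> V'" unfolding V'_def using conj_set_mono[OF NV, of "inv x"] normal_in_conj_set[OF N xi] by simp
    show "pi_over (sigma i) N V'" unfolding pi_over_def
    proof (intro allI impI)
      fix q v assume q: "Factorial_Ring.prime q" "q \<notin> sigma i" and v: "v \<in> V'" "q_elt q v"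
      have vc: "v \<in> carrier G" using v(2) by (rule q_elt_closed)
      have "inv x \<otimes> v \<otimes> x \<in> V" using v(1) conj_set_mem_iff[OF Vc xi vc] x(1) by (simp add: V'_def)
      then have "inv x \<otimes> v \<otimes> x \<in> N" using pi_overD[OF over q _ q_elt_conj[OF v(2) x(1)]] by blast
      then have "x \<otimes> (inv x \<otimes> v \<otimes> x) \<otimes> inv x \<in> N" by (rule normal_inD(5)[OF N x(1)])
      then show "v \<in> N" using vc x(1) by (simp add: m_assoc)
    qed
  qed
  then have "conj_set G V' x \<subseteq> conj_set G (P i <#> N) x" by (rule conj_set_mono)
  then show "V \<subseteq> Q <#> N"
    unfolding V'_def conj_set_inverse(2)[OF Vc x(1)] conj_set_set_mult[OF Pc Nc x(1)]
      normal_in_conj_set[OF N x(1)] x(2) .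
qed

end

theorem theorem2:
  fixes G :: "('a, 'b) monoid_scheme"
    and I :: "'i set" and sigma :: "'i \<Rightarrow> nat set"
    and H :: "'a set"
  assumes "prime_partition I sigma"
    and "group G" and "finite (carrier G)"
    and "sigma3_permutable I sigma H G"
  shows "sigma_nilpotent I sigma (G\<lparr>carrier := normal_closure G H\<rparr> Mod normal_core G H)"
proof -
  interpret fin_group G using assms(2,3) by (simp add: fin_group_def fin_group_axioms_def)
  have Hs: "subgroup H G" using assms(4) by (simp add: sigma3_permutable_def)
  have "\<exists>P. \<forall>i\<in>I. pi_projector (sigma i) (P i) G \<and>
      (\<forall>x\<in>carrier G. H <#>\<^bsub>G\<^esub> conj_set G (P i) x = conj_set G (P i) x <#>\<^bsub>G\<^esub> H)"
    using assms(4) unfolding sigma3_permutable_def by (intro bchoice) blast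
  then obtain P where P: "\<And>i. i \<in> I \<Longrightarrow> pi_projector (sigma i) (P i) G"
    and perm: "\<And>i x. i \<in> I \<Longrightarrow> x \<in> carrier G \<Longrightarrow>
      H <#>\<^bsub>G\<^esub> conj_set G (P i) x = conj_set G (P i) x <#>\<^bsub>G\<^esub> H"
    by blast
  define PP where "PP i = conj_set G (P i) ` carrier G" for i
  interpret projector_system G I sigma PP
    unfolding PP_def using assms(1) P by (rule projector_system_conjugates)
  have H: "permutable H" using Hs perm by (auto simp: permutable_def PP_def)
  define K N where "K = normal_core G H" and "N = normal_closure G H"
  have K: "normal_in K (carrier G)" "K \<subseteq> H"
    and core: "\<And>L. normal_in L (carrier G) \<Longrightarrow> L \<subseteq> H \<Longrightarrow> L \<subseteq> K"
    using normal_core_greatest[OF Hs] by (auto simp: K_def normal_in_carrier_iff)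
  have N: "normal_in N (carrier G)" "H \<subseteq> N"
    and least: "\<And>L. normal_in L (carrier G) \<Longrightarrow> H \<subseteq> L \<Longrightarrow> N \<subseteq> L"
    using normal_closure_least[OF Hs] by (auto simp: N_def normal_in_carrier_iff)
  interpret R: projector_quotient G I sigma PP K by unfold_locales (rule K)
  define H' where "H' = R.proj ` H"
  have H': "R.qp.permutable H'" unfolding H'_def using H by (rule R.image_permutable)
  note H's = R.qp.permutable_subgroup[OF H']
  have corefree: "L = {\<one>\<^bsub>R.quo\<^esub>}" if "R.q.normal_in L (carrier R.quo)" "L \<subseteq> H'" for L
    using R.fin_quotient_axioms Hs K(2) core that unfolding H'_def by (rule core_quotient_corefree)
  have "\<exists>U. R.q.normal_in U (carrier R.quo) \<and> R.q.pi_over (sigma i) {\<one>\<^bsub>R.quo\<^esub>} U \<and>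
      (\<forall>q x. Factorial_Ring.prime q \<longrightarrow> q \<in> sigma i \<longrightarrow> x \<in> H' \<longrightarrow> R.q.q_elt q x \<longrightarrow> x \<in> U)" if i: "i \<in> I" for i
    using R.qp.corefree_pi_part[OF H' corefree R.qp.permutable_pi_over[OF H'] i] by metis
  then obtain U where U: "\<And>i. i \<in> I \<Longrightarrow> R.q.normal_in (U i) (carrier R.quo)"
    "\<And>i. i \<in> I \<Longrightarrow> R.q.pi_over (sigma i) {\<one>\<^bsub>R.quo\<^esub>} (U i)"
    and HU: "\<And>i q x. i \<in> I \<Longrightarrow> Factorial_Ring.prime q \<Longrightarrow> q \<in> sigma i \<Longrightarrow> x \<in> H' \<Longrightarrow> R.q.q_elt q x \<Longrightarrow> x \<in> U i"
    by metis
  define W where "W = generate R.quo (\<Union>i\<in>I. U i)"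
  have Wn: "R.q.normal_in W (carrier R.quo)" unfolding W_def
  proof (rule R.q.normal_in_generate[OF _ R.q.subgroup_self])
    show "(\<Union>i\<in>I. U i) \<subseteq> carrier R.quo" using R.q.normal_inD(3)[OF U(1)] by blast
    fix x s assume x: "x \<in> carrier R.quo" and "s \<in> (\<Union>i\<in>I. U i)"
    then obtain j where j: "j \<in> I" "s \<in> U j" by blast
    then show "inv\<^bsub>R.quo\<^esub> x \<otimes>\<^bsub>R.quo\<^esub> s \<otimes>\<^bsub>R.quo\<^esub> x \<in> (\<Union>i\<in>I. U i)"
      using R.q.normal_inD(4)[OF U(1)[OF j(1)] x j(2)] by blast
  qed
  note w = R.q.normal_inD[OF Wn]
  have "W \<inter> H' = H'"
  proof (rule R.q.all_q_elts_imp_eq[OF R.q.subgroups_Inter_pair[OF w(1) H's] H's])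
    fix q x assume q: "Factorial_Ring.prime q" and x: "x \<in> H'" "R.q.q_elt q x"
    obtain i where i: "i \<in> I" "q \<in> sigma i" using prime_class[OF q] by blast
    then have "x \<in> U i" using HU[OF i(1) q i(2) x] by simp
    then show "x \<in> W \<inter> H'" using x(1) i(1) unfolding W_def by (blast intro: generate.incl)
  qed simp
  then have "H \<subseteq> R.pre W" using subgroup.mem_carrier[OF Hs] by (auto simp: R.pre_def H'_def)
  then have "N \<subseteq> R.pre W" by (rule least[OF R.pre_normal_in[OF Wn]])
  then have NW: "R.proj ` N \<subseteq> W" by (auto simp: R.pre_def)
  have "sigma_nilpotent I sigma (R.quo\<lparr>carrier := R.proj ` N\<rparr>)"
    using assms(1) R.image_normal_in_carrier[OF N(1)] U NW[unfolded W_def]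
    by (rule R.q.sigma_nilpotent_if_generated)
  moreover have "R.quo\<lparr>carrier := R.proj ` N\<rparr> = G\<lparr>carrier := N\<rparr> Mod K"
  proof -
    have "R.proj ` N = rcosets\<^bsub>G\<lparr>carrier := N\<rparr>\<^esub> K" by (auto simp: RCOSETS_def R.proj_def r_coset_def)
    then show ?thesis by (simp add: FactGroup_def set_mult_def[abs_def])
  qed
  ultimately show ?thesis by (simp add: K_def N_def)
qed

end
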